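(* Let $n\ge2$, let $\Omega\subset\mathbb{R}^n$ be a smooth and bounded domain, and let $m>0$. Let $u_0\in C^1(\Omega)\cap L^\infty(\Omega)$ be strictly positive on $\overline\Omega$, and let $h_0=\dfrac{m|u_0|}{\int_{\partial\Omega}|u_0|\,d\sigma}$ on $\partial\Omega$. For $k\ge0$, inductively let $u_{k+1}\in C^2(\Omega)\cap C^1(\overline\Omega)$ be the unique solution of $$\begin{cases}-\Delta u_{k+1}=R_m(u_k)\,u_k & \text{in }\Omega,\\ u_{k+1}+h_k\,\partial_\nu u_{k+1}=0 & \text{on }\partial\Omega,\end{cases}\qquad\text{and let}\qquad h_{k+1}=\frac{m|u_{k+1}|}{\int_{\partial\Omega}|u_{k+1}|\,d\sigma}\ \text{ on }\partial\Omega.$$ Then for all $k\ge0$: $$R_m(u_{k+1})\,\|u_{k+1}\|_{L^2(\Omega)}\le R_m(u_k)\,\|u_k\|_{L^2(\Omega)},$$ $$\|u_k\|_{L^2(\Omega)}\le\|u_{k+1}\|_{L^2(\Omega)},$$ $$R_m(u_{k+1})\le R_m(u_k).$$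
   Context: Here $\nu$ is the outward-pointing normal vector to $\partial\Omega$, $\partial_\nu u=\nabla u\cdot\nu$, and $\sigma$ is surface measure on $\partial\Omega$. The functional $R_m$ is $$R_m(v)=\frac{\int_\Omega|\nabla v|^2\,dx+\frac1m\left(\int_{\partial\Omega}|v|\,d\sigma\right)^2}{\int_\Omega v^2\,dx},$$ with boundary values of $H^1(\Omega)$ functions taken in the sense of traces. The iteration is well-defined, and all $u_k$ (on $\overline\Omega$) and all $h_k$ (on $\partial\Omega$) are strictly positive. *)

theory Defs
  imports "HOL-Analysis.Analysis"
begin

section \<open>Classical derivatives and function spaces\<close>

text \<open>Functions on a subset of Euclidean space are total functions. The operators below are only
  applied at points of an open set, so the values outside that set do not matter.\<close>

definition partial :: "'a::euclidean_space \<Rightarrow> ('a \<Rightarrow> real) \<Rightarrow> 'a \<Rightarrow> real" where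
  "partial b f x = frechet_derivative f (at x) b"

definition grad :: "('a::euclidean_space \<Rightarrow> real) \<Rightarrow> 'a \<Rightarrow> 'a" where
  "grad f x = (\<Sum>b\<in>Basis. partial b f x *\<^sub>R b)"

definition laplacian :: "('a::euclidean_space \<Rightarrow> real) \<Rightarrow> 'a \<Rightarrow> real" where
  "laplacian f x = (\<Sum>b\<in>Basis. partial b (partial b f) x)"

text \<open>For open \<open>S\<close>, this is membership in $C^k(S)$.\<close>

primrec Ck_on :: "nat \<Rightarrow> 'a set \<Rightarrow> ('a::euclidean_space \<Rightarrow> real) \<Rightarrow> bool" where
  "Ck_on 0 S f \<longleftrightarrow> continuous_on S f"
| "Ck_on (Suc k) S f \<longleftrightarrow> (\<forall>x\<in>S. f differentiable (at x)) \<and> (\<forall>b\<in>Basis. Ck_on k S (partial b f))"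

text \<open>$C^1(\overline\Omega)$: the function and its gradient extend continuously from \<open>\<Omega>\<close> to the
  closure; the values of \<open>u\<close> on the boundary are those of the extension.\<close>

definition C1_closure :: "'a::euclidean_space set \<Rightarrow> ('a \<Rightarrow> real) \<Rightarrow> bool" where
  "C1_closure \<Omega> u \<longleftrightarrow> Ck_on 1 \<Omega> u \<and> continuous_on (closure \<Omega>) u \<and>
     (\<exists>G. continuous_on (closure \<Omega>) G \<and> (\<forall>x\<in>\<Omega>. G x = grad u x))"

section \<open>Smooth domains, outward normal, surface measure\<close>

text \<open>In the open set \<open>U\<close>, the set \<open>\<Omega>\<close> is the part above the graph of the smooth function \<open>\<gamma>\<close>, where
  "up" is the signed coordinate direction \<open>e\<close>. The function \<open>\<gamma>\<close> of the remaining coordinates is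
  encoded as a function on the whole space that does not depend on the coordinate along \<open>e\<close>.\<close>

definition boundary_graph ::
    "'a::euclidean_space set \<Rightarrow> 'a set \<Rightarrow> 'a \<Rightarrow> ('a \<Rightarrow> real) \<Rightarrow> bool" where
  "boundary_graph \<Omega> U e \<gamma> \<longleftrightarrow>
     open U \<and> (e \<in> Basis \<or> - e \<in> Basis) \<and>
     (\<forall>k. Ck_on k UNIV \<gamma>) \<and> (\<forall>x t. \<gamma> (x + t *\<^sub>R e) = \<gamma> x) \<and>
     \<Omega> \<inter> U = {x \<in> U. \<gamma> x < x \<bullet> e}"

definition smooth_bounded_domain :: "'a::euclidean_space set \<Rightarrow> bool" where
  "smooth_bounded_domain \<Omega> \<longleftrightarrow>
     open \<Omega> \<and> connected \<Omega> \<and> \<Omega> \<noteq> {} \<and> bounded \<Omega> \<and>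
     (\<forall>p\<in>frontier \<Omega>. \<exists>U e \<gamma>. p \<in> U \<and> boundary_graph \<Omega> U e \<gamma>)"

text \<open>The outward unit normal at a boundary point \<open>p\<close>: the directions that have a negative
  (positive) component along it lead from \<open>p\<close> into \<open>\<Omega>\<close> (out of its closure). In a local graph
  \<open>\<gamma>\<close> it is $(\nabla\gamma - e)/\sqrt{1+|\nabla\gamma|^2}$.\<close>

definition outward_normal :: "'a::euclidean_space set \<Rightarrow> 'a \<Rightarrow> 'a" where
  "outward_normal \<Omega> p = (THE \<nu>. norm \<nu> = 1 \<and>
     (\<forall>v. v \<bullet> \<nu> < 0 \<longrightarrow> (\<forall>\<^sub>F t in at_right 0. p + t *\<^sub>R v \<in> \<Omega>)) \<and>
     (\<forall>v. v \<bullet> \<nu> > 0 \<longrightarrow> (\<forall>\<^sub>F t in at_right 0. p + t *\<^sub>R v \<notin> closure \<Omega>)))"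

text \<open>For $u \in C^1(\overline\Omega)$ and \<open>p\<close> on the boundary, the gradient at \<open>p\<close> is the value there of
  the continuous extension of the gradient in \<open>\<Omega>\<close>.\<close>

definition normal_deriv :: "'a::euclidean_space set \<Rightarrow> ('a \<Rightarrow> real) \<Rightarrow> 'a \<Rightarrow> real" where
  "normal_deriv \<Omega> u p = Lim (at p within \<Omega>) (grad u) \<bullet> outward_normal \<Omega> p"

text \<open>Lebesgue measure of dimension \<open>DIM('a) - 1\<close> on the coordinate hyperplane orthogonal to \<open>e\<close>,
  where \<open>e\<close> or \<open>- e\<close> is a basis vector.\<close>

definition hyperplane_measure :: "'a::euclidean_space \<Rightarrow> 'a measure" where
  "hyperplane_measure e =
     distr (\<Pi>\<^sub>M b\<in>Basis - {e, - e}. lborel) borel (\<lambda>f. \<Sum>b\<in>Basis - {e, - e}. f b *\<^sub>R b)"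

text \<open>The surface measure of a smooth bounded domain is the Borel measure on the boundary that
  satisfies $d\sigma = \sqrt{1+|\nabla\gamma|^2}\,dy$ in every local graph. Since finitely many local
  graphs cover the compact boundary, this determines \<open>\<sigma>\<close>.\<close>

definition surface_measure :: "'a::euclidean_space set \<Rightarrow> 'a measure \<Rightarrow> bool" where
  "surface_measure \<Omega> \<sigma> \<longleftrightarrow>
     sets \<sigma> = sets (restrict_space borel (frontier \<Omega>)) \<and>
     (\<forall>U e \<gamma>. boundary_graph \<Omega> U e \<gamma> \<longrightarrow>
        (\<forall>A\<in>sets \<sigma>. A \<subseteq> U \<longrightarrow>
           emeasure \<sigma> A =
             (\<integral>\<^sup>+ y. ennreal (sqrt (1 + (norm (grad \<gamma> y))\<^sup>2)) * indicator A (y + \<gamma> y *\<^sub>R e)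
                \<partial>hyperplane_measure e)))"

section \<open>Sobolev functions, traces, and the functional\<close>

text \<open>For $u \in C^1(\Omega)$, where the weak gradient is the classical one, this is $u \in H^1(\Omega)$.\<close>

definition in_H1 :: "'a::euclidean_space set \<Rightarrow> ('a \<Rightarrow> real) \<Rightarrow> bool" where
  "in_H1 \<Omega> u \<longleftrightarrow> set_integrable lborel \<Omega> (\<lambda>x. (u x)\<^sup>2) \<and>
                set_integrable lborel \<Omega> (\<lambda>x. (norm (grad u x))\<^sup>2)"

text \<open>For $u \in C^1(\Omega) \cap H^1(\Omega)$, the function \<open>g\<close> on the boundary is (a Borel representative of)
  the trace of \<open>u\<close>: the $L^2(\partial\Omega)$-limit of the boundary values of functions in
  $C^1(\overline\Omega)$ that converge to \<open>u\<close> in $H^1(\Omega)$. Integrals of squares are taken as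
  nonnegative integrals because Bochner integrals vanish for non-integrable functions.\<close>

definition has_trace ::
    "'a::euclidean_space set \<Rightarrow> 'a measure \<Rightarrow> ('a \<Rightarrow> real) \<Rightarrow> ('a \<Rightarrow> real) \<Rightarrow> bool" where
  "has_trace \<Omega> \<sigma> u g \<longleftrightarrow> g \<in> borel_measurable \<sigma> \<and>
     (\<exists>\<phi> :: nat \<Rightarrow> 'a \<Rightarrow> real.
        (\<forall>j. C1_closure \<Omega> (\<phi> j)) \<and>
        (\<lambda>j. \<integral>\<^sup>+ x\<in>\<Omega>. ennreal ((\<phi> j x - u x)\<^sup>2 + (norm (grad (\<phi> j) x - grad u x))\<^sup>2) \<partial>lborel)
           \<longlonglongrightarrow> 0 \<and>
        (\<lambda>j. \<integral>\<^sup>+ x. ennreal ((\<phi> j x - g x)\<^sup>2) \<partial>\<sigma>) \<longlonglongrightarrow> 0)"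

definition L2_norm :: "'a::euclidean_space set \<Rightarrow> ('a \<Rightarrow> real) \<Rightarrow> real" where
  "L2_norm \<Omega> v = sqrt (LINT x:\<Omega>|lborel. (v x)\<^sup>2)"

text \<open>The functional $R_m$ for $v \in C^1(\Omega) \cap H^1(\Omega)$ whose values on the boundary represent
  its trace.\<close>

definition R_functional ::
    "'a::euclidean_space set \<Rightarrow> 'a measure \<Rightarrow> real \<Rightarrow> ('a \<Rightarrow> real) \<Rightarrow> real" where
  "R_functional \<Omega> \<sigma> m v =
     ((LINT x:\<Omega>|lborel. (norm (grad v x))\<^sup>2) + 1 / m * (LINT x|\<sigma>. \<bar>v x\<bar>)\<^sup>2)
       / (LINT x:\<Omega>|lborel. (v x)\<^sup>2)"

end

theory Submission
  imports Defs
begin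

text \<open>Write $v = u_k$, $w = u_{k+1}$, $B(f) = \int_{\partial\Omega}|f|\,d\sigma$ and
  $E(f) = \int_\Omega|\nabla f|^2 + B(f)^2/m$, so that $R_m(f) = E(f)/\|f\|^2$. Green's identity gives
  $\int\nabla w\cdot\nabla\psi = R_m(v)\int v\psi + \int_{\partial\Omega}\psi\,\partial_\nu w$.
  For $\psi = w$ the boundary term is $-\frac{B(v)}{m}\int w^2/|v| \le -B(w)^2/m$, hence
  $E(w) \le R_m(v)\int vw \le R_m(v)\|v\|\|w\|$. For $\psi = v$ it is at least $-B(v)B(w)/m$, hence
  $E(v) \le \int\nabla v\cdot\nabla w + B(v)B(w)/m \le (E(v)+E(w))/2$, i.e. $E(v) \le E(w)$. So $E > 0$
  and $\|\cdot\| > 0$ propagate from $u_0$, and the three inequalities follow.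

  The divergence theorem is localised by a partition of unity. In a local graph the field is cut off
  near the boundary by a function of $(x\cdot e - \gamma(x))/\varepsilon$; the divergence of a
  compactly supported field integrates to zero by translation invariance, and for
  $\varepsilon \to 0$ the gradient of the cutoff concentrates to the flux through the graph.\<close>

section \<open>Calculus of $C^1$ functions and vector fields\<close>

text \<open>The two boundary bounds are where the choice of h_k pays off. Applying Cauchy-Schwarz to
  |w| = (|w| / sqrt |v|) * sqrt |v| bounds B(w)^2 by B(v) times the integral of w^2 / |v|, and the
  factor B(v) / m of the flux turns this into B(w)^2 / m, the nonlocal term of the energy. Two
  obstacles shape the rest. The function u_0 is only C^1 inside \<Omega> and meets the boundary
  through its trace, so it cannot be put into the classical Green identity; the identity has to be
  closed up along an approximating sequence, which needs bounds on the Laplacian, the gradient and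
  the normal derivative of w. In turn w is only C^1 up to the boundary: its second derivatives may
  blow up there, and the equation controls nothing but the Laplacian. Hence the divergence theorem
  is proved for fields that are C^1 inside, continuous on the closure and have an integrable
  divergence. Only u_0 is positive by hypothesis. The estimates are therefore phrased with |v| and
  allow zeros of v on the boundary, where the Robin condition forces w = 0.\<close>

definition divg :: "('a::euclidean_space \<Rightarrow> 'a) \<Rightarrow> 'a \<Rightarrow> real" where
  "divg F x = (\<Sum>b\<in>Basis. partial b (\<lambda>y. F y \<bullet> b) x)"

lemma partial_eqI: "(f has_derivative f') (at x) \<Longrightarrow> partial b f x = f' b"
  unfolding partial_def using frechet_derivative_at by metis

lemma grad_inner_Basis: "b \<in> Basis \<Longrightarrow> grad f x \<bullet> b = partial b f x"
  unfolding grad_def by (simp add: inner_sum_left inner_Basis if_distrib cong: if_cong)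

lemma grad_eqI:
  assumes "(f has_derivative (\<lambda>h. g \<bullet> h)) (at x)"
  shows "grad f x = g"
  by (rule euclidean_eqI) (simp add: grad_inner_Basis partial_eqI[OF assms])

lemma has_derivative_grad:
  assumes "f differentiable (at x)"
  shows "(f has_derivative (\<lambda>h. grad f x \<bullet> h)) (at x)"
proof -
  have d: "(f has_derivative frechet_derivative f (at x)) (at x)"
    using assms frechet_derivative_works by blast
  interpret bounded_linear "frechet_derivative f (at x)"
    using d has_derivative_bounded_linear by blast
  have "frechet_derivative f (at x) h = grad f x \<bullet> h" for h
  proof -
    have "frechet_derivative f (at x) h = frechet_derivative f (at x) (\<Sum>b\<in>Basis. (h \<bullet> b) *\<^sub>R b)"
      by (simp add: euclidean_representation)
    also have "\<dots> = (\<Sum>b\<in>Basis. (h \<bullet> b) * partial b f x)"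
      by (simp add: sum scale partial_def)
    also have "\<dots> = grad f x \<bullet> h"
      unfolding grad_def by (simp add: inner_sum_left inner_sum_right inner_commute mult.commute)
    finally show ?thesis .
  qed
  then show ?thesis using d by presburger
qed

lemma has_derivative_cong_open:
  assumes "open S" "x \<in> S" "\<And>y. y \<in> S \<Longrightarrow> f y = g y" 
  shows "(f has_derivative f') (at x) \<longleftrightarrow> (g has_derivative f') (at x)"
  using assms has_derivative_transform_within_open[of f f' x UNIV S g] has_derivative_transform_within_open[of g f' x UNIV S f] by auto

lemma partial_cong_open:
  assumes "open S" "x \<in> S" "\<And>y. y \<in> S \<Longrightarrow> f y = g y"
  shows "partial b f x = partial b g x"
  unfolding partial_def frechet_derivative_def
  using has_derivative_cong_open[OF assms] by presburger

lemma divg_cong_open: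
  assumes "open S" "x \<in> S" "\<And>y. y \<in> S \<Longrightarrow> F y = G y"
  shows "divg F x = divg G x"
  unfolding divg_def by (intro sum.cong refl partial_cong_open[OF assms(1,2)]) (simp add: assms)

lemma partial_zero_open:
  assumes "open S" "x \<in> S" "\<And>y. y \<in> S \<Longrightarrow> f y = 0"
  shows "partial b f x = 0"
proof -
  have "partial b f x = partial b (\<lambda>_. 0) x" by (rule partial_cong_open[OF assms(1,2)]) (simp add: assms)
  also have "\<dots> = 0" by (rule partial_eqI) (rule has_derivative_const)
  finally show ?thesis .
qed

lemma divg_zero_open:
  assumes "open S" "x \<in> S" "\<And>y. y \<in> S \<Longrightarrow> F y = 0"
  shows "divg F x = 0"
  unfolding divg_def by (intro sum.neutral ballI partial_zero_open[OF assms(1,2)]) (simp add: assms)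

section \<open>Algebra of C^1 functions\<close>

text \<open>The gradient form of \<open>Ck_on 1\<close>: continuity of one vector-valued map suits
  the continuity rules better than a conjunction over \<open>Basis\<close>.\<close>

definition C1_on :: "'a::euclidean_space set \<Rightarrow> ('a \<Rightarrow> real) \<Rightarrow> bool" where
  "C1_on S f \<longleftrightarrow> (\<forall>x\<in>S. f differentiable (at x)) \<and> continuous_on S (grad f)"

lemma C1_on_iff_Ck_on: "C1_on S f \<longleftrightarrow> Ck_on 1 S f"
proof -
  have "continuous_on S (grad f) \<longleftrightarrow> (\<forall>b\<in>Basis. continuous_on S (partial b f))"
    by (subst continuous_on_componentwise) (simp add: grad_inner_Basis cong: ball_cong)
  then show ?thesis by (auto simp: C1_on_def)
qed

lemma C1_on_I:
  assumes "\<And>x. x \<in> S \<Longrightarrow> (f has_derivative (\<lambda>h. g x \<bullet> h)) (at x)" "continuous_on S g"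
  shows "C1_on S f"
  unfolding C1_on_def
proof
  show "\<forall>x\<in>S. f differentiable at x" using assms(1) differentiable_def by blast
  have "grad f x = g x" if "x \<in> S" for x by (intro grad_eqI assms(1) that)
  with assms(2) show "continuous_on S (grad f)" by (simp cong: continuous_on_cong)
qed

lemma C1_on_imp_continuous:
  assumes "C1_on S f" shows "continuous_on S f"
  using assms unfolding C1_on_def
  by (auto intro!: continuous_at_imp_continuous_on differentiable_imp_continuous_within)

lemma C1_on_cong_open:
  assumes "open S" "\<And>y. y \<in> S \<Longrightarrow> f y = g y" "C1_on S g"
  shows "C1_on S f"
proof (rule C1_on_I)
  fix x assume x: "x \<in> S"
  then have "(g has_derivative (\<lambda>h. grad g x \<bullet> h)) (at x)"
    using assms(3) has_derivative_grad by (auto simp: C1_on_def)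
  then show "(f has_derivative (\<lambda>h. grad g x \<bullet> h)) (at x)"
    using has_derivative_cong_open[OF assms(1) x, of f g] assms(2) by blast
qed (use assms(3) C1_on_def in auto)

lemma C1_on_subset: "C1_on S f \<Longrightarrow> T \<subseteq> S \<Longrightarrow> C1_on T f"
  unfolding C1_on_def using continuous_on_subset by blast

lemma C1_on_Un: "\<lbrakk>open S; open T; C1_on S f; C1_on T f\<rbrakk> \<Longrightarrow> C1_on (S \<union> T) f"
  unfolding C1_on_def by (auto intro: continuous_on_open_Un)

lemma C1_on_D: "C1_on S f \<Longrightarrow> x \<in> S \<Longrightarrow> (f has_derivative (\<lambda>h. grad f x \<bullet> h)) (at x)"
  using has_derivative_grad by (auto simp: C1_on_def)

lemma C1_on_grad: "C1_on S f \<Longrightarrow> continuous_on S (grad f)"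
  by (simp add: C1_on_def)

lemma C1_on_const: "C1_on S (\<lambda>_. c)"
  by (rule C1_on_I[where g="\<lambda>_. 0"]) (auto intro!: derivative_eq_intros)

lemma C1_on_inner: "C1_on S (\<lambda>x. x \<bullet> e)"
  by (rule C1_on_I[where g="\<lambda>_. e"]) (auto intro!: derivative_eq_intros simp: inner_commute)

lemma grad_mult:
  assumes "C1_on S f" "C1_on S g" "x \<in> S"
  shows "grad (\<lambda>x. f x * g x) x = f x *\<^sub>R grad g x + g x *\<^sub>R grad f x"
  using has_derivative_mult[OF C1_on_D[OF assms(1,3)] C1_on_D[OF assms(2,3)]]
  by (intro grad_eqI) (simp add: inner_add_left mult.commute)

lemma C1_on_mult:
  assumes "C1_on S f" "C1_on S g"
  shows "C1_on S (\<lambda>x. f x * g x)"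
proof (rule C1_on_I)
  show "((\<lambda>x. f x * g x) has_derivative (\<lambda>h. (f x *\<^sub>R grad g x + g x *\<^sub>R grad f x) \<bullet> h)) (at x)" 
    if "x \<in> S" for x
    using has_derivative_mult[OF C1_on_D[OF assms(1) that] C1_on_D[OF assms(2) that]]
    by (simp add: inner_add_left mult.commute)
  show "continuous_on S (\<lambda>x. f x *\<^sub>R grad g x + g x *\<^sub>R grad f x)"
    by (intro continuous_intros C1_on_grad C1_on_imp_continuous assms)
qed

lemma C1_on_diff:
  assumes "C1_on S f" "C1_on S g"
  shows "C1_on S (\<lambda>x. f x - g x)"
proof (rule C1_on_I)
  show "((\<lambda>x. f x - g x) has_derivative (\<lambda>h. (grad f x - grad g x) \<bullet> h)) (at x)" 
    if "x \<in> S" for x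
    using has_derivative_diff[OF C1_on_D[OF assms(1) that] C1_on_D[OF assms(2) that]]
    by (simp add: inner_diff_left)
  show "continuous_on S (\<lambda>x. grad f x - grad g x)"
    by (intro continuous_intros C1_on_grad C1_on_imp_continuous assms)
qed

lemma C1_on_sum:
  assumes "finite I" "\<And>i. i \<in> I \<Longrightarrow> C1_on S (f i)"
  shows "C1_on S (\<lambda>x. \<Sum>i\<in>I. f i x)"
proof (rule C1_on_I)
  show "((\<lambda>x. \<Sum>i\<in>I. f i x) has_derivative (\<lambda>h. (\<Sum>i\<in>I. grad (f i) x) \<bullet> h)) (at x)" 
    if "x \<in> S" for x
    using has_derivative_sum[of I f "\<lambda>i h. grad (f i) x \<bullet> h" "at x"] C1_on_D[OF assms(2) that]
    by (simp add: inner_sum_left)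
  show "continuous_on S (\<lambda>x. \<Sum>i\<in>I. grad (f i) x)"
    by (intro continuous_intros C1_on_grad assms)
qed

lemma has_derivative_compose_real:
  assumes "f differentiable (at x)" "(q has_real_derivative d) (at (f x))"
  shows "((\<lambda>x. q (f x)) has_derivative (\<lambda>h. (d *\<^sub>R grad f x) \<bullet> h)) (at x)"
  using has_derivative_compose[OF has_derivative_grad[OF assms(1)], of q "(*) d"] assms(2)
  by (simp add: has_field_derivative_def)

text \<open>The derivative of q is asked for only at values of f, so that \<open>inverse\<close> can
  be composed with a positive function.\<close>

lemma C1_on_compose:
  assumes f: "C1_on S f" and q: "\<And>x. x \<in> S \<Longrightarrow> (q has_real_derivative q' (f x)) (at (f x))"
    and c: "continuous_on (f ` S) q'"
  shows "C1_on S (\<lambda>x. q (f x))"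
proof (rule C1_on_I)
  show "((\<lambda>x. q (f x)) has_derivative (\<lambda>h. (q' (f x) *\<^sub>R grad f x) \<bullet> h)) (at x)" if "x \<in> S" for x
    using that f q by (intro has_derivative_compose_real) (auto simp: C1_on_def)
  show "continuous_on S (\<lambda>x. q' (f x) *\<^sub>R grad f x)"
    by (intro continuous_intros C1_on_grad f continuous_on_compose2[OF c] C1_on_imp_continuous)
      auto
qed

section \<open>C^1 vector fields and their divergence\<close>

definition C1_field :: "'a::euclidean_space set \<Rightarrow> ('a \<Rightarrow> 'a) \<Rightarrow> bool" where
  "C1_field S F \<longleftrightarrow> (\<forall>b\<in>Basis. C1_on S (\<lambda>x. F x \<bullet> b))"

lemma C1_field_scaleR:
  assumes "C1_on S f" "C1_field S F"
  shows "C1_field S (\<lambda>x. f x *\<^sub>R F x)"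
  using assms C1_on_mult unfolding C1_field_def by (simp only: inner_scaleR_left) blast

lemma C1_field_continuous:
  assumes "C1_field S F" shows "continuous_on S F"
  by (subst continuous_on_componentwise)
    (use assms C1_on_imp_continuous in \<open>auto simp: C1_field_def\<close>)

lemma divg_scaleR:
  assumes f: "C1_on S f" and F: "C1_field S F" and x: "x \<in> S"
  shows "divg (\<lambda>x. f x *\<^sub>R F x) x = f x * divg F x + grad f x \<bullet> F x"
proof -
  have "partial b (\<lambda>y. (f y *\<^sub>R F y) \<bullet> b) x
      = f x * partial b (\<lambda>y. F y \<bullet> b) x + (grad f x \<bullet> b) * (F x \<bullet> b)" if b: "b \<in> Basis" for b
  proof -
    have "C1_on S (\<lambda>y. F y \<bullet> b)" using F b by (simp add: C1_field_def)
    from grad_mult[OF f this x, THEN arg_cong[where f="\<lambda>v. v \<bullet> b"]] b show ?thesis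
      by (simp add: inner_add_left grad_inner_Basis)
  qed
  then have "divg (\<lambda>x. f x *\<^sub>R F x) x
      = (\<Sum>b\<in>Basis. f x * partial b (\<lambda>y. F y \<bullet> b) x + (grad f x \<bullet> b) * (F x \<bullet> b))"
    unfolding divg_def by (rule sum.cong[OF refl])
  also have "\<dots> = f x * divg F x + grad f x \<bullet> F x"
    by (subst euclidean_inner[of "grad f x"]) (simp only: divg_def sum.distrib sum_distrib_left)
  finally show ?thesis .
qed

section \<open>A one-dimensional C^1 cutoff\<close>

text \<open>The simplest C^1 function that vanishes on a half-line. The argument asks no more than
  C^1 of its cutoffs, so this one function yields both the cutoff at the boundary and the partition
  of unity.\<close>

definition ramp :: "real \<Rightarrow> real" where "ramp t = (max 0 t)\<^sup>2 / 2"

lemma has_derivative_ramp: "(ramp has_real_derivative max 0 t) (at t)"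
proof (cases "t = 0")
  case False
  show ?thesis
  proof (cases "t > 0")
    case True
    have "((\<lambda>s. s\<^sup>2 / 2) has_real_derivative max 0 t) (at t)"
      using True DERIV_cdivide[OF DERIV_pow[of 2 t UNIV], of 2] by simp
    then show ?thesis 
      by (rule has_field_derivative_transform_within_open[where S="{0<..}"]) (use True in \<open>simp_all add: ramp_def\<close>)
  next
    case nt: False
    have "((\<lambda>s. 0) has_real_derivative max 0 t) (at t)"
      using nt by simp
    then show ?thesis 
      by (rule has_field_derivative_transform_within_open[where S="{..<0}"]) (use nt False in \<open>simp_all add: ramp_def\<close>)
  qed
next
  case True
  have "(\<lambda>h. ramp h / h) = (\<lambda>h. max 0 h / 2)"
    by (rule ext) (simp add: ramp_def power2_eq_square max_def)
  moreover have "((\<lambda>h::real. max 0 h / 2) \<longlongrightarrow> max 0 0 / 2) (at 0)"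
    by (intro tendsto_intros) simp
  ultimately have "((\<lambda>h. (ramp (0 + h) - ramp 0) / h) \<longlongrightarrow> 0) (at 0)"
    by (simp add: ramp_def)
  then show ?thesis using True unfolding DERIV_def by simp
qed

text \<open>A second difference of the ramp is a $C^1$ step; its derivative is a tent of mass one.\<close>

definition cutoff :: "real \<Rightarrow> real" where
  "cutoff t = ramp (t - 1) - 2 * ramp (t - 2) + ramp (t - 3)"

definition cutoff' :: "real \<Rightarrow> real" where
  "cutoff' t = max 0 (t - 1) - 2 * max 0 (t - 2) + max 0 (t - 3)"

lemma has_derivative_cutoff: "(cutoff has_real_derivative cutoff' t) (at t)"
proof -
  have "((\<lambda>t. ramp (t - a)) has_real_derivative max 0 (t - a)) (at t)" for a
  proof (rule DERIV_cong[OF DERIV_chain2[OF has_derivative_ramp]])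
    show "((\<lambda>t. t - a) has_real_derivative 1) (at t)" by (auto intro!: derivative_eq_intros)
  qed simp
  then show ?thesis unfolding cutoff_def cutoff'_def
    by (auto intro!: derivative_eq_intros)
qed

lemma continuous_cutoff': "continuous_on S cutoff'"
  unfolding cutoff'_def[abs_def] by (intro continuous_intros)

text \<open>The step starts at 1 rather than at 0 so that a field cut off by
  \<open>height / \<epsilon>\<close> vanishes in a full layer along the boundary and keeps a compact
  support inside \<Omega>.\<close>

lemma cutoff_eq: "t \<le> 1 \<Longrightarrow> cutoff t = 0" "t \<ge> 3 \<Longrightarrow> cutoff t = 1"
  by (simp_all add: cutoff_def ramp_def max_def power2_eq_square field_simps)

lemma cutoff'_eq_0: "t \<le> 1 \<Longrightarrow> cutoff' t = 0" "t \<ge> 3 \<Longrightarrow> cutoff' t = 0"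
  by (auto simp: cutoff'_def)

lemma cutoff'_bound: "0 \<le> cutoff' t" "cutoff' t \<le> 1"
  by (auto simp: cutoff'_def max_def)

text \<open>The derivative is nonnegative, so every value lies between the values 0 and 1 taken at
  \<open>min t 1\<close> and \<open>max t 3\<close>.\<close>

lemma abs_cutoff_le: "\<bar>cutoff t\<bar> \<le> 1"
proof -
  have mono: "cutoff s \<le> cutoff t" if "s \<le> t" for s t
    by (rule DERIV_nonneg_imp_nondecreasing[OF that]) (meson has_derivative_cutoff cutoff'_bound(1))
  have "cutoff (min t 1) \<le> cutoff t" "cutoff t \<le> cutoff (max t 3)" by (auto intro!: mono)
  then show ?thesis using cutoff_eq[of "min t 1"] cutoff_eq[of "max t 3"] by auto
qed

lemma integral_cutoff': "integrable lborel cutoff'" "(LINT t|lborel. cutoff' t) = 1"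
proof -
  have "has_bochner_integral lborel (\<lambda>x. cutoff' x * indicator {1..3} x) (cutoff 3 - cutoff 1)"
    by (rule has_bochner_integral_FTC_Icc_real[OF _ has_derivative_cutoff])
      (use continuous_cutoff'[of UNIV] in \<open>auto simp: continuous_on_eq_continuous_at\<close>)
  moreover have "(\<lambda>x. cutoff' x * indicator {1..3} x) = cutoff'"
    by (rule ext) (auto simp: indicator_def cutoff'_def max_def split: if_splits)
  ultimately have "has_bochner_integral lborel cutoff' 1"
    by (simp add: cutoff_eq)
  then show "integrable lborel cutoff'" "(LINT t|lborel. cutoff' t) = 1"
    by (auto simp: has_bochner_integral_iff)
qed

section \<open>Fubini in graph coordinates\<close>

text \<open>Lebesgue measure is the image of a product over \<open>Basis\<close>; Fubini splits off
  the factor along b, and the remaining factors make up \<open>hyperplane_measure\<close>.\<close>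

lemma nn_integral_lborel_hyperplane:
  fixes b :: "'a::euclidean_space"
  assumes b: "b \<in> Basis" and f [measurable]: "f \<in> borel_measurable borel"
  shows "(\<integral>\<^sup>+ x. f x \<partial>lborel) = (\<integral>\<^sup>+ y. (\<integral>\<^sup>+ t. f (y + t *\<^sub>R b) \<partial>lborel) \<partial>hyperplane_measure b)"
proof -
  interpret product_sigma_finite "\<lambda>_::'a. lborel :: real measure" ..
  \<comment> \<open>\<open>hyperplane_measure\<close> removes both signs because e may be minus a
    basis vector. For b in \<open>Basis\<close> the second removal is void, since - b has inner
    product -1 with b.\<close>
  have I: "Basis - {b, - b} = Basis - {b}"
  proof -
    have "- b \<notin> Basis" using b inner_Basis[of b "- b"] by (auto split: if_splits)
    then show ?thesis by blast
  qed
  have ins: "insert b (Basis - {b}) = Basis" using b by blast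
  have m1: "(\<lambda>x. \<Sum>c\<in>Basis. x c *\<^sub>R c) \<in> measurable (\<Pi>\<^sub>M c\<in>Basis. lborel) borel"
    by (intro borel_measurable_sum borel_measurable_scaleR) auto
  have m2: "(\<lambda>x. \<Sum>c\<in>Basis - {b}. x c *\<^sub>R c) \<in> measurable (\<Pi>\<^sub>M c\<in>Basis - {b}. lborel) borel"
    by (intro borel_measurable_sum borel_measurable_scaleR) auto
  have sp: "(\<Sum>c\<in>Basis. (x(b := t)) c *\<^sub>R c) = (\<Sum>c\<in>Basis - {b}. x c *\<^sub>R c) + t *\<^sub>R b" for x t
    using b by (subst sum.remove[where x=b]) (auto intro: sum.cong)
  have "(\<integral>\<^sup>+ x. f x \<partial>lborel) = (\<integral>\<^sup>+ x. f (\<Sum>c\<in>Basis. x c *\<^sub>R c) \<partial>(\<Pi>\<^sub>M c\<in>Basis. lborel))"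
    by (subst lborel_eq, subst nn_integral_distr[OF m1]) auto
  also have "\<dots> = (\<integral>\<^sup>+ x. \<integral>\<^sup>+ t. f (\<Sum>c\<in>Basis. (x(b := t)) c *\<^sub>R c) \<partial>lborel \<partial>(\<Pi>\<^sub>M c\<in>Basis - {b}. lborel))"
    using product_nn_integral_insert[of "Basis - {b}" b "\<lambda>x. f (\<Sum>c\<in>Basis. x c *\<^sub>R c)"]
      measurable_comp[OF m1 f] by (simp add: ins comp_def insert_absorb[OF b])
  also have "\<dots> = (\<integral>\<^sup>+ x. \<integral>\<^sup>+ t. f ((\<Sum>c\<in>Basis - {b}. x c *\<^sub>R c) + t *\<^sub>R b) \<partial>lborel \<partial>(\<Pi>\<^sub>M c\<in>Basis - {b}. lborel))"
    by (simp only: sp)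
  also have "\<dots> = (\<integral>\<^sup>+ y. (\<integral>\<^sup>+ t. f (y + t *\<^sub>R b) \<partial>lborel) \<partial>hyperplane_measure b)"
    unfolding hyperplane_measure_def I
    by (subst nn_integral_distr[OF m2]) auto
  finally show ?thesis .
qed

lemma sets_hyperplane_measure [measurable_cong, simp]: "sets (hyperplane_measure e) = sets borel"
  by (simp add: hyperplane_measure_def)

lemma space_hyperplane_measure [simp]: "space (hyperplane_measure e) = UNIV"
  by (simp add: hyperplane_measure_def)

lemma hyperplane_measure_uminus: "hyperplane_measure (- e) = hyperplane_measure e"
  by (simp add: hyperplane_measure_def insert_commute)

text \<open>The hyperplane measure is a measure on the whole space that is carried by the
  hyperplane. Formulas that need y orthogonal to e, such as the one for the height over the graph,
  therefore hold only almost everywhere.\<close>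

lemma AE_hyperplane_measure:
  fixes e :: "'a::euclidean_space"
  assumes e: "e \<in> Basis \<or> - e \<in> Basis"
  shows "AE y in hyperplane_measure e. y \<bullet> e = 0"
proof -
  have m: "(\<lambda>x. \<Sum>c\<in>Basis - {e, - e}. x c *\<^sub>R c) \<in> measurable (\<Pi>\<^sub>M c\<in>Basis - {e, - e}. lborel) borel"
    by (intro borel_measurable_sum borel_measurable_scaleR) auto
  have orth: "c \<bullet> e = 0" if "c \<in> Basis - {e, - e}" for c
    using e inner_Basis[of c e] inner_Basis[of c "- e"] that by auto
  show ?thesis
    unfolding hyperplane_measure_def
    by (subst AE_distr_iff[OF m]) (auto simp: inner_sum_left orth)
qed

text \<open>For fixed y this is an affine substitution on the line through y, in which
  \<open>\<gamma> y\<close> is a constant; if - e is the basis vector, the scale becomes -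
  \<epsilon>. The scale is built in because the boundary layer of the cutoff has thickness of order
  \<epsilon> and becomes a fixed interval in the variable t.\<close>

lemma nn_integral_lborel_graph:
  fixes e :: "'a::euclidean_space"
  assumes e: "e \<in> Basis \<or> - e \<in> Basis" and f [measurable]: "f \<in> borel_measurable borel"
    and "\<epsilon> > 0"
  shows "(\<integral>\<^sup>+ x. f x \<partial>lborel) =
    (\<integral>\<^sup>+ y. ennreal \<epsilon> * (\<integral>\<^sup>+ t. f (y + (\<gamma> y + \<epsilon> * t) *\<^sub>R e) \<partial>lborel) \<partial>hyperplane_measure e)"
  using e
proof
  assume e: "e \<in> Basis"
  show ?thesis
    unfolding nn_integral_lborel_hyperplane[OF e f]
  proof (intro nn_integral_cong)
    fix y :: 'a
    show "(\<integral>\<^sup>+ t. f (y + t *\<^sub>R e) \<partial>lborel) = ennreal \<epsilon> * (\<integral>\<^sup>+ t. f (y + (\<gamma> y + \<epsilon> * t) *\<^sub>R e) \<partial>lborel)"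
      using nn_integral_real_affine[of "\<lambda>t. f (y + t *\<^sub>R e)" \<epsilon> "\<gamma> y"] \<open>\<epsilon> > 0\<close> by simp
  qed
next
  assume e: "- e \<in> Basis"
  show ?thesis
    unfolding nn_integral_lborel_hyperplane[OF e f] hyperplane_measure_uminus
  proof (intro nn_integral_cong)
    fix y :: 'a
    have "y + (- \<gamma> y + (- \<epsilon>) * t) *\<^sub>R (- e) = y + (\<gamma> y + \<epsilon> * t) *\<^sub>R e" for t
      by (simp add: algebra_simps)
    then show "(\<integral>\<^sup>+ t. f (y + t *\<^sub>R (- e)) \<partial>lborel) = ennreal \<epsilon> * (\<integral>\<^sup>+ t. f (y + (\<gamma> y + \<epsilon> * t) *\<^sub>R e) \<partial>lborel)"
      using nn_integral_real_affine[of "\<lambda>t. f (y + t *\<^sub>R (- e))" "- \<epsilon>" "- \<gamma> y"] \<open>\<epsilon> > 0\<close>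
      by (simp only: abs_minus_cancel abs_of_pos) simp
  qed
qed

text \<open>As an identity of measures, the substitution carries over to Bochner integrals of
  measurable functions without any integrability check.\<close>

lemma lborel_eq_graph:
  fixes e :: "'a::euclidean_space"
  assumes e: "e \<in> Basis \<or> - e \<in> Basis" and [measurable]: "\<gamma> \<in> borel_measurable borel" and "\<epsilon> > 0"
  shows "lborel = density (distr (hyperplane_measure e \<Otimes>\<^sub>M lborel) borel
    (\<lambda>(y, t). y + (\<gamma> y + \<epsilon> * t) *\<^sub>R e)) (\<lambda>_. ennreal \<epsilon>)"
    (is "_ = density (distr ?P borel ?T) _")
proof (rule measure_eqI)
  fix A :: "'a set" assume "A \<in> sets lborel"
  then have A [measurable]: "A \<in> sets borel" by simp
  have T [measurable]: "?T \<in> measurable ?P borel" by measurable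
  have "emeasure (density (distr ?P borel ?T) (\<lambda>_. ennreal \<epsilon>)) A
      = (\<integral>\<^sup>+ z. ennreal \<epsilon> * indicator A (?T z) \<partial>?P)"
    by (simp add: emeasure_density nn_integral_distr)
  also have "\<dots> = (\<integral>\<^sup>+ y. \<integral>\<^sup>+ t. ennreal \<epsilon> * indicator A (?T (y, t)) \<partial>lborel \<partial>hyperplane_measure e)"
    by (rule lborel.nn_integral_fst[symmetric]) measurable
  also have "\<dots> = (\<integral>\<^sup>+ x. indicator A x \<partial>lborel)"
    by (subst nn_integral_lborel_graph[OF e _ \<open>\<epsilon> > 0\<close>, where \<gamma>=\<gamma>]) (simp_all add: nn_integral_cmult)
  finally show "emeasure lborel A = emeasure (density (distr ?P borel ?T) (\<lambda>_. ennreal \<epsilon>)) A"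
    by simp
qed simp

lemma integral_lborel_graph:
  fixes e :: "'a::euclidean_space" and f :: "'a \<Rightarrow> real"
  assumes e: "e \<in> Basis \<or> - e \<in> Basis" and [measurable]: "\<gamma> \<in> borel_measurable borel" and "\<epsilon> > 0"
    and [measurable]: "f \<in> borel_measurable borel"
  shows "(LINT x|lborel. f x) =
    (LINT z|(hyperplane_measure e \<Otimes>\<^sub>M lborel). \<epsilon> * f (fst z + (\<gamma> (fst z) + \<epsilon> * snd z) *\<^sub>R e))"
  using \<open>\<epsilon> > 0\<close>
  by (subst lborel_eq_graph[OF assms(1-3)])
    (simp add: integral_density integral_distr case_prod_beta)

text \<open>Thickening by a unit interval in direction e stays inside the ball of radius
  \<open>r + 1\<close>, whose Lebesgue measure is finite; this is the flat graph with scale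
  1.\<close>

lemma emeasure_hyperplane_bounded:
  fixes e :: "'a::euclidean_space"
  assumes e: "e \<in> Basis \<or> - e \<in> Basis"
  shows "emeasure (hyperplane_measure e) (cball 0 r) < \<infinity>"
proof -
  have ne: "norm e = 1" using e norm_Basis[of e] norm_Basis[of "- e"] by auto
  have "emeasure (hyperplane_measure e) (cball 0 r) = 
      (\<integral>\<^sup>+ y. 1 * (\<integral>\<^sup>+ t. indicator (cball 0 r) y * indicator {0..1} t \<partial>(lborel :: real measure)) \<partial>hyperplane_measure e)"
    by (simp add: nn_integral_cmult)
  also have "\<dots> \<le> (\<integral>\<^sup>+ y. ennreal 1 * (\<integral>\<^sup>+ t. indicator (cball 0 (r + 1)) (y + (0 + 1 * t) *\<^sub>R e) \<partial>lborel) \<partial>hyperplane_measure e)"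
  proof (intro nn_integral_mono mult_mono)
    fix y :: 'a and t :: real
    have "norm (y + t *\<^sub>R e) \<le> norm y + \<bar>t\<bar>" using norm_triangle_ineq[of y "t *\<^sub>R e"] ne by simp
    then show "indicator (cball 0 r) y * indicator {0..1} t \<le> (indicator (cball 0 (r + 1)) (y + (0 + 1 * t) *\<^sub>R e) :: ennreal)"
      by (auto simp: indicator_def)
  qed auto
  also have "\<dots> = (\<integral>\<^sup>+ x. indicator (cball (0::'a) (r + 1)) x \<partial>lborel)"
    using nn_integral_lborel_graph[OF e, of "indicator (cball 0 (r + 1))" 1 "\<lambda>_. 0"]
    by (simp add: borel_measurable_indicator)
  also have "\<dots> < \<infinity>"
    using emeasure_lborel_cball_finite[of "0::'a" "r + 1"] by simp
  finally show ?thesis .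
qed

lemma sigma_finite_hyperplane_measure:
  fixes e :: "'a::euclidean_space"
  assumes "e \<in> Basis \<or> - e \<in> Basis"
  shows "sigma_finite_measure (hyperplane_measure e)"
proof
  have "\<Union> (range (\<lambda>n::nat. cball (0::'a) (real n))) = UNIV"
    using real_arch_simple by auto
  then show "\<exists>A. countable A \<and> A \<subseteq> sets (hyperplane_measure e) \<and> \<Union> A = space (hyperplane_measure e) \<and>
      (\<forall>a\<in>A. emeasure (hyperplane_measure e) a \<noteq> \<infinity>)"
    using emeasure_hyperplane_bounded[OF assms]
    by (intro exI[of _ "range (\<lambda>n::nat. cball 0 (real n))"]) (auto simp: less_top)
qed

section \<open>Divergence of compactly supported fields\<close>

lemma integrable_continuous_compact_support:
  fixes f :: "'a::euclidean_space \<Rightarrow> real"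
  assumes "continuous_on UNIV f" "compact K" "\<And>x. x \<notin> K \<Longrightarrow> f x = 0"
  shows "integrable lborel f"
proof -
  have "integrable lborel (\<lambda>x. indicator K x *\<^sub>R f x)"
    using borel_integrable_compact[OF \<open>compact K\<close>] assms(1) continuous_on_subset by blast
  moreover have "(\<lambda>x. indicator K x *\<^sub>R f x) = f"
    by (rule ext) (use assms(3) in \<open>auto simp: indicator_def\<close>)
  ultimately show ?thesis by simp
qed

text \<open>Each difference quotient in direction b has integral zero, as f and its translate have
  the same integral. The mean value theorem bounds the quotients by the supremum of
  \<open>partial b f\<close>, so dominated convergence passes to the derivative.\<close>

lemma integral_partial_zero:
  fixes f :: "'a::euclidean_space \<Rightarrow> real"
  assumes f: "C1_on UNIV f" and K: "compact K" "\<And>x. x \<notin> K \<Longrightarrow> f x = 0" and b: "b \<in> Basis"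
  shows "integrable lborel (partial b f)" "(LINT x|lborel. partial b f x) = 0"
proof -
  have cf: "continuous_on UNIV f" by (rule C1_on_imp_continuous[OF f])
  have cp: "continuous_on UNIV (partial b f)"
    using C1_on_grad[OF f] by (auto simp: grad_inner_Basis[OF b, symmetric] intro!: continuous_intros)
  have pz: "partial b f x = 0" if "x \<notin> K" for x
    by (rule partial_zero_open[of "- K"]) (use K that compact_imp_closed in auto)
  show int: "integrable lborel (partial b f)"
    by (rule integrable_continuous_compact_support[OF cp K(1) pz])
  have fint: "integrable lborel f"
    by (rule integrable_continuous_compact_support[OF cf K])
  obtain C where C: "\<And>x. \<bar>partial b f x\<bar> \<le> C" "C \<ge> 0"
  proof -
    have "bounded (partial b f ` K)"
      by (intro compact_imp_bounded compact_continuous_image continuous_on_subset[OF cp] K) auto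
    then obtain C where "\<forall>x\<in>K. \<bar>partial b f x\<bar> \<le> C" by (auto simp: bounded_iff)
    then have "\<bar>partial b f x\<bar> \<le> max C 0" for x using pz[of x] by (cases "x \<in> K") (auto simp: max_def)
    then show thesis using that by force
  qed
  define X where "X n = inverse (real (Suc n))" for n
  have X: "0 < X n" "X n \<le> 1" for n by (auto simp: X_def field_simps)
  have X0: "X \<longlonglongrightarrow> 0" unfolding X_def by (rule LIMSEQ_inverse_real_of_nat)
  define g where "g n x = (f (x + X n *\<^sub>R b) - f x) / X n" for n x
  have line: "((\<lambda>t. f (x + t *\<^sub>R b)) has_real_derivative partial b f (x + t *\<^sub>R b)) (at t)" for x t
  proof -
    have "((\<lambda>t. x + t *\<^sub>R b) has_derivative (\<lambda>h. h *\<^sub>R b)) (at t)"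
      by (auto intro!: derivative_eq_intros)
    from has_derivative_compose[OF this C1_on_D[OF f]]
    show ?thesis by (simp add: has_field_derivative_def grad_inner_Basis[OF b] mult_commute_abs)
  qed
  obtain B where B: "\<And>x. x \<in> K \<Longrightarrow> norm x \<le> B" using compact_imp_bounded[OF K(1)] by (auto simp: bounded_iff)
  \<comment> \<open>The steps \<open>X n\<close> are at most 1, so both terms of the quotient vanish
    outside the ball of radius \<open>B + 1\<close>.\<close>
  have gb: "\<bar>g n x\<bar> \<le> C * indicator (cball 0 (B + 1)) x" for n x
  proof (cases "x \<in> cball 0 (B + 1)")
    case True
    obtain z where "f (x + X n *\<^sub>R b) - f (x + 0 *\<^sub>R b) = (X n - 0) * partial b f (x + z *\<^sub>R b)"
      using MVT2[of 0 "X n" "\<lambda>t. f (x + t *\<^sub>R b)" "\<lambda>t. partial b f (x + t *\<^sub>R b)"] X line by blast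
    then have "g n x = partial b f (x + z *\<^sub>R b)" unfolding g_def using X(1)[of n] by (simp add: field_simps)
    then show ?thesis using C(1) True by simp
  next
    case False
    have "norm x \<le> norm (x + X n *\<^sub>R b) + norm (X n *\<^sub>R b)"
      using norm_triangle_ineq4[of "x + X n *\<^sub>R b" "X n *\<^sub>R b"] by simp
    then have "norm x \<le> norm (x + X n *\<^sub>R b) + 1" using X[of n] norm_Basis[OF b] by simp
    then have "x \<notin> K" "x + X n *\<^sub>R b \<notin> K" using B[of x] B[of "x + X n *\<^sub>R b"] False by auto
    then show ?thesis using False K(2) by (simp add: g_def)
  qed
  have glim: "(\<lambda>n. g n x) \<longlonglongrightarrow> partial b f x" for x
  proof -
    have "((\<lambda>h. (f (x + h *\<^sub>R b) - f x) / h) \<longlongrightarrow> partial b f x) (at 0)"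
      using line[of x 0] by (simp add: DERIV_def)
    moreover have "filterlim X (at 0) sequentially"
      using X0 X(1) by (intro filterlim_atI) (auto simp: less_imp_neq[symmetric])
    ultimately show ?thesis unfolding g_def by (rule filterlim_compose)
  qed
  have gint: "(LINT x|lborel. g n x) = 0" for n
  proof -
    have d: "distr lborel borel ((+) (X n *\<^sub>R b)) = lborel" by (rule lborel_distr_plus)
    have m: "f \<in> borel_measurable borel" using cf borel_measurable_continuous_onI by blast
    have "integrable (distr lborel borel ((+) (X n *\<^sub>R b))) f" using fint d by simp
    then have i: "integrable lborel (\<lambda>x. f (X n *\<^sub>R b + x))"
      by (subst (asm) integrable_distr_eq) (use m in auto)
    have "(LINT x|lborel. f (X n *\<^sub>R b + x)) = (LINT x|distr lborel borel ((+) (X n *\<^sub>R b)). f x)"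
      by (subst integral_distr) (use m in auto)
    then show ?thesis unfolding g_def using i fint d by (simp add: add.commute)
  qed
  have "(\<lambda>n. LINT x|lborel. g n x) \<longlonglongrightarrow> (LINT x|lborel. partial b f x)"
  proof (rule integral_dominated_convergence[where w="\<lambda>x. C * indicator (cball 0 (B + 1)) x"])
    show "partial b f \<in> borel_measurable lborel" using int by simp
    have "f \<in> borel_measurable borel" using cf borel_measurable_continuous_onI by blast
    then show "g n \<in> borel_measurable lborel" for n unfolding g_def[abs_def] by measurable
    show "integrable lborel (\<lambda>x::'a. C * indicator (cball 0 (B + 1)) x)"
      using emeasure_lborel_cball_finite by (intro integrable_mult_right integrable_real_indicator) auto
  qed (use gb glim in auto)
  then show "(LINT x|lborel. partial b f x) = 0"
    using gint by (simp add: LIMSEQ_const_iff)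
qed

text \<open>Extended by zero, F is C^1 on each of the open sets \<Omega> and \<open>- K\<close>.
  They cover the space because K lies in \<Omega>, so the extension is C^1 everywhere and its
  partial derivatives integrate to zero.\<close>

lemma integral_divg_compact_support:
  fixes F :: "'a::euclidean_space \<Rightarrow> 'a"
  assumes \<Omega>: "open \<Omega>" and F: "C1_field \<Omega> F"
    and K: "compact K" "K \<subseteq> \<Omega>" "\<And>x. x \<in> \<Omega> - K \<Longrightarrow> F x = 0"
  shows "(LINT x:\<Omega>|lborel. divg F x) = 0"
proof -
  define G where "G x = (if x \<in> \<Omega> then F x else 0)" for x
  have oK: "open (- K)" using K(1) compact_imp_closed by blast
  have UN: "\<Omega> \<union> - K = UNIV" using K by blast
  have G0: "G x = 0" if "x \<in> - K" for x using that K(3) by (auto simp: G_def)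
  have C1: "C1_on UNIV (\<lambda>x. G x \<bullet> b)" if b: "b \<in> Basis" for b
  proof -
    have "C1_on \<Omega> (\<lambda>x. G x \<bullet> b)"
      by (rule C1_on_cong_open[OF \<Omega>, where g="\<lambda>x. F x \<bullet> b"]) (use F b in \<open>auto simp: G_def C1_field_def\<close>)
    moreover have "C1_on (- K) (\<lambda>x. G x \<bullet> b)"
      by (rule C1_on_cong_open[OF oK, where g="\<lambda>x. 0"]) (auto simp: G0 C1_on_const)
    ultimately show ?thesis using C1_on_Un[OF \<Omega> oK] UN by metis
  qed
  have "indicator \<Omega> x *\<^sub>R divg F x = divg G x" for x
  proof (cases "x \<in> \<Omega>")
    case True
    then show ?thesis using divg_cong_open[OF \<Omega> True, of F G] by (simp add: G_def)
  next
    case False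
    then have "x \<in> - K" using K by blast
    then show ?thesis using divg_zero_open[OF oK _ G0] False by simp
  qed
  then have "(LINT x:\<Omega>|lborel. divg F x) = (LINT x|lborel. divg G x)"
    by (simp add: set_lebesgue_integral_def)
  also have "\<dots> = 0"
    unfolding divg_def using integral_partial_zero[OF C1 K(1)] G0
    by (subst Bochner_Integration.integral_sum) auto
  finally show ?thesis .
qed

section \<open>Local graphs, normal and surface measure\<close>

lemma boundary_graphD:
  assumes "boundary_graph \<Omega> U e \<gamma>"
  shows "open U" "e \<in> Basis \<or> - e \<in> Basis" "C1_on UNIV \<gamma>" "\<gamma> (x + t *\<^sub>R e) = \<gamma> x"
    and "x \<in> U \<Longrightarrow> x \<in> \<Omega> \<longleftrightarrow> \<gamma> x < x \<bullet> e"
    and "norm e = 1"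
proof -
  have *: "open U" "e \<in> Basis \<or> - e \<in> Basis" "\<And>k. Ck_on k UNIV \<gamma>" "\<And>x t. \<gamma> (x + t *\<^sub>R e) = \<gamma> x"
    "\<Omega> \<inter> U = {x \<in> U. \<gamma> x < x \<bullet> e}"
    using assms unfolding boundary_graph_def by auto
  show "C1_on UNIV \<gamma>" using *(3)[of 1] C1_on_iff_Ck_on by blast
  show "norm e = 1" using *(2) norm_Basis[of e] norm_Basis[of "- e"] by auto
  show "x \<in> U \<Longrightarrow> x \<in> \<Omega> \<longleftrightarrow> \<gamma> x < x \<bullet> e" using *(5) by blast
qed (use assms in \<open>auto simp: boundary_graph_def\<close>)

lemma boundary_graph_continuous:
  assumes "boundary_graph \<Omega> U e \<gamma>"
  shows "continuous_on S \<gamma>" "continuous_on S (grad \<gamma>)"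
  using C1_on_imp_continuous C1_on_grad boundary_graphD(3)[OF assms] continuous_on_subset by blast+

lemma boundary_graph_measurable:
  assumes "boundary_graph \<Omega> U e \<gamma>"
  shows "\<gamma> \<in> borel_measurable borel" "grad \<gamma> \<in> borel_measurable borel"
  using boundary_graph_continuous[OF assms, of UNIV] by (auto intro: borel_measurable_continuous_onI)

text \<open>Below the graph a whole neighbourhood misses \<Omega>. From a point on or above it, the
  ray in direction e enters \<Omega> at once, because \<gamma> is constant along e while the
  coordinate grows.\<close>

lemma closure_graph_iff:
  assumes bg: "boundary_graph \<Omega> U e \<gamma>" and x: "x \<in> U"
  shows "x \<in> closure \<Omega> \<longleftrightarrow> \<gamma> x \<le> x \<bullet> e"
proof
  assume cl: "x \<in> closure \<Omega>"
  show "\<gamma> x \<le> x \<bullet> e"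
  proof (rule ccontr)
    assume "\<not> \<gamma> x \<le> x \<bullet> e"
    then have x1: "x \<in> U \<inter> {y. y \<bullet> e < \<gamma> y}" using x by auto
    have "open (U \<inter> {y. y \<bullet> e < \<gamma> y})"
      by (intro open_Int boundary_graphD(1)[OF bg] open_Collect_less continuous_intros
          boundary_graph_continuous[OF bg])
    with cl x1 obtain y where "y \<in> \<Omega>" "y \<in> U \<inter> {y. y \<bullet> e < \<gamma> y}"
      using closure_iff_nhds_not_empty by blast
    then show False using boundary_graphD(5)[OF bg, of y] by auto
  qed
next
  assume le: "\<gamma> x \<le> x \<bullet> e"
  have e1: "e \<bullet> e = 1" using boundary_graphD(6)[OF bg] by (simp add: dot_square_norm)
  have lim: "((\<lambda>t. x + t *\<^sub>R e) \<longlongrightarrow> x + 0 *\<^sub>R e) (at_right (0::real))"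
    by (intro tendsto_intros)
  then have "\<forall>\<^sub>F t in at_right 0. x + t *\<^sub>R e \<in> U"
    using boundary_graphD(1)[OF bg] x by (simp add: tendsto_def)
  moreover have "\<forall>\<^sub>F t::real in at_right 0. t > 0" by (simp add: eventually_at_right_less)
  ultimately have "\<forall>\<^sub>F t in at_right 0. x + t *\<^sub>R e \<in> \<Omega>"
  proof eventually_elim
    case (elim t)
    then show ?case
      using boundary_graphD(4,5)[OF bg] le by (simp add: inner_add_left e1)
  qed
  then have "\<forall>\<^sub>F t in at_right 0. x + t *\<^sub>R e \<in> closure \<Omega>"
    by eventually_elim (use closure_subset in blast)
  from Lim_in_closed_set[OF closed_closure this _ lim] show "x \<in> closure \<Omega>" by simp
qed

lemma frontier_graph_iff:
  assumes "boundary_graph \<Omega> U e \<gamma>" "open \<Omega>" "x \<in> U"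
  shows "x \<in> frontier \<Omega> \<longleftrightarrow> \<gamma> x = x \<bullet> e"
  using closure_graph_iff[OF assms(1,3)] boundary_graphD(5)[OF assms(1,3)] assms(2)
  by (auto simp: frontier_def interior_open)

text \<open>Reconciles two base points: the surface measure evaluates the slope at the foot y, the
  normal evaluates it at the boundary point over y.\<close>

lemma grad_graph_translate:
  assumes bg: "boundary_graph \<Omega> U e \<gamma>"
  shows "grad \<gamma> (x + t *\<^sub>R e) = grad \<gamma> x"
proof -
  have "((\<lambda>y. y + t *\<^sub>R e) has_derivative (\<lambda>h. h)) (at x)" by (auto intro!: derivative_eq_intros)
  from has_derivative_compose[OF this C1_on_D[OF boundary_graphD(3)[OF bg]]]
  have "(\<gamma> has_derivative (\<lambda>h. grad \<gamma> (x + t *\<^sub>R e) \<bullet> h)) (at x)"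
    by (simp add: boundary_graphD(4)[OF bg])
  then show ?thesis by (rule grad_eqI[symmetric])
qed

lemma grad_graph_orthogonal:
  assumes bg: "boundary_graph \<Omega> U e \<gamma>"
  shows "grad \<gamma> x \<bullet> e = 0"
proof -
  have "((\<lambda>t. x + t *\<^sub>R e) has_derivative (\<lambda>h. h *\<^sub>R e)) (at 0)" by (auto intro!: derivative_eq_intros)
  from has_derivative_compose[OF this C1_on_D[OF boundary_graphD(3)[OF bg]]]
  have "((\<lambda>t::real. \<gamma> x) has_derivative (\<lambda>h. grad \<gamma> x \<bullet> (h *\<^sub>R e))) (at 0)"
    by (simp add: boundary_graphD(4)[OF bg])
  from has_derivative_unique[OF this has_derivative_const] show ?thesis
    by (metis scaleR_one)
qed

lemma norm_grad_graph:
  assumes bg: "boundary_graph \<Omega> U e \<gamma>"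
  shows "norm (grad \<gamma> x - e) = sqrt (1 + (norm (grad \<gamma> x))\<^sup>2)"
proof -
  have "(grad \<gamma> x - e) \<bullet> (grad \<gamma> x - e) = 1 + (norm (grad \<gamma> x))\<^sup>2"
    using grad_graph_orthogonal[OF bg, of x] boundary_graphD(6)[OF bg]
    by (simp add: power2_norm_eq_inner norm_eq_1 inner_diff_left inner_diff_right inner_commute)
  then show ?thesis by (simp add: norm_eq_sqrt_inner)
qed

text \<open>Along the ray from p in direction v, \<gamma> minus the coordinate along e starts at 0
  with slope \<open>v \<bullet> (grad \<gamma> p - e)\<close>, and the sign of the slope decides on
  which side of the graph the ray continues. Tangential directions stay undecided, so uniqueness has
  to be drawn from transversal ones.\<close>

lemma outward_normal_graph:
  assumes bg: "boundary_graph \<Omega> U e \<gamma>" and \<Omega>: "open \<Omega>" and p: "p \<in> U" "p \<in> frontier \<Omega>"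
  shows "outward_normal \<Omega> p = (1 / sqrt (1 + (norm (grad \<gamma> p))\<^sup>2)) *\<^sub>R (grad \<gamma> p - e)"
    (is "_ = ?c *\<^sub>R _")
proof -
  define \<nu> where "\<nu> = ?c *\<^sub>R (grad \<gamma> p - e)"
  have c: "?c > 0" by (simp add: add_pos_nonneg)
  have n1: "norm \<nu> = 1" 
    unfolding \<nu>_def using norm_grad_graph[OF bg, of p] c by (simp add: add_nonneg_eq_0_iff)
  define f where "f v t = \<gamma> (p + t *\<^sub>R v) - (p + t *\<^sub>R v) \<bullet> e" for v and t :: real
  have f0: "f v 0 = 0" for v using frontier_graph_iff[OF bg \<Omega>] p by (simp add: f_def)
  have fd: "(f v has_real_derivative v \<bullet> (grad \<gamma> p - e)) (at 0)" for v
  proof -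
    have "((\<lambda>t. p + t *\<^sub>R v) has_derivative (\<lambda>h. h *\<^sub>R v)) (at 0)" by (auto intro!: derivative_eq_intros)
    from has_derivative_compose[OF this C1_on_D[OF boundary_graphD(3)[OF bg]]]
    have "((\<lambda>t. \<gamma> (p + t *\<^sub>R v)) has_real_derivative grad \<gamma> p \<bullet> v) (at 0)"
      by (simp add: has_field_derivative_def mult_commute_abs)
    moreover have "((\<lambda>t. (p + t *\<^sub>R v) \<bullet> e) has_real_derivative v \<bullet> e) (at 0)"
      by (auto simp: inner_add_left intro!: derivative_eq_intros)
    ultimately show ?thesis unfolding f_def[abs_def]
      by (auto intro!: derivative_eq_intros simp: inner_diff_right inner_commute)
  qed
  have evU: "\<forall>\<^sub>F t in at_right 0. p + t *\<^sub>R v \<in> U" for v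
  proof -
    have "((\<lambda>t. p + t *\<^sub>R v) \<longlongrightarrow> p + 0 *\<^sub>R v) (at_right (0::real))" by (intro tendsto_intros)
    then show ?thesis using boundary_graphD(1)[OF bg] p(1) by (simp add: tendsto_def)
  qed
  have sgn: "v \<bullet> \<nu> = ?c * (v \<bullet> (grad \<gamma> p - e))" for v by (simp add: \<nu>_def)
  have neg: "\<forall>\<^sub>F t in at_right 0. p + t *\<^sub>R v \<in> \<Omega>" if "v \<bullet> \<nu> < 0" for v
  proof -
    have "v \<bullet> (grad \<gamma> p - e) < 0" using that c unfolding sgn by (simp only: mult_less_0_iff) auto
    from has_real_derivative_neg_dec_right[OF fd this] obtain d where
      d: "d > 0" "\<And>h. 0 < h \<Longrightarrow> h < d \<Longrightarrow> f v h < 0" by (auto simp: f0)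
    have "\<forall>\<^sub>F t in at_right 0. f v t < 0" unfolding eventually_at_right_field using d by auto
    with evU[of v] show ?thesis
      by eventually_elim (simp add: boundary_graphD(5)[OF bg] f_def)
  qed
  have pos: "\<forall>\<^sub>F t in at_right 0. p + t *\<^sub>R v \<notin> closure \<Omega>" if "v \<bullet> \<nu> > 0" for v
  proof -
    have "v \<bullet> (grad \<gamma> p - e) > 0" using that c unfolding sgn by (simp only: zero_less_mult_iff) auto
    from has_real_derivative_pos_inc_right[OF fd this] obtain d where
      d: "d > 0" "\<And>h. 0 < h \<Longrightarrow> h < d \<Longrightarrow> f v h > 0" by (auto simp: f0)
    have "\<forall>\<^sub>F t in at_right 0. f v t > 0" unfolding eventually_at_right_field using d by auto
    with evU[of v] show ?thesis
      by eventually_elim (simp add: closure_graph_iff[OF bg] f_def)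
  qed
  have "outward_normal \<Omega> p = \<nu>"
    unfolding outward_normal_def
  proof (rule the_equality)
    fix \<mu> assume \<mu>: "norm \<mu> = 1 \<and>
     (\<forall>v. v \<bullet> \<mu> < 0 \<longrightarrow> (\<forall>\<^sub>F t in at_right 0. p + t *\<^sub>R v \<in> \<Omega>)) \<and>
     (\<forall>v. v \<bullet> \<mu> > 0 \<longrightarrow> (\<forall>\<^sub>F t in at_right 0. p + t *\<^sub>R v \<notin> closure \<Omega>))"
    show "\<mu> = \<nu>"
    proof (rule ccontr)
      assume "\<mu> \<noteq> \<nu>"
      \<comment> \<open>Distinct unit vectors have inner product below 1, so
        \<open>\<mu> - \<nu>\<close> is an inward direction for \<nu> and an outward one for \<mu>:
        the same ray would start inside \<Omega> and off its closure.\<close>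
      then have p: "(\<mu> - \<nu>) \<bullet> (\<mu> - \<nu>) > 0" by (simp only: inner_gt_zero_iff) simp
      have n: "\<mu> \<bullet> \<mu> = 1" "\<nu> \<bullet> \<nu> = 1" using \<mu> n1 by (simp_all only: norm_eq_1)
      have "\<mu> \<bullet> \<nu> < 1" using p unfolding inner_diff_left inner_diff_right n inner_commute[of \<nu> \<mu>] by simp
      then have "(\<mu> - \<nu>) \<bullet> \<nu> < 0" "(\<mu> - \<nu>) \<bullet> \<mu> > 0"
        unfolding inner_diff_left n inner_commute[of \<nu> \<mu>] by simp_all
      then have "\<forall>\<^sub>F t in at_right 0. p + t *\<^sub>R (\<mu> - \<nu>) \<in> \<Omega>" 
        "\<forall>\<^sub>F t in at_right 0. p + t *\<^sub>R (\<mu> - \<nu>) \<notin> closure \<Omega>"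
        using neg \<mu> by blast+
      then have "\<forall>\<^sub>F t::real in at_right 0. False"
        by eventually_elim (use closure_subset in blast)
      then show False by (simp add: trivial_limit_at_right_real)
    qed
  qed (use n1 neg pos in auto)
  then show ?thesis by (simp add: \<nu>_def)
qed

lemma smooth_bounded_domainD:
  assumes "smooth_bounded_domain \<Omega>"
  shows "open \<Omega>" "bounded \<Omega>" "\<Omega> \<noteq> {}" "compact (closure \<Omega>)" "compact (frontier \<Omega>)"
    and "p \<in> frontier \<Omega> \<Longrightarrow> \<exists>U e \<gamma>. p \<in> U \<and> boundary_graph \<Omega> U e \<gamma>"
  using assms unfolding smooth_bounded_domain_def
  by (auto simp: compact_closure compact_frontier_bounded)

text \<open>The description by \<open>THE\<close> gives no continuity, but near each boundary point
  the normal agrees with the graph formula, which is continuous.\<close>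

lemma continuous_outward_normal:
  assumes \<Omega>: "smooth_bounded_domain \<Omega>"
  shows "continuous_on (frontier \<Omega>) (outward_normal \<Omega>)"
proof (rule continuous_on_eq_continuous_within[THEN iffD2], rule ballI)
  fix p assume p: "p \<in> frontier \<Omega>"
  obtain U e \<gamma> where U: "p \<in> U" "boundary_graph \<Omega> U e \<gamma>"
    using smooth_bounded_domainD(6)[OF \<Omega> p] by blast
  let ?g = "\<lambda>p. (1 / sqrt (1 + (norm (grad \<gamma> p))\<^sup>2)) *\<^sub>R (grad \<gamma> p - e)"
  have nz: "1 + (norm (grad \<gamma> x))\<^sup>2 \<noteq> 0" for x
    by (metis add_nonneg_eq_0_iff zero_le_one zero_le_power2 zero_neq_one)
  have "continuous_on (frontier \<Omega>) ?g"
    by (intro continuous_intros boundary_graph_continuous[OF U(2)]) (use nz in auto)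
  from bspec[OF this[unfolded continuous_on_def] p]
  have lim: "(?g \<longlongrightarrow> ?g p) (at p within frontier \<Omega>)" .
  have eq: "outward_normal \<Omega> x = ?g x" if "x \<in> U" "x \<in> frontier \<Omega>" for x
    by (rule outward_normal_graph[OF U(2) smooth_bounded_domainD(1)[OF \<Omega>] that])
  have "\<forall>\<^sub>F x in at p within frontier \<Omega>. ?g x = outward_normal \<Omega> x"
    unfolding eventually_at_topological
    by (rule exI[of _ U]) (use U(1) boundary_graphD(1)[OF U(2)] eq in force)
  from Lim_transform_eventually[OF lim this]
  show "continuous (at p within frontier \<Omega>) (outward_normal \<Omega>)"
    unfolding continuous_within eq[OF U(1) p] .
qed

section \<open>Integration against the surface measure\<close>

lemma surface_measureD:
  assumes "surface_measure \<Omega> \<sigma>"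
  shows "sets \<sigma> = sets (restrict_space borel (frontier \<Omega>))" "space \<sigma> = frontier \<Omega>"
    and "A \<in> sets borel \<Longrightarrow> A \<inter> frontier \<Omega> \<in> sets \<sigma>"
    and "f \<in> borel_measurable \<sigma> \<Longrightarrow> (\<lambda>x. indicator (frontier \<Omega>) x *\<^sub>R f x :: real) \<in> borel_measurable borel"
    and "continuous_on (frontier \<Omega>) g \<Longrightarrow> g \<in> measurable \<sigma> borel"
proof -
  show s: "sets \<sigma> = sets (restrict_space borel (frontier \<Omega>))"
    using assms by (simp add: surface_measure_def)
  then show "space \<sigma> = frontier \<Omega>"
    using sets_eq_imp_space_eq[OF s] by (simp add: space_restrict_space)
  show "A \<in> sets borel \<Longrightarrow> A \<inter> frontier \<Omega> \<in> sets \<sigma>"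
    unfolding s by (auto simp: sets_restrict_space)
  show "(\<lambda>x. indicator (frontier \<Omega>) x *\<^sub>R f x :: real) \<in> borel_measurable borel" if "f \<in> borel_measurable \<sigma>"
  proof -
    have "f \<in> borel_measurable (restrict_space borel (frontier \<Omega>))"
      using that unfolding measurable_cong_sets[OF s refl] .
    then show ?thesis
      by (subst (asm) borel_measurable_restrict_space_iff) (auto simp: frontier_closed borel_closed)
  qed
  show "continuous_on (frontier \<Omega>) g \<Longrightarrow> g \<in> measurable \<sigma> borel"
    unfolding measurable_cong_sets[OF s refl] by (rule borel_measurable_continuous_on_restrict)
qed

lemma emeasure_surface_graph:
  assumes "surface_measure \<Omega> \<sigma>" "boundary_graph \<Omega> U e \<gamma>" "A \<in> sets \<sigma>" "A \<subseteq> U"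
  shows "emeasure \<sigma> A = (\<integral>\<^sup>+ y. ennreal (sqrt (1 + (norm (grad \<gamma> y))\<^sup>2))
    * indicator A (y + \<gamma> y *\<^sub>R e) \<partial>hyperplane_measure e)"
  using assms(1)[unfolded surface_measure_def, THEN conjunct2, rule_format, OF assms(2-4)] .

text \<open>The defining formula for sets becomes an identity of Borel measures on the whole space,
  so that integrals of signed functions can be transported. The identity map moves \<sigma> off the
  subspace \<open>frontier \<Omega>\<close>, and the density restricts it to U.\<close>

lemma surface_measure_graph:
  assumes \<sigma>: "surface_measure \<Omega> \<sigma>" and bg: "boundary_graph \<Omega> U e \<gamma>"
  defines "s \<equiv> \<lambda>y. sqrt (1 + (norm (grad \<gamma> y))\<^sup>2)" and "T \<equiv> \<lambda>y. y + \<gamma> y *\<^sub>R e"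
  shows "density (distr \<sigma> borel (\<lambda>x. x)) (\<lambda>x. ennreal (indicator U x)) =
    distr (density (hyperplane_measure e) (\<lambda>y. ennreal (s y * indicator (U \<inter> frontier \<Omega>) (T y)))) borel T"
    (is "?L = ?R")
proof (rule measure_eqI)
  note [measurable] = boundary_graph_measurable[OF bg]
  have [measurable]: "U \<in> sets borel" "frontier \<Omega> \<in> sets borel"
    using boundary_graphD(1)[OF bg] by (auto simp: borel_open borel_closed frontier_closed)
  have Tm [measurable]: "T \<in> measurable borel borel" unfolding T_def by measurable
  have sm [measurable]: "s \<in> borel_measurable borel" unfolding s_def by measurable
  have s0: "s y \<ge> 0" for y by (simp add: s_def)
  have idm: "(\<lambda>x. x) \<in> measurable \<sigma> borel"
    by (rule surface_measureD(5)[OF \<sigma>]) (rule continuous_on_id)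
  fix A assume "A \<in> sets ?L"
  then have A [measurable]: "A \<in> sets borel" by simp
  have UA: "U \<inter> A \<inter> frontier \<Omega> \<in> sets \<sigma>" by (intro surface_measureD(3)[OF \<sigma>]) auto
  have "emeasure ?L A = (\<integral>\<^sup>+ x. ennreal (indicator U x) * indicator A x \<partial>distr \<sigma> borel (\<lambda>x. x))"
    by (simp add: emeasure_density)
  also have "\<dots> = (\<integral>\<^sup>+ x. indicator (U \<inter> A) x \<partial>distr \<sigma> borel (\<lambda>x. x))"
    by (intro nn_integral_cong) (auto simp: indicator_def)
  also have "\<dots> = emeasure \<sigma> (U \<inter> A \<inter> frontier \<Omega>)"
    by (simp add: emeasure_distr[OF idm] surface_measureD(2)[OF \<sigma>])
  also have "\<dots> = (\<integral>\<^sup>+ y. ennreal (s y) * indicator (U \<inter> A \<inter> frontier \<Omega>) (T y) \<partial>hyperplane_measure e)"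
    unfolding s_def T_def by (rule emeasure_surface_graph[OF \<sigma> bg UA]) blast
  also have "\<dots> = (\<integral>\<^sup>+ y. ennreal (s y * indicator (U \<inter> frontier \<Omega>) (T y)) * indicator (T -` A) y \<partial>hyperplane_measure e)"
    by (intro nn_integral_cong) (auto simp: indicator_def)
  also have "\<dots> = emeasure ?R A"
  proof (subst emeasure_distr)
    show "T \<in> measurable (density (hyperplane_measure e) (\<lambda>y. ennreal (s y * indicator (U \<inter> frontier \<Omega>) (T y)))) borel"
      by measurable
  next
    have TA: "T -` A \<in> sets (hyperplane_measure e)" using measurable_sets[OF Tm A] by simp
    have "(\<lambda>y. ennreal (s y * indicator (U \<inter> frontier \<Omega>) (T y))) \<in> borel_measurable (hyperplane_measure e)"
      by measurable
    from emeasure_density[OF this TA]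
    show "(\<integral>\<^sup>+ y. ennreal (s y * indicator (U \<inter> frontier \<Omega>) (T y)) * indicator (T -` A) y \<partial>hyperplane_measure e)
      = emeasure (density (hyperplane_measure e) (\<lambda>y. ennreal (s y * indicator (U \<inter> frontier \<Omega>) (T y))))
          (T -` A \<inter> space (density (hyperplane_measure e) (\<lambda>y. ennreal (s y * indicator (U \<inter> frontier \<Omega>) (T y)))))"
      by (simp only: space_density space_hyperplane_measure Int_UNIV_right)
  qed (rule A)
  finally show "emeasure ?L A = emeasure ?R A" .
qed simp

lemma integral_surface_graph:
  fixes f :: "'a::euclidean_space \<Rightarrow> real"
  assumes \<sigma>: "surface_measure \<Omega> \<sigma>" and bg: "boundary_graph \<Omega> U e \<gamma>"
    and f: "f \<in> borel_measurable \<sigma>" "\<And>x. x \<in> frontier \<Omega> - U \<Longrightarrow> f x = 0"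
  shows "(LINT x|\<sigma>. f x) = (LINT y|hyperplane_measure e.
    sqrt (1 + (norm (grad \<gamma> y))\<^sup>2) * (indicator (U \<inter> frontier \<Omega>) (y + \<gamma> y *\<^sub>R e) * f (y + \<gamma> y *\<^sub>R e)))"
proof -
  note [measurable] = boundary_graph_measurable[OF bg]
  have [measurable]: "U \<in> sets borel" "frontier \<Omega> \<in> sets borel"
    using boundary_graphD(1)[OF bg] by (auto simp: borel_open borel_closed frontier_closed)
  have idm: "(\<lambda>x. x) \<in> measurable \<sigma> borel"
    by (rule surface_measureD(5)[OF \<sigma>]) (rule continuous_on_id)
  \<comment> \<open>f is measurable only for the Borel sets of the frontier; its extension by zero
    is Borel on the whole space, as composition with the graph map requires.\<close>
  define g where "g x = indicator (frontier \<Omega>) x *\<^sub>R f x" for x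
  have [measurable]: "g \<in> borel_measurable borel"
    unfolding g_def[abs_def] by (rule surface_measureD(4)[OF \<sigma> f(1)])
  have "(LINT x|\<sigma>. f x) = (LINT x|\<sigma>. indicator U x * g x)"
    using f(2) surface_measureD(2)[OF \<sigma>]
    by (intro Bochner_Integration.integral_cong) (auto simp: g_def indicator_def)
  also have "\<dots> = (LINT x|distr \<sigma> borel (\<lambda>x. x). indicator U x *\<^sub>R g x)"
    by (subst integral_distr[OF idm]) auto
  also have "\<dots> = (LINT x|density (distr \<sigma> borel (\<lambda>x. x)) (\<lambda>x. ennreal (indicator U x)). g x)"
    by (subst integral_density) auto
  also have "\<dots> = (LINT y|density (hyperplane_measure e) (\<lambda>y. ennreal (sqrt (1 + (norm (grad \<gamma> y))\<^sup>2)
      * indicator (U \<inter> frontier \<Omega>) (y + \<gamma> y *\<^sub>R e))). g (y + \<gamma> y *\<^sub>R e))"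
    unfolding surface_measure_graph[OF \<sigma> bg] by (rule integral_distr) measurable
  also have "\<dots> = (LINT y|hyperplane_measure e.
    (sqrt (1 + (norm (grad \<gamma> y))\<^sup>2) * indicator (U \<inter> frontier \<Omega>) (y + \<gamma> y *\<^sub>R e)) *\<^sub>R g (y + \<gamma> y *\<^sub>R e))"
  proof (rule integral_density)
    show "(\<lambda>y. g (y + \<gamma> y *\<^sub>R e)) \<in> borel_measurable (hyperplane_measure e)" by measurable
    show "(\<lambda>y. sqrt (1 + (norm (grad \<gamma> y))\<^sup>2) * indicator (U \<inter> frontier \<Omega>) (y + \<gamma> y *\<^sub>R e))
        \<in> borel_measurable (hyperplane_measure e)" by measurable
  qed simp
  also have "\<dots> = (LINT y|hyperplane_measure e.
    sqrt (1 + (norm (grad \<gamma> y))\<^sup>2) * (indicator (U \<inter> frontier \<Omega>) (y + \<gamma> y *\<^sub>R e) * f (y + \<gamma> y *\<^sub>R e)))"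
    by (intro Bochner_Integration.integral_cong) (auto simp: g_def indicator_def)
  finally show ?thesis .
qed

lemma norm_le_norm_add_orthogonal:
  fixes y e :: "'a::real_inner"
  assumes "y \<bullet> e = 0" shows "norm y \<le> norm (y + t *\<^sub>R e)"
proof -
  have "(norm (y + t *\<^sub>R e))\<^sup>2 = (norm y)\<^sup>2 + (norm (t *\<^sub>R e))\<^sup>2"
    by (rule norm_add_Pythagorean) (simp add: orthogonal_def assms)
  then have "(norm y)\<^sup>2 \<le> (norm (y + t *\<^sub>R e))\<^sup>2" by simp
  then show ?thesis by (rule power2_le_imp_le) simp
qed

text \<open>The foot y of a boundary point is orthogonal to e and hence no longer than the point.
  Over the resulting bounded disc the slope is bounded and the hyperplane measure is finite.\<close>

lemma emeasure_surface_cball_finite: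
  fixes \<Omega> :: "'a::euclidean_space set"
  assumes \<sigma>: "surface_measure \<Omega> \<sigma>" and bg: "boundary_graph \<Omega> U e \<gamma>" and sub: "cball p r \<subseteq> U"
  shows "emeasure \<sigma> (cball p r \<inter> frontier \<Omega>) < \<infinity>"
proof -
  let ?A = "cball p r \<inter> frontier \<Omega>" and ?B = "cball (0::'a) (norm p + r)"
  have A: "?A \<in> sets \<sigma>" by (intro surface_measureD(3)[OF \<sigma>]) auto
  have "bounded ((\<lambda>y. sqrt (1 + (norm (grad \<gamma> y))\<^sup>2)) ` ?B)"
    by (intro compact_imp_bounded compact_continuous_image continuous_intros boundary_graph_continuous[OF bg]) auto
  then obtain C where C: "\<And>y. y \<in> ?B \<Longrightarrow> sqrt (1 + (norm (grad \<gamma> y))\<^sup>2) \<le> C"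
    by (fastforce simp: bounded_iff)
  have "emeasure \<sigma> ?A = (\<integral>\<^sup>+ y. ennreal (sqrt (1 + (norm (grad \<gamma> y))\<^sup>2)) * indicator ?A (y + \<gamma> y *\<^sub>R e) \<partial>hyperplane_measure e)"
    by (rule emeasure_surface_graph[OF \<sigma> bg A]) (use sub in blast)
  also have "\<dots> \<le> (\<integral>\<^sup>+ y. ennreal C * indicator ?B y \<partial>hyperplane_measure e)"
  proof (rule nn_integral_mono_AE)
    show "AE y in hyperplane_measure e. ennreal (sqrt (1 + (norm (grad \<gamma> y))\<^sup>2)) * indicator ?A (y + \<gamma> y *\<^sub>R e) \<le> ennreal C * indicator ?B y"
      using AE_hyperplane_measure[OF boundary_graphD(2)[OF bg]]
    proof eventually_elim
      case (elim y)
      show ?case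
      proof (cases "y + \<gamma> y *\<^sub>R e \<in> ?A")
        case True
        have "norm y \<le> norm (y + \<gamma> y *\<^sub>R e)" by (rule norm_le_norm_add_orthogonal[OF elim])
        also have "\<dots> \<le> norm p + r"
          using True norm_triangle_ineq2[of "y + \<gamma> y *\<^sub>R e" p] by (simp add: dist_norm norm_minus_commute[of p])
        finally show ?thesis using True C[of y] by (simp add: ennreal_leI)
      qed simp
    qed
  qed
  also have "\<dots> = ennreal C * emeasure (hyperplane_measure e) ?B"
    by (rule nn_integral_cmult_indicator) simp
  also have "\<dots> < \<infinity>"
    using emeasure_hyperplane_bounded[OF boundary_graphD(2)[OF bg]] by (simp add: ennreal_mult_less_top)
  finally show ?thesis .
qed

text \<open>\<open>surface_measure\<close> prescribes values only inside single graph neighbourhoods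
  and does not state finiteness; finitely many small balls covering the compact frontier supply
  it.\<close>

lemma finite_surface_measure:
  assumes \<Omega>: "smooth_bounded_domain \<Omega>" and \<sigma>: "surface_measure \<Omega> \<sigma>"
  shows "finite_measure \<sigma>"
proof
  have "\<exists>r>0. emeasure \<sigma> (cball p r \<inter> frontier \<Omega>) < \<infinity>" if p: "p \<in> frontier \<Omega>" for p
  proof -
    obtain U e \<gamma> where U: "p \<in> U" "boundary_graph \<Omega> U e \<gamma>"
      using smooth_bounded_domainD(6)[OF \<Omega> p] by blast
    then obtain r where "r > 0" "cball p r \<subseteq> U"
      using boundary_graphD(1) open_contains_cball by metis
    then show ?thesis using emeasure_surface_cball_finite[OF \<sigma> U(2)] by blast
  qed
  then obtain r where r: "\<And>p. p \<in> frontier \<Omega> \<Longrightarrow> r p > 0 \<and> emeasure \<sigma> (cball p (r p) \<inter> frontier \<Omega>) < \<infinity>"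
    by metis
  have cover: "frontier \<Omega> \<subseteq> (\<Union>p\<in>frontier \<Omega>. ball p (r p))"
  proof
    fix p assume "p \<in> frontier \<Omega>"
    then show "p \<in> (\<Union>p\<in>frontier \<Omega>. ball p (r p))" using r[of p] by (intro UN_I[of p]) simp_all
  qed
  obtain D where D: "D \<subseteq> frontier \<Omega>" "finite D" "frontier \<Omega> \<subseteq> (\<Union>p\<in>D. ball p (r p))"
  proof (rule compactE_image[OF smooth_bounded_domainD(5)[OF \<Omega>], of "frontier \<Omega>" "\<lambda>p. ball p (r p)"])
    show "open (ball p (r p))" for p by (rule open_ball)
    show "frontier \<Omega> \<subseteq> (\<Union>p\<in>frontier \<Omega>. ball p (r p))" by (rule cover)
  qed (rule that)
  have sub: "(\<Union>p\<in>D. cball p (r p) \<inter> frontier \<Omega>) = frontier \<Omega>"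
  proof (intro equalityI subsetI)
    fix x assume x: "x \<in> frontier \<Omega>"
    then obtain p where "p \<in> D" "x \<in> ball p (r p)" using D(3) by blast
    then show "x \<in> (\<Union>p\<in>D. cball p (r p) \<inter> frontier \<Omega>)" using x by (intro UN_I[of p]) auto
  qed blast
  have "emeasure \<sigma> (\<Union>p\<in>D. cball p (r p) \<inter> frontier \<Omega>) \<le> (\<Sum>p\<in>D. emeasure \<sigma> (cball p (r p) \<inter> frontier \<Omega>))"
    using surface_measureD(3)[OF \<sigma>, of "cball p (r p)" for p]
    by (intro emeasure_subadditive_finite D(2)) auto
  also have "\<dots> < \<infinity>"
    using D(1,2) r by (simp add: subset_iff)
  finally show "emeasure \<sigma> (space \<sigma>) \<noteq> \<infinity>"
    unfolding sub surface_measureD(2)[OF \<sigma>] by simp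
qed

lemma integrable_surface_continuous:
  fixes f :: "'a::euclidean_space \<Rightarrow> real"
  assumes \<Omega>: "smooth_bounded_domain \<Omega>" and \<sigma>: "surface_measure \<Omega> \<sigma>" and f: "continuous_on (frontier \<Omega>) f"
  shows "integrable \<sigma> f"
proof -
  interpret finite_measure \<sigma> by (rule finite_surface_measure[OF \<Omega> \<sigma>])
  have "bounded (f ` frontier \<Omega>)"
    by (intro compact_imp_bounded compact_continuous_image f smooth_bounded_domainD(5)[OF \<Omega>])
  then obtain B where "\<And>x. x \<in> frontier \<Omega> \<Longrightarrow> norm (f x) \<le> B" by (auto simp: bounded_iff)
  then show ?thesis
    by (intro integrable_const_bound[where B=B] surface_measureD(5)[OF \<sigma> f])
      (auto simp: surface_measureD(2)[OF \<sigma>] intro!: AE_I2)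
qed

section \<open>The divergence theorem\<close>

lemma integrable_indicator_bounded:
  fixes f :: "'a::euclidean_space \<Rightarrow> real"
  assumes "bounded S" "S \<in> sets borel" "continuous_on S f" "bounded (f ` S)"
  shows "set_integrable lborel S f"
proof -
  obtain B where B: "\<And>x. x \<in> S \<Longrightarrow> \<bar>f x\<bar> \<le> B" using assms(4) by (auto simp: bounded_iff)
  have "integrable lborel (\<lambda>x. indicator S x *\<^sub>R f x)"
  proof (rule integrableI_bounded_set[where A=S and B=B])
    show "(\<lambda>x. indicator S x *\<^sub>R f x) \<in> borel_measurable lborel"
      using borel_measurable_continuous_on_indicator[OF _ assms(3)] assms(2) by simp
    show "AE x in lborel. x \<in> S \<longrightarrow> norm (indicator S x *\<^sub>R f x) \<le> B"
      using B by (intro AE_I2) simp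
  qed (use assms emeasure_bounded_finite in auto)
  then show ?thesis by (simp add: set_integrable_def)
qed

lemma set_integrable_bounded_mult:
  fixes f g :: "'a::euclidean_space \<Rightarrow> real"
  assumes S: "S \<in> sets borel" and g: "set_integrable lborel S g" 
    and f: "continuous_on S f" "bounded (f ` S)"
  shows "set_integrable lborel S (\<lambda>x. f x * g x)"
proof -
  obtain B where B: "\<And>x. x \<in> S \<Longrightarrow> \<bar>f x\<bar> \<le> B" using f(2) by (auto simp: bounded_iff)
  have m: "(\<lambda>x. indicator S x *\<^sub>R f x) \<in> borel_measurable lborel"
    using borel_measurable_continuous_on_indicator[OF S f(1)] by simp
  have i: "integrable lborel (\<lambda>x. indicator S x *\<^sub>R g x)" using g by (simp add: set_integrable_def)
  have "integrable lborel (\<lambda>x. (indicator S x *\<^sub>R f x) * (indicator S x *\<^sub>R g x))"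
  proof (rule Bochner_Integration.integrable_bound)
    show "integrable lborel (\<lambda>x. B * (indicator S x *\<^sub>R g x))" using i by (rule integrable_mult_right)
    show "AE x in lborel. norm ((indicator S x *\<^sub>R f x) * (indicator S x *\<^sub>R g x)) \<le> norm (B * (indicator S x *\<^sub>R g x))"
    proof (rule AE_I2)
      fix x show "norm ((indicator S x *\<^sub>R f x) * (indicator S x *\<^sub>R g x)) \<le> norm (B * (indicator S x *\<^sub>R g x))"
        using B[of x] by (cases "x \<in> S") (auto simp: abs_mult intro!: mult_right_mono)
    qed
  qed (use m i in auto)
  moreover have "(\<lambda>x. (indicator S x *\<^sub>R f x) * (indicator S x *\<^sub>R g x)) = (\<lambda>x. indicator S x *\<^sub>R (f x * g x))"
    by (auto simp: indicator_def)
  ultimately show ?thesis by (simp add: set_integrable_def)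
qed

section \<open>The divergence theorem in one local graph\<close>

text \<open>The field is supported, up to the boundary, in a compact part of a single graph
  neighbourhood. Of its derivatives only the divergence is controlled near the boundary, which is
  all that is available for the gradient of a solution.\<close>

locale graph_piece =
  fixes \<Omega> U :: "'a::euclidean_space set" and e :: 'a and \<gamma> :: "'a \<Rightarrow> real" and K :: "'a set" and F :: "'a \<Rightarrow> 'a"
  assumes bdd: "bounded \<Omega>" and \<Omega>: "open \<Omega>" and bg: "boundary_graph \<Omega> U e \<gamma>" and K: "compact K" "K \<subseteq> U"
    and F: "continuous_on (closure \<Omega>) F" "C1_field \<Omega> F" "\<And>x. x \<in> closure \<Omega> - K \<Longrightarrow> F x = 0"
    and di: "set_integrable lborel \<Omega> (divg F)"
begin

definition "height x = x \<bullet> e - \<gamma> x"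

text \<open>The normal is left unnormalised: \<open>grad \<gamma> x - e\<close> is minus the
  gradient of \<open>height\<close>. Outside \<Omega> the field is replaced by zero, since nothing
  is known about F off the closure.\<close>

definition "flux x = (grad \<gamma> x - e) \<bullet> (indicator \<Omega> x *\<^sub>R F x)"

text \<open>The limit of \<open>flux\<close> on the graph. The indicator also cuts down to U,
  because outside U the graph of \<gamma> need not be the boundary of \<Omega>.\<close>

definition "bflux x = (grad \<gamma> x - e) \<bullet> (indicator (U \<inter> frontier \<Omega>) x *\<^sub>R F x)"

lemma height_C1: "C1_on UNIV height"
  unfolding height_def[abs_def] by (intro C1_on_diff C1_on_inner boundary_graphD(3)[OF bg])

lemma grad_height: "grad height x = e - grad \<gamma> x"
proof (rule grad_eqI)
  show "(height has_derivative (\<lambda>h. (e - grad \<gamma> x) \<bullet> h)) (at x)"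
    unfolding height_def[abs_def]
    using C1_on_D[OF boundary_graphD(3)[OF bg], of x]
    by (auto intro!: derivative_eq_intros simp: inner_diff_left inner_diff_right inner_commute)
qed

lemma flux_measurable: "flux \<in> borel_measurable borel"
proof -
  have "(\<lambda>x. indicator \<Omega> x *\<^sub>R F x) \<in> borel_measurable borel"
    by (rule borel_measurable_continuous_on_indicator) (use \<Omega> C1_field_continuous[OF F(2)] in auto)
  then show ?thesis
    unfolding flux_def[abs_def] using boundary_graph_measurable(2)[OF bg] by measurable
qed

lemma flux_bounded: obtains C R where "C \<ge> 0" "\<And>x. \<bar>flux x\<bar> \<le> C * indicator (cball 0 R) x"
proof -
  have cK: "compact (K \<inter> closure \<Omega>)" by (intro compact_Int_closed K closed_closure)
  have cF: "continuous_on (K \<inter> closure \<Omega>) F" by (rule continuous_on_subset[OF F(1)]) auto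
  have "bounded ((\<lambda>x. (grad \<gamma> x - e) \<bullet> F x) ` (K \<inter> closure \<Omega>))"
    by (intro compact_imp_bounded compact_continuous_image continuous_intros cK cF boundary_graph_continuous[OF bg])
  then obtain C where C: "\<And>x. x \<in> K \<inter> closure \<Omega> \<Longrightarrow> \<bar>(grad \<gamma> x - e) \<bullet> F x\<bar> \<le> C"
    unfolding bounded_iff by (metis (no_types, lifting) imageI real_norm_def)
  obtain R where R: "\<And>x. x \<in> K \<Longrightarrow> norm x \<le> R"
    using compact_imp_bounded[OF K(1)] by (auto simp: bounded_iff)
  have "\<bar>flux x\<bar> \<le> max C 0 * indicator (cball 0 R) x" for x
  proof (cases "x \<in> \<Omega> \<and> x \<in> K")
    case True
    then have "x \<in> K \<inter> closure \<Omega>" using closure_subset by blast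
    then show ?thesis using True C[of x] R[of x] by (simp add: flux_def)
  next
    case False
    then have "flux x = 0" using F(3)[of x] closure_subset[of \<Omega>] by (auto simp: flux_def indicator_def)
    then show ?thesis by simp
  qed
  then show thesis using that[of "max C 0" R] by auto
qed

text \<open>The cut-off field has compact support in \<Omega>, so its divergence integrates to zero,
  and the product rule splits that divergence into the two integrands. Both appear with a plus sign
  because \<open>flux\<close> is built on the negative gradient of \<open>height\<close>.\<close>

lemma integral_cutoff_divg:
  assumes "\<epsilon> > 0"
  shows "(LINT x:\<Omega>|lborel. cutoff (height x / \<epsilon>) * divg F x) =
    (LINT x|lborel. cutoff' (height x / \<epsilon>) / \<epsilon> * flux x)"
proof -
  define cut where "cut x = cutoff (height x / \<epsilon>)" for x
  have q: "((\<lambda>t. cutoff (t / \<epsilon>)) has_real_derivative cutoff' (t / \<epsilon>) / \<epsilon>) (at t)" for t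
    by (rule DERIV_cong[OF DERIV_chain2[OF has_derivative_cutoff]])
      (use assms in \<open>auto intro!: derivative_eq_intros\<close>)
  have cutC1: "C1_on UNIV cut"
    unfolding cut_def[abs_def]
    by (rule C1_on_compose[OF height_C1 q])
      (intro continuous_intros continuous_on_compose2[OF continuous_cutoff'[of UNIV]]; use assms in simp)
  have gcut: "grad cut x = (cutoff' (height x / \<epsilon>) / \<epsilon>) *\<^sub>R (e - grad \<gamma> x)" for x
    unfolding cut_def[abs_def] grad_height[symmetric]
    by (intro grad_eqI has_derivative_compose_real q) (use height_C1 in \<open>auto simp: C1_on_def\<close>)
  have cutc: "continuous_on \<Omega> cut" using C1_on_imp_continuous[OF cutC1] continuous_on_subset by blast
  have cutF: "C1_field \<Omega> (\<lambda>x. cut x *\<^sub>R F x)"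
    by (rule C1_field_scaleR[OF C1_on_subset[OF cutC1] F(2)]) auto
  \<comment> \<open>K bounds the support sideways, and the condition on the height keeps it away
    from the graph.\<close>
  let ?K = "K \<inter> {x. \<epsilon> \<le> height x}"
  have z: "(LINT x:\<Omega>|lborel. divg (\<lambda>x. cut x *\<^sub>R F x) x) = 0"
  proof (rule integral_divg_compact_support[OF \<Omega> cutF])
    show "compact ?K"
      by (intro compact_Int_closed K closed_Collect_le continuous_intros C1_on_imp_continuous[OF height_C1])
    show "?K \<subseteq> \<Omega>"
      using boundary_graphD(5)[OF bg] K(2) assms by (force simp: height_def)
    fix x assume x: "x \<in> \<Omega> - ?K"
    show "cut x *\<^sub>R F x = 0"
    proof (cases "x \<in> K")
      case True
      then have "height x / \<epsilon> \<le> 1" using x assms by (auto simp: field_simps)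
      then show ?thesis by (simp add: cut_def cutoff_eq)
    next
      case False
      then show ?thesis using F(3) x closure_subset by force
    qed
  qed
  have i1: "set_integrable lborel \<Omega> (\<lambda>x. cut x * divg F x)"
    by (rule set_integrable_bounded_mult[OF _ di cutc])
      (use \<Omega> abs_cutoff_le in \<open>auto simp: bounded_iff cut_def intro!: exI[of _ 1]\<close>)
  obtain C R where CR: "C \<ge> 0" "\<And>x. \<bar>flux x\<bar> \<le> C * indicator (cball 0 R) x" using flux_bounded by blast
  have hm: "height \<in> borel_measurable borel"
    by (intro borel_measurable_continuous_onI C1_on_imp_continuous height_C1)
  have cm: "cutoff' \<in> borel_measurable borel"
    by (intro borel_measurable_continuous_onI continuous_cutoff')
  have i2: "integrable lborel (\<lambda>x. cutoff' (height x / \<epsilon>) / \<epsilon> * flux x)"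
  proof (rule Bochner_Integration.integrable_bound)
    show "integrable lborel (\<lambda>x::'a. 1 / \<epsilon> * (C * indicator (cball 0 R) x))"
      using emeasure_lborel_cball_finite
      by (intro integrable_mult_right integrable_real_indicator) auto
    show "(\<lambda>x. cutoff' (height x / \<epsilon>) / \<epsilon> * flux x) \<in> borel_measurable lborel"
      using flux_measurable hm cm by measurable
    show "AE x in lborel. norm (cutoff' (height x / \<epsilon>) / \<epsilon> * flux x) \<le> norm (1 / \<epsilon> * (C * indicator (cball 0 R) x))"
    proof (rule AE_I2)
      fix x :: 'a
      have "\<bar>cutoff' (height x / \<epsilon>)\<bar> * \<bar>flux x\<bar> \<le> 1 * (C * indicator (cball 0 R) x)"
        using cutoff'_bound[of "height x / \<epsilon>"] CR by (intro mult_mono) auto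
      then show "norm (cutoff' (height x / \<epsilon>) / \<epsilon> * flux x) \<le> norm (1 / \<epsilon> * (C * indicator (cball 0 R) x))"
        using assms CR(1) by (simp add: abs_mult field_simps)
    qed
  qed
  have "(LINT x:\<Omega>|lborel. divg (\<lambda>x. cut x *\<^sub>R F x) x)
     = (LINT x|lborel. indicator \<Omega> x *\<^sub>R (cut x * divg F x) - cutoff' (height x / \<epsilon>) / \<epsilon> * flux x)"
    unfolding set_lebesgue_integral_def
  proof (rule Bochner_Integration.integral_cong[OF refl])
    fix x
    show "indicator \<Omega> x *\<^sub>R divg (\<lambda>x. cut x *\<^sub>R F x) x =
      indicator \<Omega> x *\<^sub>R (cut x * divg F x) - cutoff' (height x / \<epsilon>) / \<epsilon> * flux x"
    proof (cases "x \<in> \<Omega>")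
      case True
      then show ?thesis
        using divg_scaleR[OF C1_on_subset[OF cutC1] F(2) True]
        by (simp add: gcut flux_def inner_diff_left algebra_simps diff_divide_distrib)
    qed (simp add: flux_def)
  qed
  also have "\<dots> = (LINT x:\<Omega>|lborel. cut x * divg F x) - (LINT x|lborel. cutoff' (height x / \<epsilon>) / \<epsilon> * flux x)"
    using i1 i2 by (simp add: set_lebesgue_integral_def set_integrable_def)
  finally show ?thesis using z by (simp add: cut_def)
qed

text \<open>Both sides of \<open>integral_cutoff_divg\<close> converge. On the left the cutoff tends
  to 1 wherever the divergence is not already zero. On the right, at height
  \<open>\<epsilon> * t\<close> over y, the volume element absorbs the factor
  \<open>1 / \<epsilon>\<close> and the tent depends on t alone, so only the argument of
  \<open>flux\<close> moves, and it moves to the boundary. The unit mass of the tent removes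
  t.\<close>

lemma integral_divg_graph:
  "(LINT x:\<Omega>|lborel. divg F x) = (LINT y|hyperplane_measure e. bflux (y + \<gamma> y *\<^sub>R e))"
proof -
  note e = boundary_graphD(2)[OF bg]
  define P where "P = hyperplane_measure e \<Otimes>\<^sub>M (lborel :: real measure)"
  interpret H: sigma_finite_measure "hyperplane_measure e" by (rule sigma_finite_hyperplane_measure[OF e])
  interpret HP: pair_sigma_finite "hyperplane_measure e" "lborel :: real measure" ..
  define X where "X n = inverse (real (Suc n))" for n
  have X: "X n > 0" for n by (simp add: X_def)
  have X0: "X \<longlonglongrightarrow> 0" unfolding X_def by (rule LIMSEQ_inverse_real_of_nat)
  have hm [measurable]: "height \<in> borel_measurable borel"
    by (intro borel_measurable_continuous_onI C1_on_imp_continuous height_C1)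
  have cm [measurable]: "cutoff' \<in> borel_measurable borel"
    by (intro borel_measurable_continuous_onI continuous_cutoff')
  have qm: "cutoff \<in> borel_measurable borel"
    by (intro borel_measurable_continuous_onI) (meson DERIV_isCont continuous_at_imp_continuous_on has_derivative_cutoff)
  note [measurable] = boundary_graph_measurable[OF bg] flux_measurable
  have oU: "open U" by (rule boundary_graphD(1)[OF bg])
  have e1: "e \<bullet> e = 1" using boundary_graphD(6)[OF bg] by (simp add: norm_eq_1)

  have "(\<lambda>n. LINT x:\<Omega>|lborel. cutoff (height x / X n) * divg F x) \<longlonglongrightarrow> (LINT x:\<Omega>|lborel. divg F x)"
    unfolding set_lebesgue_integral_def
  proof (rule integral_dominated_convergence[where w="\<lambda>x. \<bar>indicator \<Omega> x *\<^sub>R divg F x\<bar>"])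
    have dm: "(\<lambda>x. indicator \<Omega> x *\<^sub>R divg F x) \<in> borel_measurable lborel"
      using di by (auto simp: set_integrable_def)
    then show "(\<lambda>x. indicator \<Omega> x *\<^sub>R divg F x) \<in> borel_measurable lborel" .
    have "(\<lambda>x. cutoff (height x / X n) * (indicator \<Omega> x *\<^sub>R divg F x)) \<in> borel_measurable lborel" for n
      using dm qm by measurable
    then show "(\<lambda>x. indicator \<Omega> x *\<^sub>R (cutoff (height x / X n) * divg F x)) \<in> borel_measurable lborel" for n
      by (simp add: mult.left_commute)
    show "integrable lborel (\<lambda>x. \<bar>indicator \<Omega> x *\<^sub>R divg F x\<bar>)"
      using di by (auto simp: set_integrable_def)
    show "AE x in lborel. norm (indicator \<Omega> x *\<^sub>R (cutoff (height x / X n) * divg F x)) \<le> \<bar>indicator \<Omega> x *\<^sub>R divg F x\<bar>" for n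
    proof (rule AE_I2)
      fix x
      have "\<bar>cutoff (height x / X n)\<bar> * \<bar>divg F x\<bar> \<le> 1 * \<bar>divg F x\<bar>"
        by (intro mult_right_mono abs_cutoff_le) simp
      then show "norm (indicator \<Omega> x *\<^sub>R (cutoff (height x / X n) * divg F x)) \<le> \<bar>indicator \<Omega> x *\<^sub>R divg F x\<bar>"
        by (auto simp: indicator_def abs_mult)
    qed
    show "AE x in lborel. (\<lambda>n. indicator \<Omega> x *\<^sub>R (cutoff (height x / X n) * divg F x)) \<longlonglongrightarrow> indicator \<Omega> x *\<^sub>R divg F x"
    proof (rule AE_I2)
      fix x
      show "(\<lambda>n. indicator \<Omega> x *\<^sub>R (cutoff (height x / X n) * divg F x)) \<longlonglongrightarrow> indicator \<Omega> x *\<^sub>R divg F x"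
      proof (cases "x \<in> \<Omega> \<and> x \<in> U")
        case True
        then have h: "height x > 0" using boundary_graphD(5)[OF bg, of x] by (simp add: height_def)
        \<comment> \<open>3 is the argument from which \<open>cutoff\<close> equals 1.\<close>
        have "\<forall>\<^sub>F n in sequentially. X n < height x / 3"
          using X0 h by (intro order_tendstoD) auto
        then have "\<forall>\<^sub>F n in sequentially. cutoff (height x / X n) = 1"
        proof eventually_elim
          case (elim n)
          then have "3 \<le> height x / X n" using X[of n] by (simp add: field_simps)
          then show ?case by (simp add: cutoff_eq)
        qed
        then have "\<forall>\<^sub>F n in sequentially. indicator \<Omega> x *\<^sub>R (cutoff (height x / X n) * divg F x) = indicator \<Omega> x *\<^sub>R divg F x"
          by eventually_elim simp
        then show ?thesis by (rule tendsto_eventually)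
      next
        case False
        \<comment> \<open>Points of \<Omega> outside U lie in the open set
          \<open>\<Omega> - K\<close>, on which F vanishes; the divergence is zero there whatever
          the cutoff does.\<close>
        have "indicator \<Omega> x *\<^sub>R divg F x = 0"
        proof (cases "x \<in> \<Omega>")
          case True
          have "divg F x = 0"
          proof (rule divg_zero_open)
            show "open (\<Omega> - K)" by (intro open_Diff \<Omega> compact_imp_closed K)
            show "x \<in> \<Omega> - K" using True False K(2) by blast
            show "F y = 0" if "y \<in> \<Omega> - K" for y using F(3) that closure_subset by blast
          qed
          then show ?thesis by simp
        qed simp
        then have "(\<lambda>n. indicator \<Omega> x *\<^sub>R (cutoff (height x / X n) * divg F x)) = (\<lambda>n. indicator \<Omega> x *\<^sub>R divg F x)"
          by (intro ext) auto
        then show ?thesis by (simp only: tendsto_const)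
      qed
    qed
  qed
  moreover have "(LINT x:\<Omega>|lborel. cutoff (height x / X n) * divg F x) =
    (LINT z|P. cutoff' (height (fst z + (\<gamma> (fst z) + X n * snd z) *\<^sub>R e) / X n)
        * flux (fst z + (\<gamma> (fst z) + X n * snd z) *\<^sub>R e))" for n
  proof -
    have "(\<lambda>x. cutoff' (height x / X n) / X n * flux x) \<in> borel_measurable borel"
      by measurable
    from integral_lborel_graph[OF e boundary_graph_measurable(1)[OF bg] X[of n] this]
    show ?thesis using X[of n] unfolding integral_cutoff_divg[OF X] P_def by simp
  qed
  moreover have "(\<lambda>n. LINT z|P. cutoff' (height (fst z + (\<gamma> (fst z) + X n * snd z) *\<^sub>R e) / X n)
        * flux (fst z + (\<gamma> (fst z) + X n * snd z) *\<^sub>R e))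
      \<longlonglongrightarrow> (LINT y|hyperplane_measure e. bflux (y + \<gamma> y *\<^sub>R e))"
  proof -
    have ht: "height (y + (\<gamma> y + s) *\<^sub>R e) = s" if "y \<bullet> e = 0" for y s
      using that by (simp add: height_def boundary_graphD(4)[OF bg] inner_add_left e1)
    obtain C R where CR: "C \<ge> 0" "\<And>x. \<bar>flux x\<bar> \<le> C * indicator (cball 0 R) x" using flux_bounded by blast
    \<comment> \<open>{1..3} contains the support of the tent. The disc suffices in y because y is
      no longer than the point at which \<open>flux\<close> is evaluated.\<close>
    define w where "w z = C * (indicator (cball 0 R \<times> {1..3}) z :: real)" for z :: "'a \<times> real"
    have "emeasure P (cball 0 R \<times> {1..3}) < \<infinity>"
      unfolding P_def using emeasure_hyperplane_bounded[OF e]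
      by (subst lborel.emeasure_pair_measure_Times) (auto simp: ennreal_mult_less_top)
    then have wi: "integrable P w"
      unfolding w_def[abs_def] by (intro integrable_mult_right integrable_real_indicator) (auto simp: P_def)
    have AE0: "AE z in P. fst z \<bullet> e = 0"
      unfolding P_def
    proof (rule HP.AE_pair_measure)
      show "{z \<in> space (hyperplane_measure e \<Otimes>\<^sub>M lborel). fst z \<bullet> e = 0} \<in> sets (hyperplane_measure e \<Otimes>\<^sub>M lborel)"
        by measurable
      show "AE y in hyperplane_measure e. AE t in (lborel :: real measure). fst (y, t) \<bullet> e = 0"
        using AE_hyperplane_measure[OF e] by eventually_elim simp
    qed
    let ?s = "\<lambda>n z. cutoff' (height (fst z + (\<gamma> (fst z) + X n * snd z) *\<^sub>R e) / X n)
        * flux (fst z + (\<gamma> (fst z) + X n * snd z) *\<^sub>R e)"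
    let ?l = "\<lambda>z. cutoff' (snd z) * bflux (fst z + \<gamma> (fst z) *\<^sub>R e)"
    have lim: "(\<lambda>n. ?s n (y, t)) \<longlonglongrightarrow> ?l (y, t)" if y: "y \<bullet> e = 0" for y and t :: real
    proof (cases "t > 0")
      case False
      \<comment> \<open>These points do not lie above the graph, where \<Omega> is; the tent
        vanishes at t, so both sides are 0 and no limit of \<open>flux\<close> is asked for.\<close>
      then have "cutoff' t = 0" by (simp add: cutoff'_eq_0)
      then show ?thesis using ht[OF y] less_imp_neq[OF X, symmetric] by simp
    next
      case t: True
      define p where "p = y + \<gamma> y *\<^sub>R e"
      define x where "x n = y + (\<gamma> y + X n * t) *\<^sub>R e" for n
      have xp: "x \<longlonglongrightarrow> p"
      proof -
        have "(\<lambda>n. y + (\<gamma> y + X n * t) *\<^sub>R e) \<longlonglongrightarrow> y + (\<gamma> y + 0 * t) *\<^sub>R e"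
          by (intro tendsto_intros X0)
        then show ?thesis by (simp add: x_def[abs_def] p_def)
      qed
      have hx: "height (x n) = X n * t" for n unfolding x_def by (rule ht[OF y])
      have hp: "height p = 0" using ht[OF y, of 0] by (simp add: p_def)
      \<comment> \<open>The points \<open>x n\<close> approach p from above the graph. If p is in U,
        it is a boundary point and F is continuous up to it. Otherwise p is off K, so
        \<open>flux\<close> is eventually zero, matching the indicator in
        \<open>bflux\<close>.\<close>
      have "(\<lambda>n. flux (x n)) \<longlonglongrightarrow> bflux p"
      proof (cases "p \<in> U")
        case True
        have pf: "p \<in> frontier \<Omega>"
          using frontier_graph_iff[OF bg \<Omega> True] hp by (simp add: height_def)
        have evU: "\<forall>\<^sub>F n in sequentially. x n \<in> U" using xp oU True by (rule topological_tendstoD)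
        then have ev: "\<forall>\<^sub>F n in sequentially. x n \<in> \<Omega>"
        proof eventually_elim
          case (elim n)
          have "height (x n) > 0" using hx X t by simp
          then show ?case using boundary_graphD(5)[OF bg elim] by (simp add: height_def)
        qed
        have "(\<lambda>n. (grad \<gamma> (x n) - e) \<bullet> F (x n)) \<longlonglongrightarrow> (grad \<gamma> p - e) \<bullet> F p"
        proof (intro tendsto_intros)
          show "(\<lambda>n. grad \<gamma> (x n)) \<longlonglongrightarrow> grad \<gamma> p"
            by (rule continuous_on_tendsto_compose[OF boundary_graph_continuous(2)[OF bg, of UNIV] xp]) auto
          show "(\<lambda>n. F (x n)) \<longlonglongrightarrow> F p"
            by (rule continuous_on_tendsto_compose[OF F(1) xp])
              (use pf ev closure_subset in \<open>auto simp: frontier_def elim!: eventually_mono\<close>)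
        qed
        moreover have "\<forall>\<^sub>F n in sequentially. (grad \<gamma> (x n) - e) \<bullet> F (x n) = flux (x n)"
          using ev by eventually_elim (simp add: flux_def)
        ultimately show ?thesis using pf True by (simp add: bflux_def tendsto_cong)
      next
        case False
        then have "p \<in> - K" using K(2) by blast
        then have "\<forall>\<^sub>F n in sequentially. x n \<in> - K"
          by (intro topological_tendstoD[OF xp]) (use K(1) compact_imp_closed in auto)
        then have "\<forall>\<^sub>F n in sequentially. flux (x n) = 0"
        proof eventually_elim
          case (elim n)
          then show ?case using F(3)[of "x n"] closure_subset[of \<Omega>] by (auto simp: flux_def indicator_def)
        qed
        then have "(\<lambda>n. flux (x n)) \<longlonglongrightarrow> 0" by (rule tendsto_eventually)
        then show ?thesis using False by (simp add: bflux_def)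
      qed
      then have "(\<lambda>n. cutoff' t * flux (x n)) \<longlonglongrightarrow> cutoff' t * bflux p" by (rule tendsto_mult_left)
      moreover have "cutoff' (height (x n) / X n) = cutoff' t" for n using hx X[of n] by simp
      ultimately show ?thesis by (simp add: x_def p_def)
    qed
    have bound: "norm (?s n z) \<le> w z" if y: "fst z \<bullet> e = 0" for n z
    proof -
      obtain y t where z: "z = (y, t)" by (cases z)
      have c: "\<bar>cutoff' t\<bar> \<le> indicator {1..3} t"
        using cutoff'_bound[of t] cutoff'_eq_0[of t] by (auto simp: indicator_def)
      have "norm y \<le> norm (y + (\<gamma> y + X n * t) *\<^sub>R e)"
        by (rule norm_le_norm_add_orthogonal) (use y z in simp)
      then have "\<bar>flux (y + (\<gamma> y + X n * t) *\<^sub>R e)\<bar> \<le> C * indicator (cball 0 R) y"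
        using CR(2)[of "y + (\<gamma> y + X n * t) *\<^sub>R e"] CR(1)
        by (cases "norm (y + (\<gamma> y + X n * t) *\<^sub>R e) \<le> R") (auto simp: indicator_def)
      with c have "\<bar>cutoff' t\<bar> * \<bar>flux (y + (\<gamma> y + X n * t) *\<^sub>R e)\<bar> \<le> indicator {1..3} t * (C * indicator (cball 0 R) y)"
        by (intro mult_mono) auto
      then show ?thesis
        using y X[of n] unfolding z w_def
        by (simp add: ht abs_mult indicator_times mult_ac)
    qed
    have sm: "?s n \<in> borel_measurable P" for n unfolding P_def by measurable
    have lm: "?l \<in> borel_measurable P"
    proof -
      have "U \<inter> frontier \<Omega> \<in> sets borel" using oU by (auto simp: borel_open borel_closed frontier_closed)
      moreover have "continuous_on (U \<inter> frontier \<Omega>) F"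
        by (rule continuous_on_subset[OF F(1)]) (auto simp: frontier_def)
      ultimately have "(\<lambda>x. indicator (U \<inter> frontier \<Omega>) x *\<^sub>R F x) \<in> borel_measurable borel"
        by (rule borel_measurable_continuous_on_indicator)
      then have [measurable]: "bflux \<in> borel_measurable borel"
        unfolding bflux_def[abs_def] by measurable
      show ?thesis unfolding P_def by measurable
    qed
    have AEl: "AE z in P. (\<lambda>n. ?s n z) \<longlonglongrightarrow> ?l z"
      using AE0 by eventually_elim (use lim in force)
    have AEb: "AE z in P. norm (?s n z) \<le> w z" for n
      using AE0 by eventually_elim (rule bound)
    have il: "integrable P ?l"
      by (rule integrable_dominated_convergence[OF lm sm wi AEl AEb])
    have "(\<lambda>n. LINT z|P. ?s n z) \<longlonglongrightarrow> (LINT z|P. ?l z)"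
      by (rule integral_dominated_convergence[OF lm sm wi AEl AEb])
    also have "(LINT z|P. ?l z) = (LINT y|hyperplane_measure e. LINT t|lborel. ?l (y, t))"
      using HP.integral_fst'[of ?l] il unfolding P_def by simp
    also have "\<dots> = (LINT y|hyperplane_measure e. bflux (y + \<gamma> y *\<^sub>R e))"
      using integral_cutoff' by simp
    finally show ?thesis .
  qed
  ultimately show ?thesis using LIMSEQ_unique by auto
qed

end

text \<open>The area density of the surface integral is the length of
  \<open>grad \<gamma> y - e\<close>, so it cancels the normalisation of the outward normal and
  leaves \<open>bflux\<close>.\<close>

lemma divergence_graph_piece:
  fixes F :: "'a::euclidean_space \<Rightarrow> 'a"
  assumes dom: "smooth_bounded_domain \<Omega>" and \<sigma>: "surface_measure \<Omega> \<sigma>" and bg: "boundary_graph \<Omega> U e \<gamma>"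
    and K: "compact K" "K \<subseteq> U"
    and F: "continuous_on (closure \<Omega>) F" "C1_field \<Omega> F" "\<And>x. x \<in> closure \<Omega> - K \<Longrightarrow> F x = 0"
    and di: "set_integrable lborel \<Omega> (divg F)"
  shows "(LINT x:\<Omega>|lborel. divg F x) = (LINT x|\<sigma>. F x \<bullet> outward_normal \<Omega> x)"
proof -
  note \<Omega> = smooth_bounded_domainD[OF dom]
  interpret graph_piece \<Omega> U e \<gamma> K F
    using \<Omega>(2,1) bg K F di by unfold_locales
  have fc: "frontier \<Omega> \<subseteq> closure \<Omega>" by (auto simp: frontier_def)
  have "(LINT x|\<sigma>. F x \<bullet> outward_normal \<Omega> x) = (LINT y|hyperplane_measure e.
    sqrt (1 + (norm (grad \<gamma> y))\<^sup>2) * (indicator (U \<inter> frontier \<Omega>) (y + \<gamma> y *\<^sub>R e)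
      * (F (y + \<gamma> y *\<^sub>R e) \<bullet> outward_normal \<Omega> (y + \<gamma> y *\<^sub>R e))))"
  proof (rule integral_surface_graph[OF \<sigma> bg])
    show "(\<lambda>x. F x \<bullet> outward_normal \<Omega> x) \<in> borel_measurable \<sigma>"
      by (intro surface_measureD(5)[OF \<sigma>] continuous_on_inner continuous_outward_normal[OF dom]
          continuous_on_subset[OF F(1) fc])
    show "F x \<bullet> outward_normal \<Omega> x = 0" if "x \<in> frontier \<Omega> - U" for x
    proof -
      have "x \<in> closure \<Omega> - K" using fc K(2) that by blast
      then show ?thesis using F(3) by simp
    qed
  qed
  also have "\<dots> = (LINT y|hyperplane_measure e. bflux (y + \<gamma> y *\<^sub>R e))"
  proof (rule Bochner_Integration.integral_cong[OF refl])
    fix y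
    define p where "p = y + \<gamma> y *\<^sub>R e"
    have "sqrt (1 + (norm (grad \<gamma> y))\<^sup>2) > 0" by (simp add: add_pos_nonneg)
    moreover have "grad \<gamma> p = grad \<gamma> y" unfolding p_def by (rule grad_graph_translate[OF bg])
    ultimately show "sqrt (1 + (norm (grad \<gamma> y))\<^sup>2) * (indicator (U \<inter> frontier \<Omega>) (y + \<gamma> y *\<^sub>R e)
      * (F (y + \<gamma> y *\<^sub>R e) \<bullet> outward_normal \<Omega> (y + \<gamma> y *\<^sub>R e))) = bflux (y + \<gamma> y *\<^sub>R e)"
      using outward_normal_graph[OF bg \<Omega>(1), of p]
      unfolding p_def[symmetric]
      by (cases "p \<in> U \<inter> frontier \<Omega>") (auto simp: bflux_def inner_commute)
  qed
  also have "\<dots> = (LINT x:\<Omega>|lborel. divg F x)"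
    by (rule integral_divg_graph[symmetric])
  finally show ?thesis by simp
qed

section \<open>Partition of unity and the global theorem\<close>

lemma divg_sum:
  assumes "finite I" "\<And>i. i \<in> I \<Longrightarrow> C1_field S (G i)" "x \<in> S"
  shows "divg (\<lambda>x. \<Sum>i\<in>I. G i x) x = (\<Sum>i\<in>I. divg (G i) x)"
proof -
  have "partial b (\<lambda>y. (\<Sum>i\<in>I. G i y) \<bullet> b) x = (\<Sum>i\<in>I. partial b (\<lambda>y. G i y \<bullet> b) x)"
    if b: "b \<in> Basis" for b
  proof -
    have "((\<lambda>y. \<Sum>i\<in>I. G i y \<bullet> b) has_derivative (\<lambda>h. \<Sum>i\<in>I. grad (\<lambda>y. G i y \<bullet> b) x \<bullet> h)) (at x)"
    proof (rule has_derivative_sum)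
      fix i assume "i \<in> I"
      then have "C1_on S (\<lambda>y. G i y \<bullet> b)" using assms(2) b by (simp add: C1_field_def)
      then show "((\<lambda>y. G i y \<bullet> b) has_derivative (\<lambda>h. grad (\<lambda>y. G i y \<bullet> b) x \<bullet> h)) (at x)"
        by (rule C1_on_D[OF _ assms(3)])
    qed
    from partial_eqI[OF this, of b] show ?thesis using b by (simp add: inner_sum_left grad_inner_Basis)
  qed
  then have "divg (\<lambda>x. \<Sum>i\<in>I. G i x) x = (\<Sum>b\<in>Basis. \<Sum>i\<in>I. partial b (\<lambda>y. G i y \<bullet> b) x)"
    unfolding divg_def by (intro sum.cong refl)
  also have "\<dots> = (\<Sum>i\<in>I. divg (G i) x)"
    unfolding divg_def by (rule sum.swap)
  finally show ?thesis .
qed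

lemma bounded_image_closure:
  fixes f :: "'a::euclidean_space \<Rightarrow> 'b::metric_space"
  assumes "bounded \<Omega>" "continuous_on (closure \<Omega>) f"
  shows "bounded (f ` \<Omega>)"
proof -
  have "compact (f ` closure \<Omega>)"
    by (intro compact_continuous_image assms) (simp add: assms compact_closure)
  then show ?thesis by (meson bounded_subset closure_subset compact_imp_bounded image_mono)
qed

text \<open>\<open>ramp\<close> applied to the squared radius minus the squared distance is C^1,
  also at the centre, and positive exactly on the open ball; these bumps are divided by their sum.
  The sum is 1 on an open W and not only on C, so that a field and the sum of its pieces agree near
  every point and have the same divergence.\<close>

lemma partition_of_unity_C1:
  fixes C :: "'a::euclidean_space set"
  assumes C: "compact C" and r: "\<And>p. p \<in> C \<Longrightarrow> r p > 0"
  obtains D W \<phi> where "finite D" "D \<subseteq> C" "open W" "C \<subseteq> W"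
    "\<And>p. p \<in> D \<Longrightarrow> C1_on W (\<phi> p)" "\<And>p x. p \<in> D \<Longrightarrow> x \<notin> cball p (r p) \<Longrightarrow> \<phi> p x = 0"
    "\<And>x. x \<in> W \<Longrightarrow> (\<Sum>p\<in>D. \<phi> p x) = (1::real)"
proof -
  have cover: "C \<subseteq> (\<Union>p\<in>C. ball p (r p))"
  proof
    fix p assume "p \<in> C"
    then show "p \<in> (\<Union>p\<in>C. ball p (r p))" using r[of p] by (intro UN_I[of p]) simp_all
  qed
  obtain D where D: "D \<subseteq> C" "finite D" "C \<subseteq> (\<Union>p\<in>D. ball p (r p))"
  proof (rule compactE_image[OF C, of C "\<lambda>p. ball p (r p)"])
    show "open (ball p (r p))" for p by (rule open_ball)
    show "C \<subseteq> (\<Union>p\<in>C. ball p (r p))" by (rule cover)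
  qed (rule that)
  define \<psi> where "\<psi> p x = ramp ((r p)\<^sup>2 - (norm (x - p))\<^sup>2)" for p x
  define S where "S x = (\<Sum>p\<in>D. \<psi> p x)" for x
  define W where "W = {x. S x > 0}"
  have ramp0: "ramp t \<ge> 0" for t by (simp add: ramp_def)
  have \<psi>C1: "C1_on UNIV (\<psi> p)" for p
    unfolding \<psi>_def[abs_def]
  proof (rule C1_on_compose[where f="\<lambda>x. (r p)\<^sup>2 - (norm (x - p))\<^sup>2" and q=ramp and q'="max 0"])
    show "(ramp has_real_derivative max 0 ((r p)\<^sup>2 - (norm (x - p))\<^sup>2)) (at ((r p)\<^sup>2 - (norm (x - p))\<^sup>2))" for x
      by (rule has_derivative_ramp)
    have n: "(norm (x - p))\<^sup>2 = (x - p) \<bullet> (x - p)" for x by (rule power2_norm_eq_inner)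
    show "C1_on UNIV (\<lambda>x. (r p)\<^sup>2 - (norm (x - p))\<^sup>2)"
      unfolding n
    proof (rule C1_on_I[where g="\<lambda>x. (- 2) *\<^sub>R (x - p)"])
      show "((\<lambda>x. (r p)\<^sup>2 - (x - p) \<bullet> (x - p)) has_derivative (\<lambda>h. ((- 2) *\<^sub>R (x - p)) \<bullet> h)) (at x)" for x
        by (auto intro!: derivative_eq_intros ext simp: inner_commute algebra_simps)
    qed (intro continuous_intros)
    show "continuous_on ((\<lambda>x. (r p)\<^sup>2 - (norm (x - p))\<^sup>2) ` UNIV) (max 0)"
      by (intro continuous_intros)
  qed
  have SC1: "C1_on UNIV S" unfolding S_def[abs_def] by (intro C1_on_sum D(2) \<psi>C1)
  have oW: "open W"
    unfolding W_def by (intro open_Collect_less continuous_intros C1_on_imp_continuous[OF SC1])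
  have CW: "C \<subseteq> W"
  proof
    fix x assume "x \<in> C"
    then obtain p where p: "p \<in> D" "x \<in> ball p (r p)" using D(3) by blast
    then have "norm (x - p) < r p" by (simp add: dist_norm norm_minus_commute[of x])
    then have "(norm (x - p))\<^sup>2 < (r p)\<^sup>2" by (intro power_strict_mono) auto
    then have "\<psi> p x > 0" by (simp add: \<psi>_def ramp_def)
    then have "S x > 0"
      unfolding S_def using D(2) p(1) ramp0 by (intro sum_pos2[of _ p]) (auto simp: \<psi>_def)
    then show "x \<in> W" by (simp add: W_def)
  qed
  have inv: "C1_on W (\<lambda>x. inverse (S x))"
  proof (rule C1_on_compose[where f=S and q=inverse and q'="\<lambda>t. - (inverse t * inverse t)"])
    show "C1_on W S" by (rule C1_on_subset[OF SC1]) simp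
    show "(inverse has_real_derivative - (inverse (S x) * inverse (S x))) (at (S x))" if "x \<in> W" for x
      using that DERIV_inverse[of "S x" UNIV] by (simp add: W_def power2_eq_square)
    show "continuous_on (S ` W) (\<lambda>t. - (inverse t * inverse t))"
      by (intro continuous_intros) (auto simp: W_def)
  qed
  show thesis
  proof (rule that[of D W "\<lambda>p x. \<psi> p x * inverse (S x)"])
    show "C1_on W (\<lambda>x. \<psi> p x * inverse (S x))" for p
      by (intro C1_on_mult inv C1_on_subset[OF \<psi>C1]) simp
    show "\<psi> p x * inverse (S x) = 0" if "x \<notin> cball p (r p)" and "p \<in> D" for p x
    proof -
      have "r p \<ge> 0" using r[of p] D(1) that(2) by fastforce
      moreover have "r p \<le> norm (x - p)" using that(1) by (simp add: dist_norm norm_minus_commute[of x])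
      ultimately have "(r p)\<^sup>2 \<le> (norm (x - p))\<^sup>2" by (intro power_mono)
      then show ?thesis by (simp add: \<psi>_def ramp_def)
    qed
    show "(\<Sum>p\<in>D. \<psi> p x * inverse (S x)) = 1" if "x \<in> W" for x
      using that by (simp add: sum_distrib_right[symmetric] S_def[symmetric] W_def)
  qed (use D oW CW in auto)
qed

theorem divergence_theorem:
  fixes F :: "'a::euclidean_space \<Rightarrow> 'a"
  assumes dom: "smooth_bounded_domain \<Omega>" and \<sigma>: "surface_measure \<Omega> \<sigma>"
    and F: "continuous_on (closure \<Omega>) F" "C1_field \<Omega> F"
    and di: "set_integrable lborel \<Omega> (divg F)"
  shows "(LINT x:\<Omega>|lborel. divg F x) = (LINT x|\<sigma>. F x \<bullet> outward_normal \<Omega> x)"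
proof -
  note \<Omega> = smooth_bounded_domainD[OF dom]
  have fc: "frontier \<Omega> \<subseteq> closure \<Omega>" by (auto simp: frontier_def)
  have oc: "\<Omega> \<subseteq> closure \<Omega>" by (rule closure_subset)
  have "\<exists>r>0. cball p r \<subseteq> \<Omega> \<or> (\<exists>U e \<gamma>. boundary_graph \<Omega> U e \<gamma> \<and> cball p r \<subseteq> U)"
    if p: "p \<in> closure \<Omega>" for p
  proof (cases "p \<in> \<Omega>")
    case True
    then show ?thesis using \<Omega>(1) open_contains_cball by metis
  next
    case False
    then have "p \<in> frontier \<Omega>" using p \<Omega>(1) by (simp add: frontier_def interior_open)
    from \<Omega>(6)[OF this] obtain U e \<gamma> where U: "p \<in> U" "boundary_graph \<Omega> U e \<gamma>" by blast
    moreover obtain r where "r > 0" "cball p r \<subseteq> U"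
      using U boundary_graphD(1) open_contains_cball by metis
    ultimately show ?thesis by blast
  qed
  then obtain r where r: "\<And>p. p \<in> closure \<Omega> \<Longrightarrow> r p > 0 \<and>
      (cball p (r p) \<subseteq> \<Omega> \<or> (\<exists>U e \<gamma>. boundary_graph \<Omega> U e \<gamma> \<and> cball p (r p) \<subseteq> U))"
    by metis
  then have r0: "\<And>p. p \<in> closure \<Omega> \<Longrightarrow> r p > 0" by blast
  obtain D W \<phi> where D: "finite D" "D \<subseteq> closure \<Omega>" and W: "open W" "closure \<Omega> \<subseteq> W"
    and \<phi>: "\<And>p. p \<in> D \<Longrightarrow> C1_on W (\<phi> p)" "\<And>p x. p \<in> D \<Longrightarrow> x \<notin> cball p (r p) \<Longrightarrow> \<phi> p x = 0"
    and \<phi>1: "\<And>x. x \<in> W \<Longrightarrow> (\<Sum>p\<in>D. \<phi> p x) = (1::real)"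
  proof (rule partition_of_unity_C1[of "closure \<Omega>" r])
    show "compact (closure \<Omega>)" by (rule \<Omega>(4))
    show "r p > 0" if "p \<in> closure \<Omega>" for p using that by (rule r0)
  qed (rule that)
  have \<phi>\<Omega>: "C1_on \<Omega> (\<phi> p)" if "p \<in> D" for p
    by (rule C1_on_subset[OF \<phi>(1)[OF that]]) (use W(2) oc in blast)
  define G where "G p x = \<phi> p x *\<^sub>R F x" for p x
  have G1: "C1_field \<Omega> (G p)" if "p \<in> D" for p
    unfolding G_def[abs_def] by (rule C1_field_scaleR[OF \<phi>\<Omega>[OF that] F(2)])
  have Gc: "continuous_on (closure \<Omega>) (G p)" if "p \<in> D" for p
    unfolding G_def[abs_def]
    by (intro continuous_intros F(1) continuous_on_subset[OF C1_on_imp_continuous[OF \<phi>(1)[OF that]] W(2)])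
  \<comment> \<open>By the product rule the divergence of a piece is a bounded multiple of
    \<open>divg F\<close> plus a bounded function; no single derivative of F has to be
    integrable.\<close>
  have Gi: "set_integrable lborel \<Omega> (divg (G p))" if p: "p \<in> D" for p
  proof -
    have c: "continuous_on (closure \<Omega>) (\<phi> p)" "continuous_on (closure \<Omega>) (\<lambda>x. grad (\<phi> p) x \<bullet> F x)"
      by (intro continuous_intros F(1) continuous_on_subset[OF C1_on_imp_continuous[OF \<phi>(1)[OF p]] W(2)]
          continuous_on_subset[OF C1_on_grad[OF \<phi>(1)[OF p]] W(2)])+
    have 1: "set_integrable lborel \<Omega> (\<lambda>x. \<phi> p x * divg F x)"
      by (rule set_integrable_bounded_mult[OF _ di continuous_on_subset[OF c(1) oc] bounded_image_closure[OF \<Omega>(2) c(1)]])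
        (use \<Omega>(1) in auto)
    have 2: "set_integrable lborel \<Omega> (\<lambda>x. grad (\<phi> p) x \<bullet> F x)"
      by (rule integrable_indicator_bounded[OF \<Omega>(2) _ continuous_on_subset[OF c(2) oc] bounded_image_closure[OF \<Omega>(2) c(2)]])
        (use \<Omega>(1) in auto)
    have "set_integrable lborel \<Omega> (\<lambda>x. \<phi> p x * divg F x + grad (\<phi> p) x \<bullet> F x)"
      by (rule set_integral_add(1)[OF 1 2])
    moreover have "indicator \<Omega> x *\<^sub>R divg (G p) x = indicator \<Omega> x *\<^sub>R (\<phi> p x * divg F x + grad (\<phi> p) x \<bullet> F x)" for x
      using divg_scaleR[OF \<phi>\<Omega>[OF p] F(2), of x] by (cases "x \<in> \<Omega>") (simp_all add: G_def[abs_def])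
    ultimately show ?thesis by (simp only: set_integrable_def)
  qed
  have piece: "(LINT x:\<Omega>|lborel. divg (G p) x) = (LINT x|\<sigma>. G p x \<bullet> outward_normal \<Omega> x)" if p: "p \<in> D" for p
  proof -
    have G0: "G p x = 0" if "x \<in> closure \<Omega> - cball p (r p)" for x
      using that \<phi>(2)[OF p] by (simp add: G_def)
    consider "cball p (r p) \<subseteq> \<Omega>" | U e \<gamma> where "boundary_graph \<Omega> U e \<gamma>" "cball p (r p) \<subseteq> U"
      using r[of p] D(2) p by blast
    then show ?thesis
    proof cases
      case 1
      \<comment> \<open>A ball inside the open set \<Omega> misses the frontier, so an interior
        piece contributes nothing to either side.\<close>
      have "(LINT x:\<Omega>|lborel. divg (G p) x) = 0"
        by (rule integral_divg_compact_support[OF \<Omega>(1) G1[OF p] compact_cball 1]) (use G0 oc in blast)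
      moreover have "(LINT x|\<sigma>. G p x \<bullet> outward_normal \<Omega> x) = (LINT x|\<sigma>. 0)"
      proof (rule Bochner_Integration.integral_cong[OF refl])
        fix x assume "x \<in> space \<sigma>"
        then have "x \<in> frontier \<Omega>" by (simp add: surface_measureD(2)[OF \<sigma>])
        then have "x \<in> closure \<Omega> - cball p (r p)" using 1 \<Omega>(1) by (auto simp: frontier_def interior_open)
        then show "G p x \<bullet> outward_normal \<Omega> x = 0" using G0 by simp
      qed
      ultimately show ?thesis by simp
    next
      case 2
      show ?thesis
        by (rule divergence_graph_piece[OF dom \<sigma> 2(1) compact_cball 2(2) Gc[OF p] G1[OF p] G0 Gi[OF p]])
    qed
  qed
  have sumG: "(\<Sum>p\<in>D. G p x) = F x" if "x \<in> W" for x
    using \<phi>1[OF that] by (simp add: G_def scaleR_sum_left[symmetric])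
  have "(LINT x:\<Omega>|lborel. divg F x) = (LINT x|lborel. (\<Sum>p\<in>D. indicator \<Omega> x *\<^sub>R divg (G p) x))"
    unfolding set_lebesgue_integral_def
  proof (rule Bochner_Integration.integral_cong[OF refl])
    fix x
    show "indicator \<Omega> x *\<^sub>R divg F x = (\<Sum>p\<in>D. indicator \<Omega> x *\<^sub>R divg (G p) x)"
    proof (cases "x \<in> \<Omega>")
      case True
      have "divg F x = divg (\<lambda>x. \<Sum>p\<in>D. G p x) x"
        by (rule divg_cong_open[OF W(1)]) (use True oc W(2) sumG in auto)
      also have "\<dots> = (\<Sum>p\<in>D. divg (G p) x)" by (rule divg_sum[OF D(1) G1 True])
      finally show ?thesis by (simp add: True)
    qed simp
  qed
  also have "\<dots> = (\<Sum>p\<in>D. LINT x:\<Omega>|lborel. divg (G p) x)"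
    unfolding set_lebesgue_integral_def
    by (rule Bochner_Integration.integral_sum) (use Gi in \<open>simp add: set_integrable_def\<close>)
  also have "\<dots> = (\<Sum>p\<in>D. LINT x|\<sigma>. G p x \<bullet> outward_normal \<Omega> x)"
    by (intro sum.cong refl piece)
  also have "\<dots> = (LINT x|\<sigma>. (\<Sum>p\<in>D. G p x \<bullet> outward_normal \<Omega> x))"
    by (rule Bochner_Integration.integral_sum[symmetric])
      (intro integrable_surface_continuous[OF dom \<sigma>] continuous_intros continuous_outward_normal[OF dom]
        continuous_on_subset[OF Gc fc])
  also have "\<dots> = (LINT x|\<sigma>. F x \<bullet> outward_normal \<Omega> x)"
    by (rule Bochner_Integration.integral_cong[OF refl])
      (use sumG W(2) fc in \<open>auto simp: inner_sum_left[symmetric] surface_measureD(2)[OF \<sigma>]\<close>)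
  finally show ?thesis .
qed

section \<open>Green's identity for test functions with a trace\<close>

text \<open>On a finite measure space Cauchy-Schwarz against the constant 1 turns convergence in L^2
  into convergence of integrals. The separate q is the quantity that \<open>has_trace\<close> sends
  to zero, as a nonnegative integral; it only has to dominate the squared difference up to a
  constant.\<close>

lemma integral_tendsto_of_square:
  fixes f :: "nat \<Rightarrow> 'a \<Rightarrow> real"
  assumes M: "finite_measure M" and f: "\<And>j. integrable M (f j)" and g: "integrable M g"
    and q: "\<And>j. q j \<in> borel_measurable M" and C: "0 \<le> C"
    and le: "\<And>j x. x \<in> space M \<Longrightarrow> (f j x - g x)\<^sup>2 \<le> C * q j x"
    and lim: "(\<lambda>j. \<integral>\<^sup>+ x. ennreal (q j x) \<partial>M) \<longlonglongrightarrow> 0"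
  shows "(\<lambda>j. LINT x|M. f j x) \<longlonglongrightarrow> (LINT x|M. g x)"
proof -
  interpret finite_measure M by (rule M)
  define X where "X j = \<bar>(LINT x|M. f j x) - (LINT x|M. g x)\<bar>" for j
  let ?c = "ennreal C * emeasure M (space M)"
  have bound: "ennreal ((X j)\<^sup>2) \<le> ?c * (\<integral>\<^sup>+ x. ennreal (q j x) \<partial>M)" for j
  proof -
    note [measurable] = q[of j] borel_measurable_integrable[OF f[of j]] borel_measurable_integrable[OF g]
    have i: "integrable M (\<lambda>x. f j x - g x)" by (intro Bochner_Integration.integrable_diff f g)
    have "X j = \<bar>LINT x|M. f j x - g x\<bar>" unfolding X_def using f g by simp
    also have "\<dots> \<le> (LINT x|M. \<bar>f j x - g x\<bar>)" using integral_norm_bound[of M "\<lambda>x. f j x - g x"] by simp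
    finally have "ennreal (X j) \<le> ennreal (LINT x|M. \<bar>f j x - g x\<bar>)" by (rule ennreal_leI)
    also have "\<dots> = (\<integral>\<^sup>+ x. ennreal \<bar>f j x - g x\<bar> * 1 \<partial>M)"
      using nn_integral_eq_integral[OF integrable_abs[OF i]] by simp
    finally have a: "ennreal (X j) \<le> (\<integral>\<^sup>+ x. ennreal \<bar>f j x - g x\<bar> * 1 \<partial>M)" .
    have "ennreal ((X j)\<^sup>2) = (ennreal (X j))\<^sup>2"
      by (rule ennreal_power[symmetric]) (simp add: X_def)
    also have "\<dots> \<le> (\<integral>\<^sup>+ x. ennreal \<bar>f j x - g x\<bar> * 1 \<partial>M)\<^sup>2"
      by (intro power_mono a) simp
    also have "\<dots> \<le> (\<integral>\<^sup>+ x. (ennreal \<bar>f j x - g x\<bar>)\<^sup>2 \<partial>M) * (\<integral>\<^sup>+ x. 1\<^sup>2 \<partial>M)"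
      by (rule Cauchy_Schwarz_nn_integral) measurable
    also have "\<dots> \<le> (\<integral>\<^sup>+ x. ennreal C * ennreal (q j x) \<partial>M) * (\<integral>\<^sup>+ x. 1\<^sup>2 \<partial>M)"
    proof (intro mult_right_mono nn_integral_mono)
      fix x assume "x \<in> space M"
      then show "(ennreal \<bar>f j x - g x\<bar>)\<^sup>2 \<le> ennreal C * ennreal (q j x)"
        using le[of x j] C by (simp add: ennreal_power ennreal_leI flip: ennreal_mult')
    qed simp
    also have "\<dots> = ?c * (\<integral>\<^sup>+ x. ennreal (q j x) \<partial>M)"
      by (simp add: nn_integral_cmult mult_ac)
    finally show ?thesis .
  qed
  have "?c < top" by (simp add: ennreal_mult_eq_top_iff less_top[symmetric])
  from ennreal_tendsto_cmult[OF this lim]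
  have "(\<lambda>j. ?c * (\<integral>\<^sup>+ x. ennreal (q j x) \<partial>M)) \<longlonglongrightarrow> 0" by simp
  from tendsto_sandwich[OF always_eventually always_eventually tendsto_const this, of "\<lambda>j. ennreal ((X j)\<^sup>2)"]
  have "(\<lambda>j. ennreal ((X j)\<^sup>2)) \<longlonglongrightarrow> 0" using bound by simp
  then have "(\<lambda>j. (X j)\<^sup>2) \<longlonglongrightarrow> 0"
    using tendsto_ennreal_iff[of "\<lambda>j. (X j)\<^sup>2" sequentially 0] by simp
  then have "X \<longlonglongrightarrow> 0" by simp
  then have "(\<lambda>j. (LINT x|M. f j x) - (LINT x|M. g x)) \<longlonglongrightarrow> 0"
    unfolding X_def by (rule tendsto_rabs_zero_cancel)
  then show ?thesis by (rule LIM_zero_cancel)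
qed

text \<open>Stated for vector values so that it covers products of functions as well as inner
  products of gradients.\<close>

lemma set_integrable_inner_L2:
  fixes f g :: "'a::euclidean_space \<Rightarrow> 'b::euclidean_space"
  assumes S: "open S" and f: "continuous_on S f" "set_integrable lborel S (\<lambda>x. (norm (f x))\<^sup>2)"
    and g: "continuous_on S g" "set_integrable lborel S (\<lambda>x. (norm (g x))\<^sup>2)"
  shows "set_integrable lborel S (\<lambda>x. f x \<bullet> g x)"
  unfolding set_integrable_def
proof (rule Bochner_Integration.integrable_bound)
  show "integrable lborel (\<lambda>x. indicator S x *\<^sub>R (norm (f x))\<^sup>2 + indicator S x *\<^sub>R (norm (g x))\<^sup>2)"
    using f(2) g(2) by (intro Bochner_Integration.integrable_add) (simp_all only: set_integrable_def)
  have "(\<lambda>x. indicator S x *\<^sub>R (f x \<bullet> g x)) \<in> borel_measurable borel"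
    by (rule borel_measurable_continuous_on_indicator) (use S in \<open>auto intro!: continuous_on_inner f g\<close>)
  then show "(\<lambda>x. indicator S x *\<^sub>R (f x \<bullet> g x)) \<in> borel_measurable lborel" by simp
  show "AE x in lborel. norm (indicator S x *\<^sub>R (f x \<bullet> g x))
    \<le> norm (indicator S x *\<^sub>R (norm (f x))\<^sup>2 + indicator S x *\<^sub>R (norm (g x))\<^sup>2)"
  proof (rule AE_I2)
    fix x
    have "\<bar>f x \<bullet> g x\<bar> \<le> norm (f x) * norm (g x)" by (rule Cauchy_Schwarz_ineq2)
    also have "\<dots> \<le> (norm (f x))\<^sup>2 + (norm (g x))\<^sup>2"
    proof -
      have "2 * (norm (f x) * norm (g x)) \<le> (norm (f x))\<^sup>2 + (norm (g x))\<^sup>2"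
        using sum_squares_bound[of "norm (f x)" "norm (g x)"] by simp
      moreover have "0 \<le> norm (f x) * norm (g x)" by simp
      ultimately show ?thesis by linarith
    qed
    finally show "norm (indicator S x *\<^sub>R (f x \<bullet> g x))
      \<le> norm (indicator S x *\<^sub>R (norm (f x))\<^sup>2 + indicator S x *\<^sub>R (norm (g x))\<^sup>2)"
      by (simp add: indicator_def)
  qed
qed

lemma set_integrable_norm_square:
  fixes f :: "'a::euclidean_space \<Rightarrow> 'b::euclidean_space"
  assumes "bounded S" "open S" "continuous_on S f" "bounded (f ` S)"
  shows "set_integrable lborel S (\<lambda>x. (norm (f x))\<^sup>2)"
proof (rule integrable_indicator_bounded)
  obtain B where "\<And>x. x \<in> S \<Longrightarrow> norm (f x) \<le> B" using assms(4) by (auto simp: bounded_iff)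
  then have "(norm (f x))\<^sup>2 \<le> B\<^sup>2" if "x \<in> S" for x using that by (intro power_mono) auto
  then show "bounded ((\<lambda>x. (norm (f x))\<^sup>2) ` S)" unfolding bounded_iff by auto
qed (use assms in \<open>auto intro!: continuous_intros\<close>)

section \<open>Functions regular up to the boundary\<close>

lemma C1_closureD:
  assumes "C1_closure \<Omega> w"
  shows "C1_on \<Omega> w" "continuous_on (closure \<Omega>) w"
  using assms by (auto simp: C1_closure_def C1_on_iff_Ck_on)

lemma C1_closure_bounded:
  assumes "bounded \<Omega>" "C1_closure \<Omega> w"
  shows "bounded (w ` \<Omega>)" "bounded (grad w ` \<Omega>)"
proof -
  show "bounded (w ` \<Omega>)" by (rule bounded_image_closure[OF assms(1) C1_closureD(2)[OF assms(2)]])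
  obtain G where G: "continuous_on (closure \<Omega>) G" "\<forall>x\<in>\<Omega>. G x = grad w x"
    using assms(2) by (auto simp: C1_closure_def)
  have "bounded (G ` \<Omega>)" by (rule bounded_image_closure[OF assms(1) G(1)])
  moreover have "G ` \<Omega> = grad w ` \<Omega>" using G(2) by (intro image_cong) auto
  ultimately show "bounded (grad w ` \<Omega>)" by simp
qed

lemma C1_closure_in_H1:
  assumes "bounded \<Omega>" "open \<Omega>" "C1_closure \<Omega> w"
  shows "in_H1 \<Omega> w"
  using set_integrable_norm_square[OF assms(1,2) C1_on_imp_continuous C1_closure_bounded(1)[OF assms(1,3)]]
    set_integrable_norm_square[OF assms(1,2) C1_on_grad C1_closure_bounded(2)[OF assms(1,3)]]
    C1_closureD(1)[OF assms(3)]
  by (simp add: in_H1_def)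

lemma Ck_on_2_iff:
  "Ck_on 2 S f \<longleftrightarrow> (\<forall>x\<in>S. f differentiable (at x)) \<and> (\<forall>b\<in>Basis. C1_on S (partial b f))"
  by (simp only: numeral_2_eq_2 Ck_on.simps(2)[of "Suc 0"] C1_on_iff_Ck_on One_nat_def)

lemma continuous_laplacian:
  assumes "Ck_on 2 S f"
  shows "continuous_on S (laplacian f)"
  unfolding laplacian_def[abs_def]
proof (rule continuous_on_sum)
  fix b :: 'a assume b: "b \<in> Basis"
  then have "continuous_on S (\<lambda>x. grad (partial b f) x \<bullet> b)"
    using assms by (intro continuous_intros C1_on_grad) (auto simp: Ck_on_2_iff)
  then show "continuous_on S (\<lambda>x. partial b (partial b f) x)"
    by (simp add: grad_inner_Basis[OF b])
qed

text \<open>\<open>Lim\<close> denotes the boundary value of the gradient only if the filter is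
  nontrivial and the limit exists: p is in the closure but not in \<Omega>, and G supplies the
  limit.\<close>

lemma normal_deriv_eq:
  assumes \<Omega>: "open \<Omega>" and G: "continuous_on (closure \<Omega>) G" "\<And>x. x \<in> \<Omega> \<Longrightarrow> G x = grad w x"
    and p: "p \<in> frontier \<Omega>"
  shows "normal_deriv \<Omega> w p = G p \<bullet> outward_normal \<Omega> p"
proof -
  have pc: "p \<in> closure \<Omega>" "p \<notin> \<Omega>" using p \<Omega> by (auto simp: frontier_def interior_open)
  have "(G \<longlongrightarrow> G p) (at p within closure \<Omega>)" using G(1) pc(1) by (auto simp: continuous_on_def)
  then have "(G \<longlongrightarrow> G p) (at p within \<Omega>)" by (rule tendsto_within_subset[OF _ closure_subset])
  moreover have "\<forall>\<^sub>F x in at p within \<Omega>. G x = grad w x"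
    using G(2) by (auto simp: eventually_at_filter)
  ultimately have "(grad w \<longlongrightarrow> G p) (at p within \<Omega>)" by (rule Lim_transform_eventually)
  moreover have "at p within \<Omega> \<noteq> bot"
    using pc by (auto simp: trivial_limit_within closure_def)
  ultimately have "Lim (at p within \<Omega>) (grad w) = G p" by (intro tendsto_Lim)
  then show ?thesis by (simp add: normal_deriv_def)
qed

lemma continuous_normal_deriv:
  assumes dom: "smooth_bounded_domain \<Omega>" and w: "C1_closure \<Omega> w"
  shows "continuous_on (frontier \<Omega>) (normal_deriv \<Omega> w)"
proof -
  obtain G where G: "continuous_on (closure \<Omega>) G" "\<forall>x\<in>\<Omega>. G x = grad w x"
    using w by (auto simp: C1_closure_def)
  have "continuous_on (frontier \<Omega>) (\<lambda>p. G p \<bullet> outward_normal \<Omega> p)"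
    by (intro continuous_on_inner continuous_on_subset[OF G(1)] continuous_outward_normal[OF dom])
      (auto simp: frontier_def)
  moreover have "normal_deriv \<Omega> w p = G p \<bullet> outward_normal \<Omega> p" if "p \<in> frontier \<Omega>" for p
    by (rule normal_deriv_eq[OF smooth_bounded_domainD(1)[OF dom] G(1) _ that]) (use G(2) in blast)
  ultimately show ?thesis by (simp cong: continuous_on_cong)
qed

text \<open>On the bounded set \<Omega> the bounded functions \<open>laplacian w\<close> and
  \<open>grad w\<close> are square integrable, so both products pair two L^2 functions.\<close>

lemma Green_integrable:
  assumes dom: "smooth_bounded_domain \<Omega>"
    and w: "Ck_on 2 \<Omega> w" "C1_closure \<Omega> w" "bounded (laplacian w ` \<Omega>)"
    and \<phi>: "C1_on \<Omega> \<phi>" "in_H1 \<Omega> \<phi>"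
  shows "set_integrable lborel \<Omega> (\<lambda>x. \<phi> x * laplacian w x)"
    "set_integrable lborel \<Omega> (\<lambda>x. grad \<phi> x \<bullet> grad w x)"
proof -
  note \<Omega> = smooth_bounded_domainD[OF dom]
  have H: "set_integrable lborel \<Omega> (\<lambda>x. (norm (\<phi> x))\<^sup>2)" "set_integrable lborel \<Omega> (\<lambda>x. (norm (grad \<phi> x))\<^sup>2)"
    using \<phi>(2) by (simp_all add: in_H1_def)
  show "set_integrable lborel \<Omega> (\<lambda>x. \<phi> x * laplacian w x)"
    using set_integrable_inner_L2[OF \<Omega>(1) C1_on_imp_continuous[OF \<phi>(1)] H(1) continuous_laplacian[OF w(1)]
        set_integrable_norm_square[OF \<Omega>(2,1) continuous_laplacian[OF w(1)] w(3)]]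
    by simp
  have cw: "continuous_on \<Omega> (grad w)" by (rule C1_on_grad[OF C1_closureD(1)[OF w(2)]])
  show "set_integrable lborel \<Omega> (\<lambda>x. grad \<phi> x \<bullet> grad w x)"
    by (rule set_integrable_inner_L2[OF \<Omega>(1) C1_on_grad[OF \<phi>(1)] H(2) cw
        set_integrable_norm_square[OF \<Omega>(2,1) cw C1_closure_bounded(2)[OF \<Omega>(2) w(2)]]])
qed

text \<open>The divergence theorem is applied to \<phi> times the continuous extension G of the
  gradient of w. Its divergence contains the second derivatives of w only through the Laplacian and
  is therefore integrable.\<close>

lemma Green_C1_closure:
  assumes dom: "smooth_bounded_domain \<Omega>" and \<sigma>: "surface_measure \<Omega> \<sigma>"
    and w: "Ck_on 2 \<Omega> w" "C1_closure \<Omega> w" "bounded (laplacian w ` \<Omega>)"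
    and \<phi>: "C1_closure \<Omega> \<phi>"
  shows "(LINT x:\<Omega>|lborel. \<phi> x * laplacian w x + grad \<phi> x \<bullet> grad w x) = (LINT x|\<sigma>. \<phi> x * normal_deriv \<Omega> w x)"
proof -
  note \<Omega> = smooth_bounded_domainD[OF dom]
  obtain G where G: "continuous_on (closure \<Omega>) G" "\<And>x. x \<in> \<Omega> \<Longrightarrow> G x = grad w x"
    using w(2) by (auto simp: C1_closure_def)
  have Gp: "G x \<bullet> b = partial b w x" if "x \<in> \<Omega>" "b \<in> Basis" for x b
    using G(2) that by (simp add: grad_inner_Basis)
  have GC1: "C1_field \<Omega> G"
    unfolding C1_field_def
  proof
    fix b :: 'a assume b: "b \<in> Basis"
    show "C1_on \<Omega> (\<lambda>x. G x \<bullet> b)"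
      by (rule C1_on_cong_open[OF \<Omega>(1) Gp[OF _ b]]) (use w(1) b in \<open>auto simp: Ck_on_2_iff\<close>)
  qed
  have dG: "divg G x = laplacian w x" if "x \<in> \<Omega>" for x
    unfolding divg_def laplacian_def
    by (intro sum.cong refl partial_cong_open[OF \<Omega>(1) that] Gp)
  let ?F = "\<lambda>x. \<phi> x *\<^sub>R G x"
  have dF: "indicator \<Omega> x *\<^sub>R divg ?F x = indicator \<Omega> x *\<^sub>R (\<phi> x * laplacian w x + grad \<phi> x \<bullet> grad w x)" for x
    using divg_scaleR[OF C1_closureD(1)[OF \<phi>] GC1, of x] dG[of x] G(2)[of x]
    by (cases "x \<in> \<Omega>") simp_all
  have "set_integrable lborel \<Omega> (\<lambda>x. \<phi> x * laplacian w x + grad \<phi> x \<bullet> grad w x)"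
    by (intro set_integral_add(1) Green_integrable[OF dom w] C1_closureD(1)[OF \<phi>]
        C1_closure_in_H1[OF \<Omega>(2,1) \<phi>])
  then have di: "set_integrable lborel \<Omega> (divg ?F)" by (simp only: set_integrable_def dF)
  have "(LINT x:\<Omega>|lborel. \<phi> x * laplacian w x + grad \<phi> x \<bullet> grad w x) = (LINT x:\<Omega>|lborel. divg ?F x)"
    by (simp only: set_lebesgue_integral_def dF)
  also have "\<dots> = (LINT x|\<sigma>. ?F x \<bullet> outward_normal \<Omega> x)"
    by (rule divergence_theorem[OF dom \<sigma> _ C1_field_scaleR[OF C1_closureD(1)[OF \<phi>] GC1] di])
      (intro continuous_on_scaleR C1_closureD(2)[OF \<phi>] G(1))
  also have "\<dots> = (LINT x|\<sigma>. \<phi> x * normal_deriv \<Omega> w x)"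
    by (rule Bochner_Integration.integral_cong[OF refl])
      (simp add: surface_measureD(2)[OF \<sigma>] normal_deriv_eq[OF \<Omega>(1) G])
  finally show ?thesis .
qed

section \<open>Extension to test functions known through their trace\<close>

text \<open>One approximant at finite distance suffices: it is continuous on the compact frontier,
  hence integrable, and its difference s from g is square integrable, hence integrable by |s| \<le>
  1 + s^2.\<close>

lemma has_trace_integrable:
  assumes dom: "smooth_bounded_domain \<Omega>" and \<sigma>: "surface_measure \<Omega> \<sigma>" and tr: "has_trace \<Omega> \<sigma> v g"
  shows "integrable \<sigma> g"
proof -
  interpret finite_measure \<sigma> by (rule finite_surface_measure[OF dom \<sigma>])
  obtain \<phi> where g [measurable]: "g \<in> borel_measurable \<sigma>" and \<phi>: "\<And>j. C1_closure \<Omega> (\<phi> j)"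
    and lim: "(\<lambda>j. \<integral>\<^sup>+ x. ennreal ((\<phi> j x - g x)\<^sup>2) \<partial>\<sigma>) \<longlonglongrightarrow> 0"
    using tr by (auto simp: has_trace_def)
  obtain j :: nat where j: "(\<integral>\<^sup>+ x. ennreal ((\<phi> j x - g x)\<^sup>2) \<partial>\<sigma>) < 1"
    using order_tendstoD(2)[OF lim, of 1] by (auto simp: eventually_sequentially)
  have i\<phi>: "integrable \<sigma> (\<phi> j)"
    by (rule integrable_surface_continuous[OF dom \<sigma> continuous_on_subset[OF C1_closureD(2)[OF \<phi>]]])
      (auto simp: frontier_def)
  note [measurable] = borel_measurable_integrable[OF i\<phi>]
  have i2: "integrable \<sigma> (\<lambda>x. (\<phi> j x - g x)\<^sup>2)"
    by (rule integrableI_nonneg) (use j in \<open>auto intro: order.strict_trans\<close>)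
  have "integrable \<sigma> (\<lambda>x. \<phi> j x - g x)"
  proof (rule Bochner_Integration.integrable_bound)
    show "integrable \<sigma> (\<lambda>x. 1 + (\<phi> j x - g x)\<^sup>2)" using i2 by simp
    show "AE x in \<sigma>. norm (\<phi> j x - g x) \<le> norm (1 + (\<phi> j x - g x)\<^sup>2)"
    proof (rule AE_I2)
      fix x
      have "0 \<le> (\<bar>\<phi> j x - g x\<bar> - 1 / 2)\<^sup>2" by simp
      also have "\<dots> = (\<phi> j x - g x)\<^sup>2 - \<bar>\<phi> j x - g x\<bar> + 1 / 4"
        unfolding power2_diff[of "\<bar>\<phi> j x - g x\<bar>"] power2_abs by (simp add: power2_eq_square)
      finally have "\<bar>\<phi> j x - g x\<bar> \<le> 1 + (\<phi> j x - g x)\<^sup>2" by simp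
      then show "norm (\<phi> j x - g x) \<le> norm (1 + (\<phi> j x - g x)\<^sup>2)" by simp
    qed
  qed measurable
  from Bochner_Integration.integrable_diff[OF i\<phi> this] show ?thesis by simp
qed

lemma integrable_mult_continuous_surface:
  fixes f g :: "'a::euclidean_space \<Rightarrow> real"
  assumes dom: "smooth_bounded_domain \<Omega>" and \<sigma>: "surface_measure \<Omega> \<sigma>"
    and f: "integrable \<sigma> f" and g: "continuous_on (frontier \<Omega>) g"
  obtains B where "\<And>x. x \<in> frontier \<Omega> \<Longrightarrow> \<bar>g x\<bar> \<le> B" "B \<ge> 0" "integrable \<sigma> (\<lambda>x. f x * g x)"
proof -
  have "bounded (g ` frontier \<Omega>)"
    by (intro compact_imp_bounded compact_continuous_image g smooth_bounded_domainD(5)[OF dom])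
  then obtain B' where B': "\<And>x. x \<in> frontier \<Omega> \<Longrightarrow> \<bar>g x\<bar> \<le> B'" by (auto simp: bounded_iff)
  define B where "B = max B' 0"
  have B: "\<bar>g x\<bar> \<le> B" if "x \<in> frontier \<Omega>" for x using B'[OF that] by (simp add: B_def)
  have "integrable \<sigma> (\<lambda>x. f x * g x)"
  proof (rule Bochner_Integration.integrable_bound)
    show "integrable \<sigma> (\<lambda>x. B * f x)" using f by (rule integrable_mult_right)
    show "(\<lambda>x. f x * g x) \<in> borel_measurable \<sigma>"
      using borel_measurable_integrable[OF f] surface_measureD(5)[OF \<sigma> g] by measurable
    show "AE x in \<sigma>. norm (f x * g x) \<le> norm (B * f x)"
    proof (rule AE_I2)
      fix x assume "x \<in> space \<sigma>"
      then have "\<bar>g x\<bar> \<le> \<bar>B\<bar>" using B by (simp add: surface_measureD(2)[OF \<sigma>] B_def)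
      then have "\<bar>g x\<bar> * \<bar>f x\<bar> \<le> \<bar>B\<bar> * \<bar>f x\<bar>" by (rule mult_right_mono) simp
      then show "norm (f x * g x) \<le> norm (B * f x)" by (simp add: abs_mult mult.commute)
    qed
  qed
  then show thesis using that[of B] B by (simp add: B_def)
qed

text \<open>Both sides are continuous in the test function: the left one in H^1, since the Laplacian
  and the gradient of w are bounded, the right one in L^2 of the boundary, since the normal
  derivative is bounded. The identity thus passes along the sequence that defines the trace.\<close>

lemma Green_has_trace:
  assumes dom: "smooth_bounded_domain \<Omega>" and \<sigma>: "surface_measure \<Omega> \<sigma>"
    and w: "Ck_on 2 \<Omega> w" "C1_closure \<Omega> w" "bounded (laplacian w ` \<Omega>)"
    and v: "C1_on \<Omega> v" "in_H1 \<Omega> v" "has_trace \<Omega> \<sigma> v g"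
  shows "(LINT x:\<Omega>|lborel. v x * laplacian w x + grad v x \<bullet> grad w x) = (LINT x|\<sigma>. g x * normal_deriv \<Omega> w x)"
proof -
  note \<Omega> = smooth_bounded_domainD[OF dom]
  have fc: "frontier \<Omega> \<subseteq> closure \<Omega>" by (auto simp: frontier_def)
  obtain \<phi> where g [measurable]: "g \<in> borel_measurable \<sigma>" and \<phi>: "\<And>j. C1_closure \<Omega> (\<phi> j)"
    and lim1: "(\<lambda>j. \<integral>\<^sup>+ x\<in>\<Omega>. ennreal ((\<phi> j x - v x)\<^sup>2 + (norm (grad (\<phi> j) x - grad v x))\<^sup>2) \<partial>lborel) \<longlonglongrightarrow> 0"
    and lim2: "(\<lambda>j. \<integral>\<^sup>+ x. ennreal ((\<phi> j x - g x)\<^sup>2) \<partial>\<sigma>) \<longlonglongrightarrow> 0"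
    using v(3) by (auto simp: has_trace_def)
  let ?a = "\<lambda>\<psi> x. \<psi> x * laplacian w x + grad \<psi> x \<bullet> grad w x"
  have i\<phi>: "integrable \<sigma> (\<phi> j)" for j
    by (rule integrable_surface_continuous[OF dom \<sigma> continuous_on_subset[OF C1_closureD(2)[OF \<phi>] fc]])
  have ig: "integrable \<sigma> g" by (rule has_trace_integrable[OF dom \<sigma> v(3)])
  have cn: "continuous_on (frontier \<Omega>) (normal_deriv \<Omega> w)" by (rule continuous_normal_deriv[OF dom w(2)])
  have "(\<lambda>j. LINT x|\<sigma>. \<phi> j x * normal_deriv \<Omega> w x) \<longlonglongrightarrow> (LINT x|\<sigma>. g x * normal_deriv \<Omega> w x)"
  proof -
    obtain B where B: "\<And>x. x \<in> frontier \<Omega> \<Longrightarrow> \<bar>normal_deriv \<Omega> w x\<bar> \<le> B"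
      and ign: "integrable \<sigma> (\<lambda>x. g x * normal_deriv \<Omega> w x)"
      using integrable_mult_continuous_surface[OF dom \<sigma> ig cn] by metis
    show ?thesis
    proof (rule integral_tendsto_of_square[OF finite_surface_measure[OF dom \<sigma>] _ ign _ _ _ lim2, of _ "B\<^sup>2"])
      show "integrable \<sigma> (\<lambda>x. \<phi> j x * normal_deriv \<Omega> w x)" for j
        using integrable_mult_continuous_surface[OF dom \<sigma> i\<phi> cn] by metis
      show "(\<lambda>x. (\<phi> j x - g x)\<^sup>2) \<in> borel_measurable \<sigma>" for j
        using borel_measurable_integrable[OF i\<phi>[of j]] g by measurable
      show "(\<phi> j x * normal_deriv \<Omega> w x - g x * normal_deriv \<Omega> w x)\<^sup>2 \<le> B\<^sup>2 * (\<phi> j x - g x)\<^sup>2"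
        if "x \<in> space \<sigma>" for j x
      proof -
        have "x \<in> frontier \<Omega>" using that by (simp add: surface_measureD(2)[OF \<sigma>])
        then have "(normal_deriv \<Omega> w x)\<^sup>2 \<le> B\<^sup>2" using B by (metis abs_ge_zero power2_abs power_mono)
        then have "(normal_deriv \<Omega> w x)\<^sup>2 * (\<phi> j x - g x)\<^sup>2 \<le> B\<^sup>2 * (\<phi> j x - g x)\<^sup>2"
          by (rule mult_right_mono) simp
        then show ?thesis by (simp add: power_mult_distrib[symmetric] algebra_simps)
      qed
    qed simp
  qed
  moreover have "(\<lambda>j. LINT x:\<Omega>|lborel. ?a (\<phi> j) x) \<longlonglongrightarrow> (LINT x:\<Omega>|lborel. ?a v x)"
  proof -
    \<comment> \<open>The limit lemma speaks of a finite measure space, so integrals over \<Omega>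
      are rewritten for the restricted measure.\<close>
    define M where "M = restrict_space lborel \<Omega>"
    have \<Omega>M: "\<Omega> \<inter> space lborel \<in> sets lborel" using \<Omega>(1) by simp
    have spM: "space M = \<Omega>" by (simp add: M_def space_restrict_space)
    have fM: "finite_measure M"
    proof
      have "emeasure M \<Omega> = emeasure lborel \<Omega>"
        unfolding M_def using \<Omega>(1) by (intro emeasure_restrict_space) auto
      then show "emeasure M (space M) \<noteq> \<infinity>"
        using emeasure_bounded_finite[OF \<Omega>(2)] spM by simp
    qed
    have LM: "(LINT x:\<Omega>|lborel. f x) = (LINT x|M. f x)" for f :: "'a \<Rightarrow> real"
      unfolding M_def set_lebesgue_integral_def by (rule integral_restrict_space[OF \<Omega>M, symmetric])
    have IM: "set_integrable lborel \<Omega> f \<longleftrightarrow> integrable M f" for f :: "'a \<Rightarrow> real"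
      unfolding M_def set_integrable_def by (rule integrable_restrict_space[OF \<Omega>M, symmetric])
    have mM: "continuous_on \<Omega> f \<Longrightarrow> f \<in> borel_measurable M" for f :: "'a \<Rightarrow> real"
      unfolding M_def using borel_measurable_continuous_on_restrict[of \<Omega> f]
      by (simp add: measurable_def sets_restrict_space space_restrict_space)
    obtain B1 where B1: "\<And>x. x \<in> \<Omega> \<Longrightarrow> \<bar>laplacian w x\<bar> \<le> B1" using w(3) by (auto simp: bounded_iff)
    obtain B2 where B2: "\<And>x. x \<in> \<Omega> \<Longrightarrow> norm (grad w x) \<le> B2"
      using C1_closure_bounded(2)[OF \<Omega>(2) w(2)] by (auto simp: bounded_iff)
    let ?q = "\<lambda>j x. (\<phi> j x - v x)\<^sup>2 + (norm (grad (\<phi> j) x - grad v x))\<^sup>2"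
    show ?thesis
      unfolding LM
    \<comment> \<open>The constant comes from
      \<open>(s + t)\<^sup>2 \<le> 2 * (s\<^sup>2 + t\<^sup>2)\<close>, where s and t are the
      differences in the Laplacian term and in the gradient term, with the larger factor
      \<open>B1\<^sup>2 + B2\<^sup>2\<close> used for both.\<close>
    proof (rule integral_tendsto_of_square[where q="?q" and C="2 * (B1\<^sup>2 + B2\<^sup>2)", OF fM])
      show "integrable M (?a (\<phi> j))" for j
        unfolding IM[symmetric]
        by (intro set_integral_add(1) Green_integrable[OF dom w] C1_closureD(1)[OF \<phi>] C1_closure_in_H1[OF \<Omega>(2,1) \<phi>])
      show "integrable M (?a v)"
        unfolding IM[symmetric] by (intro set_integral_add(1) Green_integrable[OF dom w] v)
      show "?q j \<in> borel_measurable M" for j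
        by (intro mM continuous_intros C1_on_imp_continuous C1_on_grad v C1_closureD(1)[OF \<phi>])
      show "(\<lambda>j. \<integral>\<^sup>+ x. ennreal (?q j x) \<partial>M) \<longlonglongrightarrow> 0"
        using lim1 unfolding M_def by (simp add: nn_integral_restrict_space[OF \<Omega>M])
      show "(?a (\<phi> j) x - ?a v x)\<^sup>2 \<le> 2 * (B1\<^sup>2 + B2\<^sup>2) * ?q j x" if "x \<in> space M" for j x
      proof -
        have x: "x \<in> \<Omega>" using that spM by simp
        define s where "s = (\<phi> j x - v x) * laplacian w x"
        define t where "t = (grad (\<phi> j) x - grad v x) \<bullet> grad w x"
        have l1: "(laplacian w x)\<^sup>2 \<le> B1\<^sup>2" using B1[OF x] by (metis abs_ge_zero power2_abs power_mono)
        have l2: "(norm (grad w x))\<^sup>2 \<le> B2\<^sup>2" using B2[OF x] by (intro power_mono) auto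
        have s: "s\<^sup>2 \<le> (\<phi> j x - v x)\<^sup>2 * B1\<^sup>2"
          unfolding s_def power_mult_distrib by (intro mult_left_mono l1) simp
        have "\<bar>t\<bar>\<^sup>2 \<le> (norm (grad (\<phi> j) x - grad v x) * norm (grad w x))\<^sup>2"
          unfolding t_def by (intro power_mono Cauchy_Schwarz_ineq2) simp
        also have "\<dots> \<le> (norm (grad (\<phi> j) x - grad v x))\<^sup>2 * B2\<^sup>2"
          unfolding power_mult_distrib by (intro mult_left_mono l2) simp
        finally have t: "t\<^sup>2 \<le> (norm (grad (\<phi> j) x - grad v x))\<^sup>2 * B2\<^sup>2" by simp
        have "?a (\<phi> j) x - ?a v x = s + t" by (simp add: s_def t_def inner_diff_left algebra_simps)
        then have "(?a (\<phi> j) x - ?a v x)\<^sup>2 = (s + t)\<^sup>2" by (rule arg_cong)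
        also have "\<dots> \<le> 2 * (s\<^sup>2 + t\<^sup>2)"
          using sum_squares_bound[of s t] by (simp add: power2_sum)
        also have "s\<^sup>2 + t\<^sup>2 \<le> (B1\<^sup>2 + B2\<^sup>2) * ?q j x"
        proof -
          have "0 \<le> (\<phi> j x - v x)\<^sup>2 * B2\<^sup>2" "0 \<le> (norm (grad (\<phi> j) x - grad v x))\<^sup>2 * B1\<^sup>2" by simp_all
          with s t show ?thesis
            unfolding distrib_left distrib_right mult.commute[of "B1\<^sup>2"] mult.commute[of "B2\<^sup>2"] by linarith
        qed
        finally show ?thesis by (simp only: mult.assoc)
      qed
    qed simp
  qed
  ultimately show ?thesis
    using LIMSEQ_unique Green_C1_closure[OF dom \<sigma> w \<phi>] by auto
qed

lemma C1_closure_has_trace: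
  assumes "surface_measure \<Omega> \<sigma>" "C1_closure \<Omega> w"
  shows "has_trace \<Omega> \<sigma> w w"
  unfolding has_trace_def
proof (intro conjI exI[of _ "\<lambda>_. w"])
  show "w \<in> borel_measurable \<sigma>"
    by (rule surface_measureD(5)[OF assms(1) continuous_on_subset[OF C1_closureD(2)[OF assms(2)]]])
      (auto simp: frontier_def)
qed (use assms(2) in simp_all)

section \<open>Energy estimates for the iteration\<close>

definition energy :: "'a::euclidean_space set \<Rightarrow> 'a measure \<Rightarrow> real \<Rightarrow> ('a \<Rightarrow> real) \<Rightarrow> real" where
  "energy \<Omega> \<sigma> m v = (LINT x:\<Omega>|lborel. (norm (grad v x))\<^sup>2) + 1 / m * (LINT x|\<sigma>. \<bar>v x\<bar>)\<^sup>2"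

lemma L2_norm_square: "(L2_norm \<Omega> v)\<^sup>2 = (LINT x:\<Omega>|lborel. (v x)\<^sup>2)"
proof -
  have "0 \<le> (LINT x:\<Omega>|lborel. (v x)\<^sup>2)"
    unfolding set_lebesgue_integral_def by (rule Bochner_Integration.integral_nonneg) simp
  then show ?thesis by (simp add: L2_norm_def)
qed

lemma L2_norm_nonneg: "0 \<le> L2_norm \<Omega> v"
proof -
  have "0 \<le> (LINT x:\<Omega>|lborel. (v x)\<^sup>2)"
    unfolding set_lebesgue_integral_def by (rule Bochner_Integration.integral_nonneg) simp
  then show ?thesis by (simp add: L2_norm_def)
qed

lemma R_functional_eq: "R_functional \<Omega> \<sigma> m v = energy \<Omega> \<sigma> m v / (L2_norm \<Omega> v)\<^sup>2"
  by (simp add: R_functional_def energy_def L2_norm_square)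

lemma L2_Cauchy_Schwarz:
  assumes \<Omega>: "open \<Omega>" and v: "C1_on \<Omega> v" "in_H1 \<Omega> v" and w: "C1_on \<Omega> w" "in_H1 \<Omega> w"
    and pos: "L2_norm \<Omega> v > 0"
  shows "(LINT x:\<Omega>|lborel. v x * w x) \<le> L2_norm \<Omega> v * L2_norm \<Omega> w"
proof -
  define V where "V = (LINT x:\<Omega>|lborel. (v x)\<^sup>2)"
  define W where "W = (LINT x:\<Omega>|lborel. (w x)\<^sup>2)"
  define I where "I = (LINT x:\<Omega>|lborel. v x * w x)"
  have iv: "set_integrable lborel \<Omega> (\<lambda>x. (v x)\<^sup>2)" and iw: "set_integrable lborel \<Omega> (\<lambda>x. (w x)\<^sup>2)"
    using v(2) w(2) by (simp_all add: in_H1_def)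
  have ivw: "set_integrable lborel \<Omega> (\<lambda>x. v x * w x)"
    using set_integrable_inner_L2[OF \<Omega> C1_on_imp_continuous[OF v(1)] _ C1_on_imp_continuous[OF w(1)]] iv iw
    by simp
  have V: "V > 0" using pos L2_norm_square[of \<Omega> v] unfolding V_def by (metis zero_less_power)
  \<comment> \<open>This s minimises \<open>s\<^sup>2 * V - 2 * s * I + W\<close>; nonnegativity of
    the minimum is \<open>I\<^sup>2 \<le> V * W\<close>.\<close>
  define s where "s = I / V"
  have "0 \<le> (LINT x:\<Omega>|lborel. (s * v x - w x)\<^sup>2)"
    unfolding set_lebesgue_integral_def by (rule Bochner_Integration.integral_nonneg) simp
  also have "\<dots> = (LINT x:\<Omega>|lborel. s\<^sup>2 * (v x)\<^sup>2 + (w x)\<^sup>2 - 2 * s * (v x * w x))"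
    by (simp add: power2_diff power_mult_distrib algebra_simps)
  also have "\<dots> = s\<^sup>2 * V + W - 2 * s * I"
    unfolding V_def W_def I_def using iv iw ivw by (simp add: set_integral_add set_integral_diff)
  finally have "0 \<le> s\<^sup>2 * V + W - 2 * s * I" .
  then have "I\<^sup>2 \<le> V * W" using V by (simp add: s_def power2_eq_square field_simps)
  also have "\<dots> = (L2_norm \<Omega> v * L2_norm \<Omega> w)\<^sup>2"
    by (simp add: V_def W_def power_mult_distrib L2_norm_square)
  finally have "\<bar>I\<bar> \<le> L2_norm \<Omega> v * L2_norm \<Omega> w"
    by (rule abs_le_square_iff[THEN iffD2, THEN order_trans])
      (simp add: L2_norm_nonneg)
  then show ?thesis by (simp add: I_def)
qed

lemma emeasure_lborel_open_nonzero:
  fixes S :: "'a::euclidean_space set"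
  assumes "open S" "S \<noteq> {}"
  shows "emeasure lborel S \<noteq> 0"
proof
  assume "emeasure lborel S = 0"
  then have "S \<in> null_sets lborel" using assms(1) by (intro null_setsI) auto
  then have "S \<in> null_sets lebesgue" by (rule null_sets_completionI)
  then show False using open_not_negligible[OF assms] negligible_iff_null_sets by blast
qed

text \<open>Otherwise the divergence theorem for the identity field would give $n|\Omega| = 0$.\<close>

lemma surface_measure_not_null:
  assumes dom: "smooth_bounded_domain \<Omega>" and \<sigma>: "surface_measure \<Omega> \<sigma>"
  shows "\<not> (AE x in \<sigma>. False)"
proof
  assume null: "AE x in \<sigma>. False"
  note \<Omega> = smooth_bounded_domainD[OF dom]
  have d: "divg (\<lambda>x::'a. x) x = DIM('a)" for x
  proof -
    have "partial b (\<lambda>y. y \<bullet> b) x = b \<bullet> b" for b :: 'a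
      by (rule partial_eqI) (auto intro!: derivative_eq_intros)
    then show ?thesis by (simp add: divg_def inner_Basis)
  qed
  have "set_integrable lborel \<Omega> (divg (\<lambda>x. x))"
    by (rule integrable_indicator_bounded[OF \<Omega>(2)]) (use \<Omega>(1) in \<open>auto simp: d[abs_def] bounded_iff\<close>)
  then have "(LINT x:\<Omega>|lborel. divg (\<lambda>x. x) x) = (LINT x|\<sigma>. x \<bullet> outward_normal \<Omega> x)"
    by (intro divergence_theorem[OF dom \<sigma>] continuous_intros) (simp_all add: C1_field_def C1_on_inner)
  also have "\<dots> = (LINT x|\<sigma>. 0)"
  proof (rule integral_cong_AE)
    show "(\<lambda>x. x \<bullet> outward_normal \<Omega> x) \<in> borel_measurable \<sigma>"
      by (intro surface_measureD(5)[OF \<sigma>] continuous_intros continuous_outward_normal[OF dom])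
    show "AE x in \<sigma>. x \<bullet> outward_normal \<Omega> x = 0" using null by eventually_elim simp
  qed simp
  finally have "measure lborel \<Omega> = 0"
    using \<Omega>(1) emeasure_bounded_finite[OF \<Omega>(2)] by (simp add: d set_lebesgue_integral_def)
  then have "emeasure lborel \<Omega> = 0"
    using emeasure_bounded_finite[OF \<Omega>(2)] by (auto simp: measure_def enn2real_eq_0_iff)
  then show False using emeasure_lborel_open_nonzero[OF \<Omega>(1,3)] by blast
qed

lemma L2_norm_pos:
  assumes dom: "smooth_bounded_domain \<Omega>" and v: "in_H1 \<Omega> v" "\<And>x. x \<in> \<Omega> \<Longrightarrow> v x > 0"
  shows "L2_norm \<Omega> v > 0"
proof -
  note \<Omega> = smooth_bounded_domainD[OF dom]
  have i: "integrable lborel (\<lambda>x. indicator \<Omega> x *\<^sub>R (v x)\<^sup>2)"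
    using v(1) by (simp add: in_H1_def set_integrable_def)
  have "L2_norm \<Omega> v \<noteq> 0"
  proof
    assume "L2_norm \<Omega> v = 0"
    then have "(LINT x|lborel. indicator \<Omega> x *\<^sub>R (v x)\<^sup>2) = 0"
      using L2_norm_square[of \<Omega> v] by (simp add: set_lebesgue_integral_def)
    then have "AE x in lborel. indicator \<Omega> x *\<^sub>R (v x)\<^sup>2 = 0"
      using integral_nonneg_eq_0_iff_AE[OF i] by simp
    then have "AE x in lborel. x \<notin> \<Omega>"
      by eventually_elim (use v(2) in \<open>force simp: indicator_def split: if_splits\<close>)
    then have "emeasure lborel \<Omega> = 0"
      using \<Omega>(1) AE_iff_measurable[of \<Omega> lborel "\<lambda>x. x \<notin> \<Omega>"] by simp
    then show False using emeasure_lborel_open_nonzero[OF \<Omega>(1,3)] by blast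
  qed
  then show ?thesis using L2_norm_nonneg[of \<Omega> v] by simp
qed

text \<open>The Dirichlet integral may vanish, as it does for constants, so positivity comes from
  the boundary term; this is where \<sigma> must not be the zero measure.\<close>

lemma energy_pos:
  assumes dom: "smooth_bounded_domain \<Omega>" and \<sigma>: "surface_measure \<Omega> \<sigma>" and m: "m > 0"
    and v: "integrable \<sigma> v" "\<And>x. x \<in> frontier \<Omega> \<Longrightarrow> v x > 0"
  shows "energy \<Omega> \<sigma> m v > 0"
proof -
  have "(LINT x|\<sigma>. \<bar>v x\<bar>) \<noteq> 0"
  proof
    assume "(LINT x|\<sigma>. \<bar>v x\<bar>) = 0"
    then have "AE x in \<sigma>. \<bar>v x\<bar> = 0"
      using integral_nonneg_eq_0_iff_AE[OF integrable_abs[OF v(1)]] by simp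
    with AE_space have "AE x in \<sigma>. False"
      by eventually_elim (use v(2) in \<open>force simp: surface_measureD(2)[OF \<sigma>]\<close>)
    then show False using surface_measure_not_null[OF dom \<sigma>] by blast
  qed
  moreover have "0 \<le> (LINT x:\<Omega>|lborel. (norm (grad v x))\<^sup>2)"
    unfolding set_lebesgue_integral_def by (rule Bochner_Integration.integral_nonneg) simp
  ultimately show ?thesis unfolding energy_def using m by (intro add_nonneg_pos) auto
qed

section \<open>One step of the iteration\<close>

text \<open>A pointwise substitute for Cauchy-Schwarz that leaves no quotient w^2 / |v| to
  integrate. The first bound is
  \<open>(\<bar>w\<bar> * Bv - Bw * \<bar>v\<bar>)\<^sup>2 \<ge> 0\<close> divided by
  \<open>m * \<bar>v\<bar> * Bv\<close>; here Bw is a free parameter, later the integral of |w|. The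
  second comes from \<open>\<bar>v * n\<bar> = Bv / m * \<bar>w\<bar>\<close>. Where v = 0 the
  boundary condition forces w = 0.\<close>

lemma robin_boundary_estimates:
  fixes v w n m Bv Bw :: real
  assumes m: "m > 0" and Bv: "Bv > 0" and bc: "w + m * \<bar>v\<bar> / Bv * n = 0"
  shows "w * n \<le> (Bw\<^sup>2 / Bv * \<bar>v\<bar> - 2 * Bw * \<bar>w\<bar>) / m" "- (Bv / m * \<bar>w\<bar>) \<le> v * n"
proof -
  show "w * n \<le> (Bw\<^sup>2 / Bv * \<bar>v\<bar> - 2 * Bw * \<bar>w\<bar>) / m"
  proof (cases "v = 0")
    case True
    then show ?thesis using bc by simp
  next
    case False
    define a b where "a = \<bar>v\<bar>" and "b = \<bar>w\<bar>"
    have a: "a > 0" using False by (simp add: a_def)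
    have "n = - (w * Bv / (m * a))" using bc m Bv a unfolding a_def[symmetric] by (simp add: field_simps)
    then have wn: "w * n = - (b * b * Bv / (m * a))" by (simp add: b_def)
    have "0 \<le> (b * Bv - Bw * a)\<^sup>2 / (m * a * Bv)" using m Bv a by simp
    also have "\<dots> = (Bw\<^sup>2 / Bv * a - 2 * Bw * b) / m - w * n"
      unfolding wn using m Bv a by (simp add: power2_eq_square field_simps)
    finally have "0 \<le> (Bw\<^sup>2 / Bv * \<bar>v\<bar> - 2 * Bw * \<bar>w\<bar>) / m - w * n" unfolding a_def b_def .
    then show ?thesis by simp
  qed
  show "- (Bv / m * \<bar>w\<bar>) \<le> v * n"
  proof (cases "v = 0")
    case True
    then show ?thesis using bc m Bv by simp
  next
    case False
    have n: "n = - (w * Bv / (m * \<bar>v\<bar>))" using bc m Bv False by (simp add: field_simps)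
    have "\<bar>v * n\<bar> = Bv / m * \<bar>w\<bar>" unfolding n using m Bv False by (simp add: abs_mult)
    then show ?thesis by linarith
  qed
qed

text \<open>R is kept abstract: the first bound holds for every R in the equation, and its value as
  a Rayleigh quotient enters the second only through a premise that is free of division.\<close>

lemma energy_iteration_step:
  assumes dom: "smooth_bounded_domain \<Omega>" and \<sigma>: "surface_measure \<Omega> \<sigma>" and m: "m > 0"
    and v: "C1_on \<Omega> v" "bounded (v ` \<Omega>)" "in_H1 \<Omega> v" "has_trace \<Omega> \<sigma> v v"
    and w: "Ck_on 2 \<Omega> w" "C1_closure \<Omega> w"
    and eq: "\<And>x. x \<in> \<Omega> \<Longrightarrow> - laplacian w x = R * v x"
    and bc: "\<And>x. x \<in> frontier \<Omega> \<Longrightarrow> w x + m * \<bar>v x\<bar> / (LINT y|\<sigma>. \<bar>v y\<bar>) * normal_deriv \<Omega> w x = 0"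
  shows "energy \<Omega> \<sigma> m w \<le> R * (LINT x:\<Omega>|lborel. v x * w x)"
    "R * (LINT x:\<Omega>|lborel. (v x)\<^sup>2) = energy \<Omega> \<sigma> m v \<Longrightarrow> energy \<Omega> \<sigma> m v \<le> energy \<Omega> \<sigma> m w"
proof -
  note \<Omega> = smooth_bounded_domainD[OF dom]
  define n where "n = normal_deriv \<Omega> w"
  define Bv where "Bv = (LINT y|\<sigma>. \<bar>v y\<bar>)"
  define Bw where "Bw = (LINT y|\<sigma>. \<bar>w y\<bar>)"
  have B0: "Bv \<ge> 0" "Bw \<ge> 0" by (simp_all add: Bv_def Bw_def)
  have w1: "C1_on \<Omega> w" "in_H1 \<Omega> w" "has_trace \<Omega> \<sigma> w w"
    using C1_closureD[OF w(2)] C1_closure_in_H1[OF \<Omega>(2,1) w(2)] C1_closure_has_trace[OF \<sigma> w(2)] by auto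
  have lap: "laplacian w x = - R * v x" if "x \<in> \<Omega>" for x using eq[OF that] by simp
  have "bounded (laplacian w ` \<Omega>)"
  proof -
    obtain B where B: "\<And>x. x \<in> \<Omega> \<Longrightarrow> \<bar>v x\<bar> \<le> B" using v(2) by (auto simp: bounded_iff)
    have "norm (laplacian w x) \<le> \<bar>R\<bar> * B" if "x \<in> \<Omega>" for x
      using mult_left_mono[OF B[OF that], of "\<bar>R\<bar>"] by (simp add: lap[OF that] abs_mult)
    then show ?thesis unfolding bounded_iff by blast
  qed
  note w' = w this
  have green: "(LINT x:\<Omega>|lborel. grad \<psi> x \<bullet> grad w x) = R * (LINT x:\<Omega>|lborel. v x * \<psi> x) + (LINT x|\<sigma>. \<psi> x * n x)"
    if \<psi>: "C1_on \<Omega> \<psi>" "in_H1 \<Omega> \<psi>" "has_trace \<Omega> \<sigma> \<psi> \<psi>" for \<psi>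
  proof -
    have "(LINT x:\<Omega>|lborel. \<psi> x * laplacian w x) = (LINT x:\<Omega>|lborel. - R * (v x * \<psi> x))"
      unfolding set_lebesgue_integral_def
      by (rule Bochner_Integration.integral_cong[OF refl]) (auto simp: lap indicator_def)
    also have "\<dots> = - R * (LINT x:\<Omega>|lborel. v x * \<psi> x)" by (rule set_integral_mult_right)
    finally show ?thesis
      using Green_has_trace[OF dom \<sigma> w' \<psi>] set_integral_add(2)[OF Green_integrable[OF dom w' \<psi>(1,2)]]
      by (simp add: n_def)
  qed
  have iv: "integrable \<sigma> v" and iw: "integrable \<sigma> w"
    by (rule has_trace_integrable[OF dom \<sigma>]; fact)+
  have cn: "continuous_on (frontier \<Omega>) n" unfolding n_def by (rule continuous_normal_deriv[OF dom w(2)])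
  have ivn: "integrable \<sigma> (\<lambda>x. v x * n x)" and iwn: "integrable \<sigma> (\<lambda>x. w x * n x)"
    using integrable_mult_continuous_surface[OF dom \<sigma> iv cn] integrable_mult_continuous_surface[OF dom \<sigma> iw cn]
    by metis+
  have est: "(LINT x|\<sigma>. w x * n x) \<le> - (1 / m * Bw\<^sup>2) \<and> - (1 / m * (Bv * Bw)) \<le> (LINT x|\<sigma>. v x * n x)"
  proof (cases "Bv = 0")
    txt \<open>Division by zero makes the coefficient of the normal derivative \<open>0\<close>, so \<open>w = 0\<close> on the boundary.\<close>
    case True
    then have w0: "w x = 0" if "x \<in> frontier \<Omega>" for x using bc[OF that] by (simp add: Bv_def)
    have "(LINT x|\<sigma>. w x * n x) = (LINT x|\<sigma>. 0)" "Bw = (LINT x|\<sigma>. 0)"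
      unfolding Bw_def
      by (rule Bochner_Integration.integral_cong[OF refl]; simp add: w0 surface_measureD(2)[OF \<sigma>])+
    moreover have "(LINT x|\<sigma>. v x * n x) = (LINT x|\<sigma>. 0)"
    proof (rule integral_cong_AE)
      have "AE x in \<sigma>. \<bar>v x\<bar> = 0"
        using True integral_nonneg_eq_0_iff_AE[OF integrable_abs[OF iv]] by (simp add: Bv_def)
      then show "AE x in \<sigma>. v x * n x = 0" by eventually_elim simp
    qed (use ivn in auto)
    ultimately show ?thesis by simp
  next
    case False
    then have Bv: "Bv > 0" using B0 by simp
    have b: "w x + m * \<bar>v x\<bar> / Bv * n x = 0" if "x \<in> space \<sigma>" for x
      using bc that by (simp add: n_def Bv_def surface_measureD(2)[OF \<sigma>])
    \<comment> \<open>With Bv and Bw equal to the boundary integrals, the pointwise bound integrates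
      to \<open>(Bw\<^sup>2 - 2 * Bw\<^sup>2) / m\<close>.\<close>
    have "(LINT x|\<sigma>. w x * n x) \<le> (LINT x|\<sigma>. (Bw\<^sup>2 / Bv * \<bar>v x\<bar> - 2 * Bw * \<bar>w x\<bar>) / m)"
      by (intro integral_mono iwn robin_boundary_estimates(1)[OF m Bv b])
        (use iv iw in \<open>auto intro!: Bochner_Integration.integrable_diff integrable_mult_right\<close>)
    also have "\<dots> = (Bw\<^sup>2 / Bv * Bv - 2 * Bw * Bw) / m"
      using iv iw by (simp add: Bv_def Bw_def)
    also have "\<dots> = - (1 / m * Bw\<^sup>2)"
      using Bv by (simp add: power2_eq_square)
    finally have 1: "(LINT x|\<sigma>. w x * n x) \<le> - (1 / m * Bw\<^sup>2)" .
    have "- (1 / m * (Bv * Bw)) = (LINT x|\<sigma>. - (Bv / m * \<bar>w x\<bar>))" by (simp add: Bw_def)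
    also have "\<dots> \<le> (LINT x|\<sigma>. v x * n x)"
      by (intro integral_mono ivn robin_boundary_estimates(2)[OF m Bv b]) (use iw in auto)
    finally show ?thesis using 1 by blast
  qed
  show "energy \<Omega> \<sigma> m w \<le> R * (LINT x:\<Omega>|lborel. v x * w x)"
    using green[OF w1] est unfolding energy_def Bw_def by (simp add: dot_square_norm)
  assume Rv: "R * (LINT x:\<Omega>|lborel. (v x)\<^sup>2) = energy \<Omega> \<sigma> m v"
  define Dv where "Dv = (LINT x:\<Omega>|lborel. (norm (grad v x))\<^sup>2)"
  define Dw where "Dw = (LINT x:\<Omega>|lborel. (norm (grad w x))\<^sup>2)"
  have iDv: "set_integrable lborel \<Omega> (\<lambda>x. (norm (grad v x))\<^sup>2)"
    and iDw: "set_integrable lborel \<Omega> (\<lambda>x. (norm (grad w x))\<^sup>2)"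
    using v(3) w1(2) by (simp_all add: in_H1_def)
  have "2 * (LINT x:\<Omega>|lborel. grad v x \<bullet> grad w x) = (LINT x:\<Omega>|lborel. 2 * (grad v x \<bullet> grad w x))"
    by (rule set_integral_mult_right[symmetric])
  also have "\<dots> \<le> (LINT x:\<Omega>|lborel. (norm (grad v x))\<^sup>2 + (norm (grad w x))\<^sup>2)"
  proof (rule set_integral_mono)
    show "set_integrable lborel \<Omega> (\<lambda>x. 2 * (grad v x \<bullet> grad w x))"
      by (rule set_integrable_mult_right) (rule Green_integrable(2)[OF dom w' v(1,3)])
    show "set_integrable lborel \<Omega> (\<lambda>x. (norm (grad v x))\<^sup>2 + (norm (grad w x))\<^sup>2)"
      by (rule set_integral_add(1)[OF iDv iDw])
    fix x
    have "0 \<le> (grad v x - grad w x) \<bullet> (grad v x - grad w x)" by simp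
    then show "2 * (grad v x \<bullet> grad w x) \<le> (norm (grad v x))\<^sup>2 + (norm (grad w x))\<^sup>2"
      unfolding power2_norm_eq_inner inner_diff_left inner_diff_right inner_commute[of "grad w x" "grad v x"]
      by linarith
  qed
  also have "\<dots> = Dv + Dw" unfolding Dv_def Dw_def by (rule set_integral_add(2)[OF iDv iDw])
  finally have D: "2 * (LINT x:\<Omega>|lborel. grad v x \<bullet> grad w x) \<le> Dv + Dw" .
  have "2 * (Bv * Bw) \<le> Bv\<^sup>2 + Bw\<^sup>2" using sum_squares_bound[of Bv Bw] by simp
  then have "1 / m * (2 * (Bv * Bw)) \<le> 1 / m * (Bv\<^sup>2 + Bw\<^sup>2)" using m by (intro mult_left_mono) auto
  then have B: "2 * (1 / m * (Bv * Bw)) \<le> 1 / m * Bv\<^sup>2 + 1 / m * Bw\<^sup>2"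
    by (simp add: add_divide_distrib)
  \<comment> \<open>In Green's identity tested with v, the volume term is R times the squared norm
    of v, which the premise turns into the energy of v.\<close>
  have "(LINT x:\<Omega>|lborel. grad v x \<bullet> grad w x) = energy \<Omega> \<sigma> m v + (LINT x|\<sigma>. v x * n x)"
    using green[OF v(1,3,4)] Rv by (simp add: power2_eq_square)
  moreover have "energy \<Omega> \<sigma> m v = Dv + 1 / m * Bv\<^sup>2" "energy \<Omega> \<sigma> m w = Dw + 1 / m * Bw\<^sup>2"
    by (simp_all add: energy_def Dv_def Dw_def Bv_def Bw_def)
  ultimately show "energy \<Omega> \<sigma> m v \<le> energy \<Omega> \<sigma> m w" using D B est by linarith
qed

section \<open>Induction along the iteration\<close>

text \<open>The iterates enter as any sequence that solves the boundary value problems. For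
  \<open>u 0\<close> membership in H^1 and the trace are assumptions; for later iterates they follow
  from C^1 regularity up to the boundary. Positivity of \<open>u 0\<close> makes energy and norm
  positive at the start, and from there their monotonicity carries positivity along.\<close>

theorem proposition4p1:
  fixes \<Omega> :: "(real ^ 'n) set"
    and \<sigma> :: "(real ^ 'n) measure"
    and m :: real
    and u h :: "nat \<Rightarrow> real ^ 'n \<Rightarrow> real"
  assumes "CARD('n) \<ge> 2"
    and "smooth_bounded_domain \<Omega>"
    and "surface_measure \<Omega> \<sigma>"
    and "m > 0"
    and "Ck_on 1 \<Omega> (u 0)"
    and "bounded (u 0 ` \<Omega>)"
    and "in_H1 \<Omega> (u 0)"
    and "has_trace \<Omega> \<sigma> (u 0) (u 0)"
    and "\<And>x. x \<in> closure \<Omega> \<Longrightarrow> u 0 x > 0"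
    and "\<And>k x. x \<in> frontier \<Omega> \<Longrightarrow> h k x = m * \<bar>u k x\<bar> / (LINT y|\<sigma>. \<bar>u k y\<bar>)"
    and "\<And>k. Ck_on 2 \<Omega> (u (Suc k))"
    and "\<And>k. C1_closure \<Omega> (u (Suc k))"
    and "\<And>k x. x \<in> \<Omega> \<Longrightarrow> - laplacian (u (Suc k)) x = R_functional \<Omega> \<sigma> m (u k) * u k x"
    and "\<And>k x. x \<in> frontier \<Omega> \<Longrightarrow> u (Suc k) x + h k x * normal_deriv \<Omega> (u (Suc k)) x = 0"
  shows "\<forall>k. R_functional \<Omega> \<sigma> m (u (Suc k)) * L2_norm \<Omega> (u (Suc k))
               \<le> R_functional \<Omega> \<sigma> m (u k) * L2_norm \<Omega> (u k) \<and>
             L2_norm \<Omega> (u k) \<le> L2_norm \<Omega> (u (Suc k)) \<and>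
             R_functional \<Omega> \<sigma> m (u (Suc k)) \<le> R_functional \<Omega> \<sigma> m (u k)"
proof -
  note dom = assms(2) and \<sigma> = assms(3) and m = assms(4)
  note \<Omega> = smooth_bounded_domainD[OF dom]
  define N where "N k = L2_norm \<Omega> (u k)" for k
  define E where "E k = energy \<Omega> \<sigma> m (u k)" for k
  define R where "R k = R_functional \<Omega> \<sigma> m (u k)" for k
  have RE: "R k = E k / (N k)\<^sup>2" for k by (simp add: R_def E_def N_def R_functional_eq)
  have reg: "C1_on \<Omega> (u k)" "bounded (u k ` \<Omega>)" "in_H1 \<Omega> (u k)" "has_trace \<Omega> \<sigma> (u k) (u k)" for k
  proof -
    have "C1_on \<Omega> (u k) \<and> bounded (u k ` \<Omega>) \<and> in_H1 \<Omega> (u k) \<and> has_trace \<Omega> \<sigma> (u k) (u k)"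
    proof (cases k)
      case 0
      then show ?thesis using assms(5-8) C1_on_iff_Ck_on by blast
    next
      case (Suc j)
      show ?thesis unfolding Suc
        by (intro conjI C1_closureD(1) C1_closure_bounded(1) C1_closure_in_H1 C1_closure_has_trace \<sigma> \<Omega>(1,2) assms(12))
    qed
    then show "C1_on \<Omega> (u k)" "bounded (u k ` \<Omega>)" "in_H1 \<Omega> (u k)" "has_trace \<Omega> \<sigma> (u k) (u k)" by auto
  qed
  have N0: "N k \<ge> 0" for k by (simp add: N_def L2_norm_nonneg)
  \<comment> \<open>Division by zero yields 0, so \<open>R k\<close> is a genuine positive quotient
    only if \<open>E k\<close> and \<open>N k\<close> are positive; the cancellation below rests on
    this.\<close>
  have step: "E (Suc k) \<le> R k * N k * N (Suc k) \<and> E k \<le> E (Suc k) \<and> N k \<le> N (Suc k)"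
    if pos: "E k > 0" "N k > 0" for k
  proof -
    have R: "R k > 0" using pos by (simp add: RE)
    have Rv: "R k * (LINT x:\<Omega>|lborel. (u k x)\<^sup>2) = energy \<Omega> \<sigma> m (u k)"
      using pos by (simp add: RE E_def N_def flip: L2_norm_square)
    have bc: "u (Suc k) x + m * \<bar>u k x\<bar> / (LINT y|\<sigma>. \<bar>u k y\<bar>) * normal_deriv \<Omega> (u (Suc k)) x = 0"
      if "x \<in> frontier \<Omega>" for x
      using assms(14)[OF that, of k] assms(10)[OF that, of k] by simp
    note s = energy_iteration_step[OF dom \<sigma> m reg assms(11) assms(12) assms(13)[folded R_def] bc]
    have "E (Suc k) \<le> R k * (LINT x:\<Omega>|lborel. u k x * u (Suc k) x)" unfolding E_def by (rule s(1))
    also have "\<dots> \<le> R k * (N k * N (Suc k))"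
      unfolding N_def using R pos(2)
      by (intro mult_left_mono L2_Cauchy_Schwarz[OF \<Omega>(1) reg(1,3) reg(1,3)]) (auto simp: N_def)
    finally have 1: "E (Suc k) \<le> R k * N k * N (Suc k)" by (simp add: mult.assoc)
    have 2: "E k \<le> E (Suc k)" unfolding E_def by (rule s(2)[OF _ _ Rv])
    \<comment> \<open>With this identity,
      \<open>E k \<le> E (Suc k) \<le> R k * N k * N (Suc k)\<close> reduces to monotonicity of the
      norms after cancelling \<open>R k * N k\<close>.\<close>
    have "R k * N k * N k = E k" using pos by (simp add: RE power2_eq_square)
    with 1 2 have "R k * N k * N k \<le> R k * N k * N (Suc k)" by linarith
    then have "N k \<le> N (Suc k)" using R pos(2) by (simp add: mult_le_cancel_left_pos)
    with 1 2 show ?thesis by blast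
  qed
  have pos: "E k > 0 \<and> N k > 0" for k
  proof (induction k)
    case 0
    have "E 0 > 0"
      unfolding E_def by (rule energy_pos[OF dom \<sigma> m has_trace_integrable[OF dom \<sigma> reg(4)]])
        (use assms(9) in \<open>auto simp: frontier_def\<close>)
    moreover have "N 0 > 0"
      unfolding N_def by (rule L2_norm_pos[OF dom reg(3)]) (use assms(9) closure_subset in blast)
    ultimately show ?case by blast
  next
    case (Suc k)
    then show ?case using step[of k] by linarith
  qed
  show ?thesis
    unfolding R_def[symmetric] N_def[symmetric]
  proof (intro allI conjI)
    fix k
    have p: "E k > 0" "N k > 0" "N (Suc k) > 0" using pos by blast+
    have s: "E (Suc k) \<le> R k * N k * N (Suc k)" "N k \<le> N (Suc k)" using step[OF p(1,2)] by blast+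
    have "R (Suc k) * N (Suc k) = E (Suc k) / N (Suc k)" using p by (simp add: RE power2_eq_square)
    also have "\<dots> \<le> R k * N k" using s(1) p(3) by (simp add: pos_divide_le_eq)
    finally show 1: "R (Suc k) * N (Suc k) \<le> R k * N k" .
    show "N k \<le> N (Suc k)" by (rule s(2))
    have "R k \<ge> 0" using p by (simp add: RE)
    \<comment> \<open>The first inequality has different norms on its two sides; enlarging the right
      one to \<open>N (Suc k)\<close> gives a common factor to cancel.\<close>
    with s(2) have "R k * N k \<le> R k * N (Suc k)" by (rule mult_left_mono)
    with 1 have "R (Suc k) * N (Suc k) \<le> R k * N (Suc k)" by linarith
    then show "R (Suc k) \<le> R k" using p(3) by simp
  qed
qed

end
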